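(* Let $\lambda$ be a dominant weight of $U_q(sp_{2n})$ and let $T\in\mathbf{ST}(n,\lambda)$. The expansion of the monomial vector $A(T)$ on the basis $\{v_\tau\mid\tau\in\mathbf{T}(n,\lambda)\}$ of $W(\lambda)$ is of the form $A(T)=\sum_\tau\alpha_{\tau,T}(q)v_\tau$ where the coefficients $\alpha_{\tau,T}(q)$ satisfy: (i) $\alpha_{\tau,T}(q)\neq0$ only if $\tau$ and $T$ have the same weight; (ii) $\alpha_{\tau,T}(q)\in\mathbb{N}[q,q^{-1}]$ and $\alpha_{T,T}(q)=1$; (iii) $\alpha_{\tau,T}(q)\neq0$ only if $\tau\trianglelefteq T$.
   Context: **Quantum group.** $n$ is a positive integer. $U_q(sp_{2n})$ is the associative $\mathbb{C}(q)$-algebra generated by $e_i,f_i,q^{h_i},q^{-h_i}$ ($1\le i\le n$) with relations: $q^{h_i}q^{-h_i}=q^{-h_i}q^{h_i}=1$; the $q^{\pm h_i}$ commute; $q^{h_i}e_jq^{-h_i}=q^{a_{i,j}}e_j$; $q^{h_i}f_jq^{-h_i}=q^{-a_{i,j}}f_j$; $[e_i,f_j]=\delta_{i,j}\frac{t_i-t_i^{-1}}{q_i-q_i^{-1}}$; and for $i\ne j$, $\sum_{k=0}^{1-a_{i,j}}(-1)^k e_i^{(k)}e_je_i^{(1-a_{i,j}-k)}=0=\sum_{k=0}^{1-a_{i,j}}(-1)^k f_i^{(k)}f_jf_i^{(1-a_{i,j}-k)}$. Here $a_{i,i}=2$, $a_{n-1,n}=-2$, $a_{i,j}=-1$ for all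 other pairs with $|i-j|=1$, and $a_{i,j}=0$ if $|i-j|\ge2$; $q_i=q$, $t_i=q^{h_i}$ for $i<n$; $q_n=q^2$, $t_n=q^{2h_n}$; $[m]_i=\frac{q_i^m-q_i^{-m}}{q_i-q_i^{-1}}$, $[m]_i!=[m]_i\cdots[1]_i$, $e_i^{(m)}=e_i^m/[m]_i!$, $f_i^{(m)}=f_i^m/[m]_i!$. Tensor products of modules: $q^{h_i}(u\otimes v)=q^{h_i}u\otimes q^{h_i}v$, $e_i(u\otimes v)=e_iu\otimes t_i^{-1}v+u\otimes e_iv$, $f_i(u\otimes v)=f_iu\otimes v+t_iu\otimes f_iv$. $\Lambda_1,\dots,\Lambda_n$ are the fundamental weights; a dominant weight is $\lambda=\sum_p\lambda_p\Lambda_p$ with $\lambda_p\in\mathbb{N}$ ($0\in\mathbb{N}$). A vector $v$ has weight $\mu=\sum\mu_i\Lambda_i$ if $q^{h_i}v=q^{\mu_i}v$ for all $i$. **Columns.** $\mathcal{C}_n=\{1<\dots<n<\overline n<\dots<\overline1\}$ is a totally ordered alphabet; letters $\le n$ are called unbarred. A column of height $p$ is a subset of $\mathcal{C}_n$ of cardinality $p$ (written as a vertical strip strictly increasing from top to bottom); $\mathbf{C}(n,p)$ is the set of all of them; the reading $\mathrm{w}(C)$ is the word of its letters from top to bottom. $C_p^0=\{1,\dots,p\}$ is the column of highest weight of height $p$. Write $C-\{a\}+\{b\}=(C\setminus\{a\})\cup\{b\}$. For columns, $C_1\le C_2$ means $h(C_1)\ge h(C_2)$ ($h$ = height) and the rows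 of the top-justified two-column array $C_1C_2$ weakly increase from left to right. A letter $x\in C$, $x\ne1$, is movable in $C$ if the predecessor of $x$ in $\mathcal{C}_n$ is not in $C$ (the letter $1$ is never movable). **Admissible columns.** For a column $C$ let $I_C=\{z_1>\dots>z_r\}$ be the set of unbarred $z$ with $z,\overline z\in C$. $C$ is admissible if there exist unbarred letters $t_1>\dots>t_r$ such that $t_1$ is the greatest letter with $t_1<z_1$, $t_1\notin C$, $\overline{t_1}\notin C$, and for $i\ge2$, $t_i$ is the greatest letter with $t_i<\min(t_{i-1},z_i)$, $t_i\notin C$, $\overline{t_i}\notin C$. Then $rC$ is the column obtained from $C$ by changing each $\overline{z_i}$ into $\overline{t_i}$, and $lC$ the column obtained from $C$ by changing each $z_i$ into $t_i$. **The module $W(\Lambda_p)$, $1\le p\le n$.** It is the $\mathbb{C}(q)$-vector space with basis $\{v_C\mid C\in\mathbf{C}(n,p)\}$ and the following action. For $i<n$ put $E=C\cap\{i,i+1,\overline{i+1},\overline i\}$. Then $q^{h_i}v_C=q^{m}v_C$ with $m=|C\cap\{i,\overline{i+1}\}|-|C\cap\{i+1,\overline i\}|$, and: - $f_iv_C=v_{C-\{i\}+\{i+1\}}$ if $E=\{i\}$, $\{\overline{i+1},\overline i,i\}$ or $\{\overline i,i\}$; $f_iv_C=v_{C-\{\overline{i+1}\}+\{\overline i\}}$ if $E=\{\overline{i+1}\}$ or $\{\overline{i+1},i,i+1\}$; $f_iv_C=q^{-1}v_{C-\{\overline{i+1}\}+\{\overline i\}}$ if $E=\{\overline{i+1},i+1\}$;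 $f_iv_C=v_{C-\{i\}+\{i+1\}}+q\,v_{C-\{\overline{i+1}\}+\{\overline i\}}$ if $E=\{\overline{i+1},i\}$; $f_iv_C=0$ otherwise. - $e_iv_C=v_{C-\{i+1\}+\{i\}}$ if $E=\{i+1\}$ or $\{\overline{i+1},\overline i,i+1\}$; $e_iv_C=v_{C-\{\overline i\}+\{\overline{i+1}\}}$ if $E=\{\overline i\}$, $\{\overline i,i,i+1\}$ or $\{\overline i,i\}$; $e_iv_C=q^{-1}v_{C-\{i+1\}+\{i\}}$ if $E=\{\overline{i+1},i+1\}$; $e_iv_C=v_{C-\{\overline i\}+\{\overline{i+1}\}}+q\,v_{C-\{i+1\}+\{i\}}$ if $E=\{\overline i,i+1\}$; $e_iv_C=0$ otherwise. For $i=n$: $q^{h_n}v_C=q^{m}v_C$ with $m=|C\cap\{n\}|-|C\cap\{\overline n\}|$; $f_nv_C=v_{C-\{n\}+\{\overline n\}}$ if $n\in C,\overline n\notin C$, and $0$ otherwise; $e_nv_C=v_{C-\{\overline n\}+\{n\}}$ if $\overline n\in C,n\notin C$, and $0$ otherwise. **Tabloids, symplectic tableaux, $W(\lambda)$.** The Young diagram $Y(\lambda)$ has $\lambda_p$ columns of height $p$ for each $p$, arranged with heights weakly decreasing from left to right. A tabloid of shape $\lambda$ is a sequence $\tau=C_1\cdots C_r$ of columns (left to right) filling $Y(\lambda)$, with no further condition; $\mathbf{T}(n,\lambda)$ is the set of them. Put $\mathrm{w}(\tau)=\mathrm{w}(C_r)\cdots\mathrm{w}(C_1)$. A symplectic tableau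 of shape $\lambda$ is a tabloid $C_1\cdots C_r$ with all $C_i$ admissible and $rC_i\le lC_{i+1}$ for $1\le i<r$; $\mathbf{ST}(n,\lambda)$ is the set of them. $W(\lambda)=W(\Lambda_1)^{\otimes\lambda_1}\otimes\cdots\otimes W(\Lambda_n)^{\otimes\lambda_n}$ has basis $v_\tau=v_{C_r}\otimes\cdots\otimes v_{C_1}$, $\tau=C_1\cdots C_r\in\mathbf{T}(n,\lambda)$. The weight of $\tau$ is the weight of $v_\tau$. The total order on $\mathbf{T}(n,\lambda)$ is: $\tau_1\trianglelefteq\tau_2$ iff $\mathrm{w}(\tau_1)$ is lexicographically less than or equal to $\mathrm{w}(\tau_2)$ (letters compared in $\mathcal{C}_n$). $T_\lambda$ is the tabloid of shape $\lambda$ whose $k$-th row is filled with letters $k$, and $v_\lambda=v_{T_\lambda}$; $V(\lambda)=U_q(sp_{2n})v_\lambda\subset W(\lambda)$ is the irreducible module of highest weight $\lambda$. **Definition of $A(T)$.** $A(T_\lambda)=v_\lambda$. Let $T=C_1\cdots C_l\in\mathbf{ST}(n,\lambda)$, $T\ne T_\lambda$. Let $C_k$ be the rightmost column of $T$ that is not of highest weight, $x$ the smallest movable letter of $C_k$, and $i\in\{1,\dots,n\}$ the index with $x=i+1$ (if $x\le n$, so $i<n$) or $x=\overline i$ (if $x$ is barred). Below, for $i=n$, read $\{\overline i,i+1\}$ as $\{\overline n\}$ and $\{\overline{i+1},i\}$ as $\{n\}$. Let $y$ be the rightmost letter of $\mathrm{w}(T)$, at or to the right of the occurrence of $x$ coming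 from $C_k$, such that $y\in\{\overline i,i+1\}$ and the factor $x\cdots y$ of $\mathrm{w}(T)$ contains no letter of $\{\overline{i+1},i\}$. Set $i_1=i$, let $r_1$ be the number of letters of $\{\overline i,i+1\}$ in the factor $x\cdots y$, and let $T_1$ be the tabloid obtained from $T$ by changing, in this factor, each $\overline i$ into $\overline{i+1}$ and each $i+1$ into $i$ if $i\ne n$, and each $\overline n$ into $n$ if $i=n$. Then $T_1\in\mathbf{ST}(n,\lambda)$. Repeat with $T_1$ to get $i_2,r_2,T_2$, and so on until $T_s=T_\lambda$. Put $A(T)=f_{i_1}^{(r_1)}\cdots f_{i_s}^{(r_s)}v_\lambda$. *)

theory Defs
  imports
    "HOL-Library.Poly_Mapping"
    "HOL-Computational_Algebra.Computational_Algebra"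
begin

section \<open>Letters, columns and tabloids\<close>

datatype letter = Unbar nat | Bar nat

text \<open>The order 1 < 2 < ... < n < Bar n < ... < Bar 2 < Bar 1.\<close>

instantiation letter :: linorder
begin

fun less_letter :: "letter \<Rightarrow> letter \<Rightarrow> bool" where
  "less_letter (Unbar i) (Unbar j) \<longleftrightarrow> i < j"
| "less_letter (Unbar i) (Bar j) \<longleftrightarrow> True"
| "less_letter (Bar i) (Unbar j) \<longleftrightarrow> False"
| "less_letter (Bar i) (Bar j) \<longleftrightarrow> j < i"

definition less_eq_letter :: "letter \<Rightarrow> letter \<Rightarrow> bool" where
  "less_eq_letter x y \<longleftrightarrow> x < y \<or> x = y"

instance
proof
  fix x y z :: letter
  show "x < y \<longleftrightarrow> x \<le> y \<and> \<not> y \<le> x"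
    by (cases x; cases y) (auto simp: less_eq_letter_def)
  show "x \<le> x"
    by (simp add: less_eq_letter_def)
  show "x \<le> y \<Longrightarrow> y \<le> z \<Longrightarrow> x \<le> z"
    by (cases x; cases y; cases z) (auto simp: less_eq_letter_def)
  show "x \<le> y \<Longrightarrow> y \<le> x \<Longrightarrow> x = y"
    by (cases x; cases y) (auto simp: less_eq_letter_def)
  show "x \<le> y \<or> y \<le> x"
    by (cases x; cases y) (auto simp: less_eq_letter_def)
qed

end

type_synonym column = "letter set"

text \<open>A tabloid is the list of its columns from left to right.\<close>

type_synonym tabloid = "letter set list"

definition alphabet :: "nat \<Rightarrow> letter set" where
  "alphabet n = Unbar ` {1..n} \<union> Bar ` {1..n}"

definition columns :: "nat \<Rightarrow> nat \<Rightarrow> column set" where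
  "columns n p = {C. C \<subseteq> alphabet n \<and> card C = p}"

definition col_word :: "column \<Rightarrow> letter list" where
  "col_word C = sorted_list_of_set C"

definition word :: "tabloid \<Rightarrow> letter list" where
  "word \<tau> = concat (map col_word (rev \<tau>))"

definition hw_column :: "nat \<Rightarrow> column" where
  "hw_column p = Unbar ` {1..p}"

text \<open>A dominant weight is given by its coefficients \<open>lam p\<close> on the fundamental weights,
  for \<open>1 \<le> p \<le> n\<close>; values outside this range play no role.  The heights of the columns of the
  Young diagram, from left to right:\<close>

definition heights :: "nat \<Rightarrow> (nat \<Rightarrow> nat) \<Rightarrow> nat list" where
  "heights n lam = concat (map (\<lambda>p. replicate (lam p) p) (rev [1..<Suc n]))"

definition tabloids :: "nat \<Rightarrow> (nat \<Rightarrow> nat) \<Rightarrow> tabloid set" where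
  "tabloids n lam = {\<tau>. list_all2 (\<lambda>C p. C \<in> columns n p) \<tau> (heights n lam)}"

definition hw_tabloid :: "nat \<Rightarrow> (nat \<Rightarrow> nat) \<Rightarrow> tabloid" where
  "hw_tabloid n lam = map hw_column (heights n lam)"

definition tabloid_le :: "tabloid \<Rightarrow> tabloid \<Rightarrow> bool" where
  "tabloid_le \<tau>1 \<tau>2 \<longleftrightarrow> lexordp_eq (word \<tau>1) (word \<tau>2)"

lemma finite_tabloids: "finite (tabloids n lam)"
proof -
  have "finite (alphabet n)"
    by (simp add: alphabet_def)
  then have "finite {\<tau>. set \<tau> \<subseteq> Pow (alphabet n) \<and> length \<tau> = length (heights n lam)}"
    by (intro finite_lists_length_eq) simp
  moreover have "tabloids n lam \<subseteq>
      {\<tau>. set \<tau> \<subseteq> Pow (alphabet n) \<and> length \<tau> = length (heights n lam)}"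
    by (auto simp: tabloids_def columns_def list_all2_conv_all_nth in_set_conv_nth subset_iff)
  ultimately show ?thesis
    by (rule finite_subset[rotated])
qed


section \<open>Symplectic tableaux\<close>

text \<open>The list of the z in \<open>I\<^sub>C\<close> in decreasing order.\<close>

definition pairs_of :: "column \<Rightarrow> nat list" where
  "pairs_of C = rev (sorted_list_of_set {z. Unbar z \<in> C \<and> Bar z \<in> C})"

definition is_greatest :: "nat set \<Rightarrow> nat \<Rightarrow> bool" where
  "is_greatest S t \<longleftrightarrow> t \<in> S \<and> (\<forall>s\<in>S. s \<le> t)"

definition is_splitting :: "column \<Rightarrow> nat list \<Rightarrow> bool" where
  "is_splitting C ts \<longleftrightarrow>
     (let zs = pairs_of C in
      length ts = length zs \<and>
      (\<forall>k<length zs.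
         is_greatest
           {t. 1 \<le> t \<and> t < (if k = 0 then zs ! 0 else min (ts ! (k - 1)) (zs ! k)) \<and>
               Unbar t \<notin> C \<and> Bar t \<notin> C}
           (ts ! k)))"

definition admissible :: "column \<Rightarrow> bool" where
  "admissible C \<longleftrightarrow> (\<exists>ts. is_splitting C ts)"

text \<open>For an admissible column the list of the t's is uniquely determined.\<close>

definition splitting :: "column \<Rightarrow> nat list" where
  "splitting C = (THE ts. is_splitting C ts)"

definition rcol :: "column \<Rightarrow> column" where
  "rcol C = (C - Bar ` set (pairs_of C)) \<union> Bar ` set (splitting C)"

definition lcol :: "column \<Rightarrow> column" where
  "lcol C = (C - Unbar ` set (pairs_of C)) \<union> Unbar ` set (splitting C)"

definition col_le :: "column \<Rightarrow> column \<Rightarrow> bool" where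
  "col_le C D \<longleftrightarrow> card D \<le> card C \<and> (\<forall>k<card D. col_word C ! k \<le> col_word D ! k)"

definition symplectic_tableaux :: "nat \<Rightarrow> (nat \<Rightarrow> nat) \<Rightarrow> tabloid set" where
  "symplectic_tableaux n lam =
     {T \<in> tabloids n lam.
        (\<forall>C\<in>set T. admissible C) \<and>
        (\<forall>k. Suc k < length T \<longrightarrow> col_le (rcol (T ! k)) (lcol (T ! Suc k)))}"


section \<open>The action of the quantum group\<close>

text \<open>The field C(q), and free vector spaces over it as finitely supported functions.\<close>

type_synonym ratfun = "complex poly fract"

definition q :: ratfun where
  "q = Fract [:0, 1:] 1"

definition scale :: "ratfun \<Rightarrow> ('a \<Rightarrow>\<^sub>0 ratfun) \<Rightarrow> ('a \<Rightarrow>\<^sub>0 ratfun)" where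
  "scale c v = Poly_Mapping.map ((*) c) v"

definition basis_vec :: "'a \<Rightarrow> ('a \<Rightarrow>\<^sub>0 ratfun)" where
  "basis_vec b = Poly_Mapping.single b 1"

definition lin_extend :: "('a \<Rightarrow> ('b \<Rightarrow>\<^sub>0 ratfun)) \<Rightarrow> ('a \<Rightarrow>\<^sub>0 ratfun) \<Rightarrow> ('b \<Rightarrow>\<^sub>0 ratfun)" where
  "lin_extend g v = (\<Sum>b\<in>Poly_Mapping.keys v. scale (Poly_Mapping.lookup v b) (g b))"

text \<open>Since \<open>v\<^sub>\<tau>\<close> for \<open>\<tau> = C\<^sub>1 \<dots> C\<^sub>r\<close> is the tensor product of the \<open>v\<^sub>C\<close> in the order
  \<open>C\<^sub>r, \<dots>, C\<^sub>1\<close>, adding a column on the left of a tabloid adds a tensor factor on the right: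
  the tensor product of \<open>basis_vec \<tau>\<close> and \<open>basis_vec C\<close> is \<open>basis_vec (C # \<tau>)\<close>.\<close>

definition tensor ::
    "(tabloid \<Rightarrow>\<^sub>0 ratfun) \<Rightarrow> (column \<Rightarrow>\<^sub>0 ratfun) \<Rightarrow> (tabloid \<Rightarrow>\<^sub>0 ratfun)" where
  "tensor u v = lin_extend (\<lambda>\<tau>. lin_extend (\<lambda>C. basis_vec (C # \<tau>)) v) u"

definition col_exponent :: "nat \<Rightarrow> nat \<Rightarrow> column \<Rightarrow> int" where
  "col_exponent n i C =
     (if i < n
      then int (card (C \<inter> {Unbar i, Bar (i + 1)})) - int (card (C \<inter> {Unbar (i + 1), Bar i}))
      else int (card (C \<inter> {Unbar n})) - int (card (C \<inter> {Bar n})))"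

definition qh_col :: "nat \<Rightarrow> nat \<Rightarrow> column \<Rightarrow> (column \<Rightarrow>\<^sub>0 ratfun)" where
  "qh_col n i C = scale (q powi col_exponent n i C) (basis_vec C)"

definition f_col :: "nat \<Rightarrow> nat \<Rightarrow> column \<Rightarrow> (column \<Rightarrow>\<^sub>0 ratfun)" where
  "f_col n i C =
     (if i < n then
        let E = C \<inter> {Unbar i, Unbar (i + 1), Bar (i + 1), Bar i};
            u = basis_vec (C - {Unbar i} \<union> {Unbar (i + 1)});
            b = basis_vec (C - {Bar (i + 1)} \<union> {Bar i})
        in
          if E = {Unbar i} \<or> E = {Bar (i + 1), Bar i, Unbar i} \<or> E = {Bar i, Unbar i} then u
          else if E = {Bar (i + 1)} \<or> E = {Bar (i + 1), Unbar i, Unbar (i + 1)} then b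
          else if E = {Bar (i + 1), Unbar (i + 1)} then scale (q powi (-1)) b
          else if E = {Bar (i + 1), Unbar i} then u + scale q b
          else 0
      else if Unbar n \<in> C \<and> Bar n \<notin> C then basis_vec (C - {Unbar n} \<union> {Bar n})
      else 0)"

text \<open>The empty tabloid spans the trivial module.\<close>

fun qh_tab :: "nat \<Rightarrow> nat \<Rightarrow> tabloid \<Rightarrow> (tabloid \<Rightarrow>\<^sub>0 ratfun)" where
  "qh_tab n i [] = basis_vec []"
| "qh_tab n i (C # \<tau>) = tensor (qh_tab n i \<tau>) (qh_col n i C)"

definition qh :: "nat \<Rightarrow> nat \<Rightarrow> (tabloid \<Rightarrow>\<^sub>0 ratfun) \<Rightarrow> (tabloid \<Rightarrow>\<^sub>0 ratfun)" where
  "qh n i = lin_extend (qh_tab n i)"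

definition t_op :: "nat \<Rightarrow> nat \<Rightarrow> (tabloid \<Rightarrow>\<^sub>0 ratfun) \<Rightarrow> (tabloid \<Rightarrow>\<^sub>0 ratfun)" where
  "t_op n i v = (if i < n then qh n i v else qh n n (qh n n v))"

fun f_tab :: "nat \<Rightarrow> nat \<Rightarrow> tabloid \<Rightarrow> (tabloid \<Rightarrow>\<^sub>0 ratfun)" where
  "f_tab n i [] = 0"
| "f_tab n i (C # \<tau>) =
     tensor (f_tab n i \<tau>) (basis_vec C) + tensor (t_op n i (basis_vec \<tau>)) (f_col n i C)"

definition f_op :: "nat \<Rightarrow> nat \<Rightarrow> (tabloid \<Rightarrow>\<^sub>0 ratfun) \<Rightarrow> (tabloid \<Rightarrow>\<^sub>0 ratfun)" where
  "f_op n i = lin_extend (f_tab n i)"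

definition q_idx :: "nat \<Rightarrow> nat \<Rightarrow> ratfun" where
  "q_idx n i = (if i < n then q else q ^ 2)"

definition q_int :: "nat \<Rightarrow> nat \<Rightarrow> nat \<Rightarrow> ratfun" where
  "q_int n i m =
     (q_idx n i powi int m - q_idx n i powi (- int m)) / (q_idx n i - q_idx n i powi (-1))"

definition q_fact :: "nat \<Rightarrow> nat \<Rightarrow> nat \<Rightarrow> ratfun" where
  "q_fact n i m = (\<Prod>k=1..m. q_int n i k)"

definition f_div :: "nat \<Rightarrow> nat \<Rightarrow> nat \<Rightarrow> (tabloid \<Rightarrow>\<^sub>0 ratfun) \<Rightarrow> (tabloid \<Rightarrow>\<^sub>0 ratfun)" where
  "f_div n i r v = scale (1 / q_fact n i r) ((f_op n i ^^ r) v)"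

definition has_weight :: "nat \<Rightarrow> (tabloid \<Rightarrow>\<^sub>0 ratfun) \<Rightarrow> (nat \<Rightarrow> int) \<Rightarrow> bool" where
  "has_weight n v \<mu> \<longleftrightarrow> (\<forall>i\<in>{1..n}. qh n i v = scale (q powi \<mu> i) v)"

definition same_weight :: "nat \<Rightarrow> tabloid \<Rightarrow> tabloid \<Rightarrow> bool" where
  "same_weight n \<tau>1 \<tau>2 \<longleftrightarrow>
     (\<exists>\<mu>. has_weight n (basis_vec \<tau>1) \<mu> \<and> has_weight n (basis_vec \<tau>2) \<mu>)"

text \<open>The Laurent polynomials in q with coefficients in the natural numbers.\<close>

definition nat_laurent :: "ratfun set" where
  "nat_laurent = {\<Sum>m\<in>S. of_nat (c m) * q powi m | (c :: int \<Rightarrow> nat) S. finite S}"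


section \<open>The monomial vectors\<close>

fun pred_letter :: "nat \<Rightarrow> letter \<Rightarrow> letter" where
  "pred_letter n (Unbar i) = Unbar (i - 1)"
| "pred_letter n (Bar i) = (if i = n then Unbar n else Bar (i + 1))"

definition movable :: "nat \<Rightarrow> column \<Rightarrow> letter \<Rightarrow> bool" where
  "movable n C x \<longleftrightarrow> x \<in> C \<and> x \<noteq> Unbar 1 \<and> pred_letter n x \<notin> C"

text \<open>Columns are numbered from 0.\<close>

definition active_col :: "tabloid \<Rightarrow> nat" where
  "active_col T = Max {k. k < length T \<and> T ! k \<noteq> hw_column (card (T ! k))}"

definition active_letter :: "nat \<Rightarrow> tabloid \<Rightarrow> letter" where
  "active_letter n T = Min {x. movable n (T ! active_col T) x}"

definition active_idx :: "nat \<Rightarrow> tabloid \<Rightarrow> nat" where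
  "active_idx n T = (case active_letter n T of Unbar j \<Rightarrow> j - 1 | Bar j \<Rightarrow> j)"

definition raised_letters :: "nat \<Rightarrow> nat \<Rightarrow> letter set" where
  "raised_letters n i = (if i = n then {Bar n} else {Bar i, Unbar (i + 1)})"

definition blocking_letters :: "nat \<Rightarrow> nat \<Rightarrow> letter set" where
  "blocking_letters n i = (if i = n then {Unbar n} else {Bar (i + 1), Unbar i})"

text \<open>The index in \<open>word T\<close> (from 0) of the occurrence of the letter \<open>a\<close> coming from the
  column \<open>T ! j\<close>: the columns to the right of it are read first.\<close>

definition word_pos :: "tabloid \<Rightarrow> nat \<Rightarrow> letter \<Rightarrow> nat" where
  "word_pos T j a = (\<Sum>l\<in>{j<..<length T}. card (T ! l)) + card {b \<in> T ! j. b < a}"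

text \<open>The indices in \<open>word T\<close> of the letters x and y delimiting the factor to be changed.\<close>

definition start_pos :: "nat \<Rightarrow> tabloid \<Rightarrow> nat" where
  "start_pos n T = word_pos T (active_col T) (active_letter n T)"

definition end_pos :: "nat \<Rightarrow> tabloid \<Rightarrow> nat" where
  "end_pos n T = Max {p. start_pos n T \<le> p \<and> p < length (word T) \<and>
     word T ! p \<in> raised_letters n (active_idx n T) \<and>
     (\<forall>m\<in>{start_pos n T..p}. word T ! m \<notin> blocking_letters n (active_idx n T))}"

definition raise_count :: "nat \<Rightarrow> tabloid \<Rightarrow> nat" where
  "raise_count n T = card {m \<in> {start_pos n T..end_pos n T}.
     word T ! m \<in> raised_letters n (active_idx n T)}"

definition next_tabloid :: "nat \<Rightarrow> tabloid \<Rightarrow> tabloid" where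
  "next_tabloid n T =
     map (\<lambda>j. (\<lambda>a. if word_pos T j a \<in> {start_pos n T..end_pos n T} \<and>
                       a \<in> raised_letters n (active_idx n T)
                    then pred_letter n a else a) ` (T ! j))
       [0..<length T]"

text \<open>The number s of steps needed to reach the tabloid of highest weight.\<close>

definition step_count :: "nat \<Rightarrow> (nat \<Rightarrow> nat) \<Rightarrow> tabloid \<Rightarrow> nat" where
  "step_count n lam T = (LEAST s. (next_tabloid n ^^ s) T = hw_tabloid n lam)"

definition monomial_vector :: "nat \<Rightarrow> (nat \<Rightarrow> nat) \<Rightarrow> tabloid \<Rightarrow> (tabloid \<Rightarrow>\<^sub>0 ratfun)" where
  "monomial_vector n lam T =
     foldr (\<lambda>k. f_div n (active_idx n ((next_tabloid n ^^ k) T))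
                       (raise_count n ((next_tabloid n ^^ k) T)))
       [0..<step_count n lam T] (basis_vec (hw_tabloid n lam))"

end

theory Submission
  imports Defs
begin

text \<open>A(T) is the divided power of \<open>f\<^sub>i\<close> of order r applied to A(T'), where T' arises from T by
  raising the r letters of \<open>raised_letters n i\<close> in the longest prefix of the word of T free of
  \<open>blocking_letters n i\<close>.  Divided powers act on the basis by positive Laurent polynomials, and each
  term of the image of a basis vector lowers r letters of its word.  The letters that lead from T'
  back to T are the leftmost r letters of T' that can be lowered, so T is the lexicographically
  largest word reached from words not above that of T', it is reached from T' only, and no power of
  q enters since the factors to the left of a lowered letter have been lowered completely.

  That the steps end in the tabloid of highest weight follows from an invariant weaker than
  symplecticity: the columns carry pairs (L, R), modelled on (lC, rC), with each R below the next L.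
  Raising C amounts to applying a simple reflection to L or R where this makes letters smaller,
  and the column order lifts along such reflections as the Bruhat order does.\<close>

text \<open>The definition of A(T) asserts that each step stays among symplectic tableaux and that
  the steps end; neither may be taken for granted. Symplecticity is awkward to propagate because the
  letters t of a split column are chosen greedily. \<open>split_col\<close> keeps only
  (in)equalities between prefix counts, and a simple reflection changes prefix counts at two
  positions at most. That the intermediate tabloids are symplectic is never shown: the weaker
  invariant already locates the active letter, and the total rank of the letters drops at every
  step. The second obstacle is positivity, which is invisible in a power of f_i divided by a quantum
  factorial. \<open>fdiv_tab\<close> gives the divided powers on a tensor product in a closed form
  free of denominators, and the recursion f_i f_i^(r) = [r+1]_i f_i^(r+1) identifies it with
  \<open>f_div\<close>. On names: \<open>raised_letters n i\<close> are the letters that e_i moves,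
  and \<open>blocking_letters n i\<close> are their predecessors, the letters that f_i
  moves.\<close>

section \<open>Free vector spaces\<close>

lemma lookup_scale [simp]:
  "Poly_Mapping.lookup (scale c v) x = c * Poly_Mapping.lookup v x"
  by (simp add: scale_def Poly_Mapping.map.rep_eq when_def)

lemma lookup_basis_vec:
  "Poly_Mapping.lookup (basis_vec b) x = (if x = b then 1 else 0)"
  by (auto simp: basis_vec_def lookup_single when_def)

lemma scale_zero_right [simp]: "scale c 0 = 0"
  and scale_zero_left [simp]: "scale 0 v = 0"
  and scale_one [simp]: "scale 1 v = v"
  and scale_scale [simp]: "scale a (scale b v) = scale (a * b) v"
  and scale_add_right: "scale c (u + v) = scale c u + scale c v"
  and scale_add_left: "scale (a + b) v = scale a v + scale b v"
  by (rule poly_mapping_eqI; simp add: lookup_add algebra_simps)+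

lemma scale_sum: "scale c (sum h S) = (\<Sum>x\<in>S. scale c (h x))"
  by (induction S rule: infinite_finite_induct) (simp_all add: scale_add_right)

lemma lin_extend_superset:
  assumes "finite S" "Poly_Mapping.keys v \<subseteq> S"
  shows "lin_extend g v = (\<Sum>b\<in>S. scale (Poly_Mapping.lookup v b) (g b))"
  unfolding lin_extend_def
  by (rule sum.mono_neutral_left) (use assms in \<open>auto simp: in_keys_iff\<close>)

lemma lin_extend_add: "lin_extend g (u + v) = lin_extend g u + lin_extend g v"
proof -
  let ?S = "Poly_Mapping.keys u \<union> Poly_Mapping.keys v"
  have "lin_extend g (u + v) = (\<Sum>b\<in>?S. scale (Poly_Mapping.lookup (u + v) b) (g b))"
    by (rule lin_extend_superset) (auto simp: in_keys_iff lookup_add)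
  also have "\<dots> = lin_extend g u + lin_extend g v"
    by (simp add: lin_extend_superset[of ?S] lookup_add scale_add_left sum.distrib)
  finally show ?thesis .
qed

lemma lin_extend_scale: "lin_extend g (scale c v) = scale c (lin_extend g v)"
proof -
  have "lin_extend g (scale c v) =
      (\<Sum>b\<in>Poly_Mapping.keys v. scale (Poly_Mapping.lookup (scale c v) b) (g b))"
    by (rule lin_extend_superset) (auto simp: in_keys_iff)
  then show ?thesis
    by (simp add: lin_extend_def scale_sum)
qed

lemma lin_extend_zero [simp]: "lin_extend g 0 = 0"
  by (simp add: lin_extend_def)

lemma lin_extend_basis_vec [simp]: "lin_extend g (basis_vec b) = g b"
  by (simp add: lin_extend_def basis_vec_def)

lemma lin_extend_sum: "lin_extend g (sum h S) = (\<Sum>x\<in>S. lin_extend g (h x))"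
  by (induction S rule: infinite_finite_induct) (simp_all add: lin_extend_add)

text \<open>All operators below are linear, so identities between them need checking on basis
  vectors only. The zero vector arises from scaling by 0.\<close>

lemma basis_vec_induct [case_names basis scale add]:
  assumes "\<And>b. P (basis_vec b)" "\<And>c v. P v \<Longrightarrow> P (scale c v)"
    and "\<And>u v. P u \<Longrightarrow> P v \<Longrightarrow> P (u + v)"
  shows "P v"
proof -
  have zero: "P 0"
    using assms(2)[OF assms(1), of 0] by simp
  have "P (\<Sum>b\<in>S. scale (Poly_Mapping.lookup v b) (basis_vec b))" for S
    by (induction S rule: infinite_finite_induct) (auto intro: assms zero)
  moreover have "v = lin_extend basis_vec v"
    by (rule poly_mapping_eqI)
       (simp add: lin_extend_def lookup_sum lookup_basis_vec in_keys_iff mult_delta_right)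
  ultimately show ?thesis
    unfolding lin_extend_def by metis
qed

lemma lookup_lin_extend:
  "Poly_Mapping.lookup (lin_extend g v) x =
     (\<Sum>b\<in>Poly_Mapping.keys v. Poly_Mapping.lookup v b * Poly_Mapping.lookup (g b) x)"
  by (simp add: lin_extend_def lookup_sum)

text \<open>A nonempty tabloid splits uniquely into its first column and the rest, so each
  coordinate of a tensor product is a single product. The laws for \<open>tensor\<close> then hold
  coordinatewise.\<close>

lemma lookup_tensor_Cons [simp]:
  "Poly_Mapping.lookup (tensor u v) (C # \<tau>) = Poly_Mapping.lookup u \<tau> * Poly_Mapping.lookup v C"
proof (induction u rule: basis_vec_induct)
  case (basis \<tau>')
  show ?case
  proof (induction v rule: basis_vec_induct)
    case (basis C')
    show ?case
      by (auto simp: tensor_def lookup_basis_vec)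
  next
    case (scale c v)
    then show ?case
      by (simp add: tensor_def lin_extend_scale)
  next
    case (add u v)
    then show ?case
      by (simp add: tensor_def lin_extend_add lookup_add distrib_left)
  qed
next
  case (scale c u)
  then show ?case
    by (simp add: tensor_def lin_extend_scale)
next
  case (add u u')
  then show ?case
    by (simp add: tensor_def lin_extend_add lookup_add distrib_right)
qed

lemma lookup_tensor_Nil [simp]: "Poly_Mapping.lookup (tensor u v) [] = 0"
  by (simp add: tensor_def lookup_lin_extend lookup_basis_vec)

lemma tensor_eqI:
  assumes "Poly_Mapping.lookup u [] = Poly_Mapping.lookup v []"
    and "\<And>C \<tau>. Poly_Mapping.lookup u (C # \<tau>) = Poly_Mapping.lookup v (C # \<tau>)"
  shows "u = v"
proof (rule poly_mapping_eqI)
  fix \<tau>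
  show "Poly_Mapping.lookup u \<tau> = Poly_Mapping.lookup v \<tau>"
    using assms by (cases \<tau>) auto
qed

lemma tensor_add_left: "tensor (u + u') v = tensor u v + tensor u' v"
  and tensor_add_right: "tensor u (v + v') = tensor u v + tensor u v'"
  and tensor_scale_left: "tensor (scale c u) v = scale c (tensor u v)"
  and tensor_scale_right: "tensor u (scale c v) = scale c (tensor u v)"
  and tensor_zero_left [simp]: "tensor 0 v = 0"
  and tensor_zero_right [simp]: "tensor u 0 = 0"
  and tensor_basis_vec [simp]: "tensor (basis_vec \<tau>) (basis_vec C) = basis_vec (C # \<tau>)"
  by (rule tensor_eqI; auto simp: lookup_add algebra_simps lookup_basis_vec)+


section \<open>Quantum integers and Laurent polynomials\<close>

lemma q_power: "q ^ k = Fract (monom 1 k) 1"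
  by (induction k) (simp_all add: One_fract_def q_def monom_Suc)

lemma q_nonzero [simp]: "q \<noteq> 0"
  by (simp add: q_def Zero_fract_def eq_fract)

text \<open>Degrees show that the indeterminate is not a root of unity. This is what makes quantum
  integers and factorials invertible.\<close>

lemma q_power_neq_one:
  assumes "k > 0"
  shows "q ^ k \<noteq> 1"
proof
  assume "q ^ k = 1"
  then have "monom (1 :: complex) k = monom 1 0"
    by (simp add: q_power One_fract_def eq_fract)
  then show False
    using assms by (metis degree_monom_eq gr_implies_not0 zero_neq_one)
qed

lemma q_idx_nonzero [simp]: "q_idx n i \<noteq> 0"
  by (simp add: q_idx_def)

lemma q_idx_powi: "q_idx n i powi k = q powi (if i < n then k else 2 * k)"
  by (simp add: q_idx_def power_int_mult)

lemma q_idx_powi_neq: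
  assumes "m > 0"
  shows "q_idx n i powi int m - q_idx n i powi (- int m) \<noteq> 0"
proof
  let ?x = "q_idx n i"
  assume "?x powi int m - ?x powi (- int m) = 0"
  then have "?x powi int m * ?x powi int m = ?x powi (- int m) * ?x powi int m"
    by simp
  then have "?x ^ (m + m) = 1"
    by (simp add: power_add power_int_minus)
  then have "q ^ ((if i < n then 1 else 2) * (m + m)) = 1"
    by (simp only: power_mult) (simp add: q_idx_def split: if_splits)
  then show False
    using q_power_neq_one[of "(if i < n then 1 else 2) * (m + m)"] assms by (simp split: if_splits)
qed

lemma q_int_nonzero: "m > 0 \<Longrightarrow> q_int n i m \<noteq> 0"
  using q_idx_powi_neq[of m n i] q_idx_powi_neq[of 1 n i] by (simp add: q_int_def)

lemma q_fact_nonzero: "q_fact n i m \<noteq> 0"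
  by (simp add: q_fact_def q_int_nonzero)

lemma q_int_one [simp]: "q_int n i (Suc 0) = 1"
  using q_idx_powi_neq[of 1 n i] by (simp add: q_int_def)

lemma q_int_zero [simp]: "q_int n i 0 = 0"
  by (simp add: q_int_def)

text \<open>With x for \<open>q_idx n i\<close>, the numerators telescope: x^(a+b) - x^(-a-b) = x^b
  (x^a - x^(-a)) + x^(-a) (x^b - x^(-b)). The identity later merges the two contributions of f_i to
  one summand of a divided power.\<close>

lemma q_int_add:
  "q_int n i (a + b) = q_idx n i powi int b * q_int n i a + q_idx n i powi (- int a) * q_int n i b"
proof -
  have *: "q_idx n i powi (int a + int b) = q_idx n i powi int b * q_idx n i powi int a"
    "q_idx n i powi (- int a - int b) = q_idx n i powi (- int a) * q_idx n i powi (- int b)"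
    by (simp_all add: power_int_add power_int_diff power_int_minus divide_simps)
  show ?thesis
    unfolding q_int_def
    by (simp add: * add_divide_distrib[symmetric] algebra_simps del: power_int_of_nat power_int_minus_left)
qed

lemma q_int_two:
  assumes "i < n"
  shows "q_int n i (Suc (Suc 0)) = q powi (- 1) + q"
  using q_int_add[of n i 1 1] assms by (simp add: q_idx_def)

section \<open>Closure properties of Laurent polynomials with natural coefficients\<close>

lemma nat_laurentI: "finite S \<Longrightarrow> (\<Sum>m\<in>S. of_nat (c m) * q powi m) \<in> nat_laurent"
  unfolding nat_laurent_def by blast

lemma nat_laurent_add:
  assumes "x \<in> nat_laurent" "y \<in> nat_laurent"
  shows "x + y \<in> nat_laurent"
proof -
  obtain c S d S' where x: "x = (\<Sum>m\<in>S. of_nat (c m) * q powi m)" "finite S"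
    and y: "y = (\<Sum>m\<in>S'. of_nat (d m) * q powi m)" "finite S'"
    using assms unfolding nat_laurent_def by blast
  let ?c = "\<lambda>m. if m \<in> S then c m else 0" and ?d = "\<lambda>m. if m \<in> S' then d m else 0"
  have "x = (\<Sum>m\<in>S \<union> S'. of_nat (?c m) * q powi m)"
    unfolding x by (rule sum.mono_neutral_cong_left) (use x y in auto)
  moreover have "y = (\<Sum>m\<in>S \<union> S'. of_nat (?d m) * q powi m)"
    unfolding y by (rule sum.mono_neutral_cong_left) (use x y in auto)
  ultimately have "x + y = (\<Sum>m\<in>S \<union> S'. of_nat (?c m + ?d m) * q powi m)"
    by (simp only: sum.distrib[symmetric] of_nat_add distrib_right)
  then show ?thesis
    using x(2) y(2) nat_laurentI[of "S \<union> S'" "\<lambda>m. ?c m + ?d m"] by (simp del: of_nat_add)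
qed

lemma nat_laurent_zero [simp]: "0 \<in> nat_laurent"
  using nat_laurentI[of "{}"] by simp

lemma nat_laurent_sum: "(\<And>x. x \<in> S \<Longrightarrow> h x \<in> nat_laurent) \<Longrightarrow> sum h S \<in> nat_laurent"
  by (induction S rule: infinite_finite_induct) (auto intro: nat_laurent_add)

lemma nat_laurent_monom: "of_nat c * q powi m \<in> nat_laurent"
  using nat_laurentI[of "{m}" "\<lambda>_. c"] by simp

lemma nat_laurent_powi [simp]: "q powi m \<in> nat_laurent"
  using nat_laurent_monom[of 1 m] by simp

lemma nat_laurent_one [simp]: "1 \<in> nat_laurent"
  using nat_laurent_powi[of 0] by simp

lemma nat_laurent_mult:
  assumes "x \<in> nat_laurent" "y \<in> nat_laurent"
  shows "x * y \<in> nat_laurent"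
proof -
  obtain c S d S' where x: "x = (\<Sum>m\<in>S. of_nat (c m) * q powi m)"
    and y: "y = (\<Sum>m\<in>S'. of_nat (d m) * q powi m)"
    using assms unfolding nat_laurent_def by blast
  have "x * y = (\<Sum>m\<in>S. \<Sum>m'\<in>S'. of_nat (c m * d m') * q powi (m + m'))"
    by (simp add: x y sum_product power_int_add algebra_simps)
  then show ?thesis
    by (simp only: nat_laurent_sum nat_laurent_monom)
qed

lemma q_idx_powi_nat_laurent [simp]: "q_idx n i powi m \<in> nat_laurent"
  by (simp add: q_idx_powi)

section \<open>Lowering and raising letters in words\<close>

lemma alphabet_iff [simp]:
  "Unbar j \<in> alphabet n \<longleftrightarrow> 1 \<le> j \<and> j \<le> n"
  "Bar j \<in> alphabet n \<longleftrightarrow> 1 \<le> j \<and> j \<le> n"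
  by (auto simp: alphabet_def)

lemma finite_alphabet [simp]: "finite (alphabet n)"
  by (simp add: alphabet_def)

lemma letter_le_iff [simp]:
  "Unbar i \<le> Unbar j \<longleftrightarrow> i \<le> j" "Bar i \<le> Bar j \<longleftrightarrow> j \<le> i" "Unbar i \<le> Bar j"
  "\<not> Bar i \<le> Unbar j"
  by (auto simp: less_eq_letter_def)

lemma raised_not_blocking: "i \<le> n \<Longrightarrow> b \<in> raised_letters n i \<Longrightarrow> b \<notin> blocking_letters n i"
  by (auto simp: raised_letters_def blocking_letters_def split: if_splits)

lemma raised_cases:
  assumes "b \<in> raised_letters n i" "1 \<le> i" "i \<le> n"
  obtains "i = n" "b = Bar n" | "i < n" "b = Bar i" | "i < n" "b = Unbar (Suc i)"
  using assms by (auto simp: raised_letters_def split: if_splits)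

lemma pred_raised:
  assumes "1 \<le> i" "i \<le> n" "b \<in> raised_letters n i"
  shows "pred_letter n b \<in> blocking_letters n i" "pred_letter n b < b"
    "b \<in> alphabet n" "pred_letter n b \<in> alphabet n"
  using assms(3,1,2) by (cases rule: raised_cases; simp add: blocking_letters_def)+

text \<open>A raised letter covers its predecessor in the alphabet. This keeps columns sorted when
  letters move, and it drives the lexicographic estimate in \<open>lowered_lex\<close>.\<close>

lemma le_pred_raised:
  assumes "1 \<le> i" "i \<le> n" "b \<in> raised_letters n i" "a \<in> alphabet n" "a < b"
  shows "a \<le> pred_letter n b"
  using assms(3,1,2,4,5) by (cases rule: raised_cases; cases a; simp)

lemma pred_letter_inj:
  assumes "b \<in> raised_letters n i" "c \<in> raised_letters n i" "pred_letter n b = pred_letter n c"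
  shows "b = c"
  using assms by (auto simp: raised_letters_def split: if_splits)

text \<open>Records which words can occur when a divided power of f_i acts, without the
  coefficients: r letters move down one place each, and none moves twice.\<close>

inductive lowered :: "nat \<Rightarrow> nat \<Rightarrow> nat \<Rightarrow> letter list \<Rightarrow> letter list \<Rightarrow> bool" for n i where
  Nil: "lowered n i 0 [] []"
| keep: "lowered n i r w w' \<Longrightarrow> lowered n i r (a # w) (a # w')"
| lower: "b \<in> raised_letters n i \<Longrightarrow> lowered n i r w w' \<Longrightarrow>
    lowered n i (Suc r) (pred_letter n b # w) (b # w')"

inductive_cases lowered_ConsE: "lowered n i r (a # w) w'"
inductive_cases lowered_NilE: "lowered n i r [] w'"

lemma lowered_length: "lowered n i r w w' \<Longrightarrow> length w' = length w"
  by (induction rule: lowered.induct) auto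

lemma lowered_zero: "lowered n i r w w' \<Longrightarrow> r = 0 \<Longrightarrow> w' = w"
  by (induction rule: lowered.induct) auto

lemma lowered_append:
  "lowered n i r v v' \<Longrightarrow> lowered n i s w w' \<Longrightarrow> lowered n i (r + s) (v @ w) (v' @ w')"
  by (induction rule: lowered.induct) (auto intro: lowered.intros)

lemma lowered_refl: "lowered n i 0 w w"
  by (induction w) (auto intro: lowered.intros)

lemma lowered_map:
  assumes "\<And>a. a \<in> set w \<Longrightarrow> g a = a \<or> g a \<in> raised_letters n i \<and> pred_letter n (g a) = a"
  shows "lowered n i (length (filter (\<lambda>a. g a \<noteq> a) w)) w (map g w)"
  using assms
proof (induction w)
  case (Cons a w)
  then have IH: "lowered n i (length (filter (\<lambda>a. g a \<noteq> a) w)) w (map g w)"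
    by simp
  show ?case
  proof (cases "g a = a")
    case True
    then show ?thesis
      using lowered.keep[OF IH] by simp
  next
    case False
    then have "g a \<in> raised_letters n i" "pred_letter n (g a) = a"
      using Cons.prems by auto
    then show ?thesis
      using lowered.lower[OF _ IH, of "g a"] False by simp
  qed
qed (simp add: lowered.Nil)

section \<open>Weights of letters and words\<close>

definition letter_weight :: "nat \<Rightarrow> nat \<Rightarrow> letter \<Rightarrow> int" where
  "letter_weight n j a =
     (if j < n
      then of_bool (a \<in> {Unbar j, Bar (j + 1)}) - of_bool (a \<in> {Unbar (j + 1), Bar j})
      else of_bool (a = Unbar n) - of_bool (a = Bar n))"

text \<open>The entry a_{j,i} of the Cartan matrix, read off as the change of weight along an arrow
  of the vector representation. \<open>Bar i\<close> serves as the source because it is a raised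
  letter both for i < n and for i = n.\<close>

definition cartan :: "nat \<Rightarrow> nat \<Rightarrow> nat \<Rightarrow> int" where
  "cartan n j i = letter_weight n j (pred_letter n (Bar i)) - letter_weight n j (Bar i)"

lemma letter_weight_Bar: "letter_weight n j (Bar k) = - letter_weight n j (Unbar k)"
  by (simp add: letter_weight_def)

lemma cartan_diag: "1 \<le> i \<Longrightarrow> i \<le> n \<Longrightarrow> cartan n i i = 2"
  by (auto simp: cartan_def letter_weight_def)

text \<open>Barring a letter negates its weight, so the arrow from \<open>Unbar (i + 1)\<close> to
  \<open>Unbar i\<close> changes weights exactly as the one from \<open>Bar i\<close> to
  \<open>Bar (i + 1)\<close> does.\<close>

lemma letter_weight_pred:
  assumes "1 \<le> i" "i \<le> n" "b \<in> raised_letters n i"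
  shows "letter_weight n j (pred_letter n b) = letter_weight n j b + cartan n j i"
  using assms(3,1,2) by (cases rule: raised_cases; simp add: cartan_def letter_weight_Bar)

definition word_weight :: "nat \<Rightarrow> nat \<Rightarrow> letter list \<Rightarrow> int" where
  "word_weight n j w = sum_list (map (letter_weight n j) w)"

lemma word_weight_append: "word_weight n j (v @ w) = word_weight n j v + word_weight n j w"
  by (simp add: word_weight_def)

lemma lowered_weight:
  assumes "lowered n i r w w'" "1 \<le> i" "i \<le> n"
  shows "word_weight n j w' = word_weight n j w - int r * cartan n j i"
  using assms
  by (induction rule: lowered.induct) (auto simp: word_weight_def letter_weight_pred algebra_simps)

fun raise_word :: "nat \<Rightarrow> nat \<Rightarrow> letter list \<Rightarrow> letter list" where
  "raise_word n i [] = []"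
| "raise_word n i (a # w) =
     (if a \<in> blocking_letters n i then a # w
      else (if a \<in> raised_letters n i then pred_letter n a else a) # raise_word n i w)"

fun raise_number :: "nat \<Rightarrow> nat \<Rightarrow> letter list \<Rightarrow> nat" where
  "raise_number n i [] = 0"
| "raise_number n i (a # w) =
     (if a \<in> blocking_letters n i then 0
      else of_bool (a \<in> raised_letters n i) + raise_number n i w)"

lemma raise_word_append:
  "raise_word n i (v @ w) =
     raise_word n i v @ (if set v \<inter> blocking_letters n i = {} then raise_word n i w else w)"
  by (induction v) auto

lemma raise_number_append:
  "raise_number n i (v @ w) =
     raise_number n i v + (if set v \<inter> blocking_letters n i = {} then raise_number n i w else 0)"
  by (induction v) auto

lemma length_raise_word [simp]: "length (raise_word n i w) = length w"
  by (induction w) auto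

lemma raise_word_lowered: "lowered n i (raise_number n i w) (raise_word n i w) w"
  by (induction w) (auto intro: lowered.intros lowered_refl)

text \<open>The letters changed in passing from \<open>t\<close> to \<open>raise_word n i t\<close> are the leftmost letters on
  which lowering can act, so that lowering them again yields the lexicographic maximum.\<close>

lemma lowered_lex:
  assumes "1 \<le> i" "i \<le> n" "lowered n i (raise_number n i t) u u'"
    and "lexordp_eq u (raise_word n i t)" "set t \<subseteq> alphabet n" "set u \<subseteq> alphabet n"
    and "length u = length t"
  shows "lexordp_eq u' t \<and> (u' = t \<longrightarrow> u = raise_word n i t)"
  using assms(3-)
proof (induction t arbitrary: u u')
  case Nil
  then show ?case
    by (auto elim: lowered_NilE)
next
  case (Cons b t)
  note i = assms(1,2)
  obtain c v where u: "u = c # v"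
    using Cons.prems(5) by (cases u) auto
  show ?case
  proof (cases "b \<in> blocking_letters n i")
    \<comment> \<open>A blocking head stops the raising at once: nothing is raised, so nothing is
      lowered, and u' = u.\<close>
    case True
    then show ?thesis
      using Cons.prems lowered_zero[of n i 0 u u'] by auto
  next
    case nb: False
    have v: "set v \<subseteq> alphabet n" "length v = length t" "set t \<subseteq> alphabet n"
      "b \<in> alphabet n" "c \<in> alphabet n"
      using Cons.prems u by auto
    show ?thesis
    proof (cases "b \<in> raised_letters n i")
      case b: True
      have lex: "c < pred_letter n b \<or> c = pred_letter n b \<and> lexordp_eq v (raise_word n i t)"
        using Cons.prems(2) u nb b by auto
      have "lowered n i (Suc (raise_number n i t)) (c # v) u'"
        using Cons.prems(1) u nb b by simp
      then consider v' where "u' = c # v'"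
        | d v' where "u' = d # v'" "d \<in> raised_letters n i" "c = pred_letter n d"
            "lowered n i (raise_number n i t) v v'"
        by (auto elim: lowered_ConsE)
      then show ?thesis
      proof cases
        case 1
        \<comment> \<open>If the head is not lowered although it could have been, u' is already
          strictly smaller than t.\<close>
        have "c < b"
          using lex pred_raised(2)[OF i b] by auto
        then show ?thesis
          using 1 by auto
      next
        case d: 2
        show ?thesis
        proof (cases "d = b")
          case True
          then have "lexordp_eq v (raise_word n i t)"
            using lex d by auto
          then show ?thesis
            using Cons.IH[OF d(4) _ v(3,1,2)] d True u nb b by auto
        next
          case False
          then have "c < pred_letter n b"
            using lex d pred_letter_inj b by blast
          \<comment> \<open>Were b < d, then also pred b < d, hence pred b would be at most pred d =
            c, against c < pred b.\<close>
          then have "\<not> b \<le> d"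
            using False le_pred_raised[OF i d(2), of "pred_letter n b"] pred_raised(2,4)[OF i b] d(3)
              by (metis leD nless_le order.trans)
          then show ?thesis
            using d by auto
        qed
      qed
    next
      case b: False
      have lex: "c < b \<or> c = b \<and> lexordp_eq v (raise_word n i t)"
        using Cons.prems(2) u nb b by auto
      have "lowered n i (raise_number n i t) (c # v) u'"
        using Cons.prems(1) u nb b by simp
      then consider v' where "u' = c # v'" "lowered n i (raise_number n i t) v v'"
        | d v' where "u' = d # v'" "d \<in> raised_letters n i" "c = pred_letter n d"
        by (auto elim: lowered_ConsE)
      then show ?thesis
      proof cases
        case 1
        then show ?thesis
          using lex Cons.IH[OF 1(2) _ v(3,1,2)] u nb b by auto
      next
        case 2
        \<comment> \<open>c is a predecessor of a raised letter, hence blocking, whereas b is not;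
          so c = b is impossible.\<close>
        have "c < b"
          using lex 2 nb pred_raised(1)[OF i 2(2)] by auto
        then have "d < b"
          using le_pred_raised[OF i 2(2) v(4)] 2 b by (metis leD linorder_neqE)
        then show ?thesis
          using 2 by auto
      qed
    qed
  qed
qed


section \<open>Columns\<close>

lemma finite_column: "C \<subseteq> alphabet n \<Longrightarrow> finite C"
  using finite_alphabet finite_subset by blast

lemma set_col_word [simp]: "finite C \<Longrightarrow> set (col_word C) = C"
  by (simp add: col_word_def)

lemma length_col_word [simp]: "length (col_word C) = card C"
  by (simp add: col_word_def)

lemma distinct_col_word [simp]: "distinct (col_word C)"
  by (simp add: col_word_def)

text \<open>A strictly increasing relabelling commutes with sorting, so moving letters of a column
  becomes a letterwise change of its word.\<close>

lemma col_word_image: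
  assumes "finite C" "strict_mono_on C g"
  shows "col_word (g ` C) = map g (col_word C)"
proof -
  have "sorted_wrt (<) (map g (col_word C))"
    unfolding sorted_wrt_map
    by (rule sorted_wrt_mono_rel[of _ "(<)"])
       (use assms in \<open>auto simp: strict_mono_on_def col_word_def\<close>)
  then have "sorted (map g (col_word C))" "distinct (map g (col_word C))"
    by (simp_all add: strict_sorted_iff)
  moreover have "set (map g (col_word C)) = g ` C"
    using assms(1) by simp
  ultimately show ?thesis
    unfolding col_word_def[of "g ` C"]
    by (metis distinct_remdups_id sort_key_id_if_sorted sorted_list_of_set_sort_remdups sorted_sort_id)
qed

text \<open>Inverse to \<open>pred_letter\<close> on \<open>blocking_letters n i\<close>: the
  direction in which f_i moves.\<close>

definition succ_letter :: "nat \<Rightarrow> nat \<Rightarrow> letter \<Rightarrow> letter" where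
  "succ_letter n i a = (if i < n \<and> a = Unbar i then Unbar (i + 1) else Bar i)"

definition lower_set :: "nat \<Rightarrow> nat \<Rightarrow> column \<Rightarrow> column \<Rightarrow> column" where
  "lower_set n i D C = (C - D) \<union> succ_letter n i ` D"

lemma succ_letter:
  assumes "1 \<le> i" "i \<le> n" "a \<in> blocking_letters n i"
  shows "succ_letter n i a \<in> raised_letters n i" "pred_letter n (succ_letter n i a) = a"
  using assms
  by (auto simp: succ_letter_def raised_letters_def blocking_letters_def split: if_splits)

text \<open>The lowered letters do not collide with letters of C, and no letter lies between a
  letter and its successor. Hence lowering D is strictly increasing on C and
  \<open>col_word_image\<close> applies.\<close>

lemma lowered_lower_set:
  assumes i: "1 \<le> i" "i \<le> n" and C: "C \<subseteq> alphabet n"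
    and D: "D \<subseteq> C \<inter> blocking_letters n i" "succ_letter n i ` D \<inter> C = {}"
  shows "lower_set n i D C \<subseteq> alphabet n"
    and "lowered n i (card D) (col_word C) (col_word (lower_set n i D C))"
proof -
  define g where "g a = (if a \<in> D then succ_letter n i a else a)" for a
  have g: "g ` C = lower_set n i D C"
    using D by (auto simp: g_def lower_set_def)
  have raised: "succ_letter n i a \<in> raised_letters n i" "pred_letter n (succ_letter n i a) = a"
    if "a \<in> D" for a
    using succ_letter[OF i] D that by auto
  show "lower_set n i D C \<subseteq> alphabet n"
    using C raised(1) pred_raised(3)[OF i] by (auto simp: lower_set_def)
  have fin: "finite C"
    using C by (rule finite_column)
  have gt: "a < succ_letter n i a" if "a \<in> D" for a
    using pred_raised(2)[OF i raised(1)[OF that]] raised(2)[OF that] by simp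
  have "strict_mono_on C g"
  proof (rule strict_mono_onI)
    fix x y assume xy: "x \<in> C" "y \<in> C" "x < y"
    have "y \<le> g y"
      using gt by (auto simp: g_def less_imp_le)
    moreover have "g x < y"
    proof (cases "x \<in> D")
      case True
      then have "\<not> y < succ_letter n i x"
        using le_pred_raised[OF i raised(1)[OF True], of y] raised(2)[OF True] xy C by auto
      moreover have "y \<noteq> succ_letter n i x"
        using D True xy by auto
      ultimately show ?thesis
        using True by (auto simp: g_def)
    qed (use xy in \<open>simp add: g_def\<close>)
    ultimately show "g x < g y"
      by simp
  qed
  then have *: "col_word (lower_set n i D C) = map g (col_word C)"
    using col_word_image[OF fin] g by metis
  have "set (filter (\<lambda>a. g a \<noteq> a) (col_word C)) = D"
    using fin D gt by (fastforce simp: g_def)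
  moreover have "distinct (filter (\<lambda>a. g a \<noteq> a) (col_word C))"
    by simp
  ultimately have "length (filter (\<lambda>a. g a \<noteq> a) (col_word C)) = card D"
    by (metis distinct_card)
  moreover have "lowered n i (length (filter (\<lambda>a. g a \<noteq> a) (col_word C))) (col_word C)
      (map g (col_word C))"
    by (rule lowered_map) (use raised in \<open>auto simp: g_def\<close>)
  ultimately show "lowered n i (card D) (col_word C) (col_word (lower_set n i D C))"
    by (simp add: *)
qed

lemma col_exponent_word:
  assumes "finite C"
  shows "col_exponent n i C = word_weight n i (col_word C)"
proof -
  have *: "(\<Sum>a\<in>C. of_bool (a \<in> S)) = int (card (C \<inter> S))" for S
    using assms by (simp add: of_bool_def sum.If_cases)
  have "word_weight n i (col_word C) = (\<Sum>a\<in>C. letter_weight n i a)"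
    using assms by (simp add: word_weight_def sum_list_distinct_conv_sum_set)
  then show ?thesis
    using *[of "{Unbar i, Bar (i + 1)}"] *[of "{Unbar (i + 1), Bar i}"]
      *[of "{Unbar n}"] *[of "{Bar n}"]
    by (simp add: letter_weight_def col_exponent_def sum_subtractf)
qed


section \<open>Divided powers\<close>

text \<open>At most two letters of a column can be moved by f_i, so the third divided power
  vanishes, and the second is nonzero only if \<open>Unbar i\<close> and \<open>Bar (i + 1)\<close>
  are both free to move.\<close>

definition fdiv_col :: "nat \<Rightarrow> nat \<Rightarrow> nat \<Rightarrow> column \<Rightarrow> (column \<Rightarrow>\<^sub>0 ratfun)" where
  "fdiv_col n i b C =
     (if b = 0 then basis_vec C
      else if b = 1 then f_col n i C
      else if b = 2 \<and> i < n \<and> C \<inter> {Unbar i, Unbar (i + 1), Bar (i + 1), Bar i} = {Bar (i + 1), Unbar i}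
      then basis_vec (lower_set n i {Unbar i, Bar (i + 1)} C)
      else 0)"

lemma Int_eq_iff_ball: "C \<inter> F = S \<longleftrightarrow> S \<subseteq> F \<and> (\<forall>a\<in>F. a \<in> C \<longleftrightarrow> a \<in> S)"
  by blast

lemma f_col_last:
  "f_col n n C = (if Unbar n \<in> C \<and> Bar n \<notin> C then basis_vec (lower_set n n {Unbar n} C) else 0)"
  by (auto simp: f_col_def lower_set_def succ_letter_def)

text \<open>The table of f_i regrouped by the outcome. Stated through four memberships, it reduces
  later claims to at most sixteen patterns.\<close>

lemma f_col_less:
  assumes "i < n"
  shows "f_col n i C =
     (if Unbar i \<in> C \<and> Unbar (Suc i) \<notin> C \<and> (Bar (Suc i) \<in> C \<longrightarrow> Bar i \<in> C)
        then basis_vec (lower_set n i {Unbar i} C)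
      else if Bar (Suc i) \<in> C \<and> Bar i \<notin> C \<and> (Unbar i \<in> C \<longleftrightarrow> Unbar (Suc i) \<in> C)
        then basis_vec (lower_set n i {Bar (Suc i)} C)
      else if Bar (Suc i) \<in> C \<and> Bar i \<notin> C \<and> Unbar (Suc i) \<in> C
        then scale (q powi (-1)) (basis_vec (lower_set n i {Bar (Suc i)} C))
      else if Bar (Suc i) \<in> C \<and> Bar i \<notin> C
        then basis_vec (lower_set n i {Unbar i} C) + scale q (basis_vec (lower_set n i {Bar (Suc i)} C))
      else 0)"
proof -
  have u: "lower_set n i {Unbar i} C = C - {Unbar i} \<union> {Unbar (i + 1)}"
    and b: "lower_set n i {Bar (Suc i)} C = C - {Bar (i + 1)} \<union> {Bar i}"
    using assms by (simp_all add: lower_set_def succ_letter_def)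
  show ?thesis
    using assms unfolding f_col_def Let_def Int_eq_iff_ball u b
    by (cases "Unbar i \<in> C"; cases "Unbar (Suc i) \<in> C"; cases "Bar (Suc i) \<in> C"; cases "Bar i \<in> C";
        simp)
qed

lemma lower_set_Unbar:
  assumes "i < n"
  shows "lower_set n i {Unbar i} C = insert (Unbar (Suc i)) (C - {Unbar i})"
  using assms by (auto simp: lower_set_def succ_letter_def)

lemma lower_set_Bar: "lower_set n i {Bar (Suc i)} C = insert (Bar i) (C - {Bar (Suc i)})"
  by (auto simp: lower_set_def succ_letter_def)

lemma lower_set_both:
  assumes "i < n"
  shows "lower_set n i {Unbar i, Bar (Suc i)} C =
    insert (Unbar (Suc i)) (insert (Bar i) (C - {Unbar i, Bar (Suc i)}))"
  using assms by (auto simp: lower_set_def succ_letter_def)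

lemma lower_set_last: "lower_set n n {Unbar n} C = insert (Bar n) (C - {Unbar n})"
  by (auto simp: lower_set_def succ_letter_def)

lemma fdiv_col_zero [simp]: "fdiv_col n i 0 C = basis_vec C"
  by (simp add: fdiv_col_def)

lemma fdiv_col_one [simp]: "fdiv_col n i (Suc 0) C = f_col n i C"
  by (simp add: fdiv_col_def)

lemma fdiv_col_two:
  "fdiv_col n i (Suc (Suc 0)) C =
     (if i < n \<and> Unbar i \<in> C \<and> Unbar (Suc i) \<notin> C \<and> Bar (Suc i) \<in> C \<and> Bar i \<notin> C
      then basis_vec (lower_set n i {Unbar i, Bar (Suc i)} C) else 0)"
  by (auto simp: fdiv_col_def Int_eq_iff_ball)

lemma fdiv_col_many [simp]: "fdiv_col n i (Suc (Suc (Suc b))) C = 0"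
  by (simp add: fdiv_col_def)

text \<open>The two letters can be lowered in two orders. Starting with the unbarred one gives the
  factor q^(-1) at the second move; starting with the barred one gives q at the first. The sum is
  [2].\<close>

lemma f_col_twice:
  assumes "1 \<le> i" "i \<le> n"
  shows "lin_extend (f_col n i) (f_col n i C) =
    scale (q_int n i (Suc (Suc 0))) (fdiv_col n i (Suc (Suc 0)) C)"
proof (cases "i < n")
  case False
  then have "i = n"
    using assms by simp
  then show ?thesis
    by (simp add: f_col_last fdiv_col_two lower_set_last)
next
  case True
  have "insert (Bar i) (insert (Unbar (Suc i)) (C - {Unbar i}) - {Bar (Suc i)}) =
      lower_set n i {Unbar i, Bar (Suc i)} C"
    "insert (Unbar (Suc i)) (insert (Bar i) (C - {Bar (Suc i)}) - {Unbar i}) =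
      lower_set n i {Unbar i, Bar (Suc i)} C"
    using True by (auto simp: lower_set_both)
  then show ?thesis
    using True unfolding f_col_less[OF True, of C] fdiv_col_two
    by (cases "Unbar i \<in> C"; cases "Unbar (Suc i) \<in> C"; cases "Bar (Suc i) \<in> C"; cases "Bar i \<in> C";
        simp add: lin_extend_add lin_extend_scale f_col_less[OF True] lower_set_Unbar lower_set_Bar
          q_int_two scale_add_left)
qed

lemma f_col_fdiv_col:
  assumes "1 \<le> i" "i \<le> n"
  shows "lin_extend (f_col n i) (fdiv_col n i b C) =
    scale (q_int n i (Suc b)) (fdiv_col n i (Suc b) C)"
proof -
  consider "b = 0" | "b = Suc 0" | "b = Suc (Suc 0)" | c where "b = Suc (Suc (Suc c))"
    by (metis not0_implies_Suc)
  then show ?thesis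
  proof cases
    case 3
    then show ?thesis
      by (auto simp: fdiv_col_two f_col_less lower_set_both)
  qed (auto simp: f_col_twice[OF assms])
qed

lemma fdiv_col_nat_laurent:
  assumes "1 \<le> i" "i \<le> n"
  shows "Poly_Mapping.lookup (fdiv_col n i b C) C' \<in> nat_laurent"
proof -
  have 1: "Poly_Mapping.lookup (basis_vec D) C' \<in> nat_laurent" for D
    by (simp add: lookup_basis_vec)
  have q: "q \<in> nat_laurent"
    using nat_laurent_powi[of 1] by simp
  have 2: "Poly_Mapping.lookup (f_col n i C) C' \<in> nat_laurent"
  proof (cases "i < n")
    case True
    show ?thesis
      unfolding f_col_less[OF True]
      by (auto simp: lookup_add simp del: power_int_minus1_right intro!: nat_laurent_add nat_laurent_mult 1 q)
  next
    case False
    then have "i = n"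
      using assms by simp
    then show ?thesis
      by (simp add: f_col_last 1)
  qed
  show ?thesis
    using 1 2 by (simp add: fdiv_col_def)
qed

lemma fdiv_col_support:
  assumes i: "1 \<le> i" "i \<le> n" and C: "C \<subseteq> alphabet n"
    and nz: "Poly_Mapping.lookup (fdiv_col n i b C) C' \<noteq> 0"
  shows "C' \<subseteq> alphabet n \<and> lowered n i b (col_word C) (col_word C')"
proof -
  have *: "C' \<subseteq> alphabet n \<and> lowered n i b (col_word C) (col_word C')"
    if "D \<subseteq> C \<inter> blocking_letters n i" "succ_letter n i ` D \<inter> C = {}" "C' = lower_set n i D C"
      "card D = b" for D
    using lowered_lower_set[OF i C that(1,2)] that(3,4) by auto
  consider "b = 0" | "b = Suc 0" | "b = Suc (Suc 0)" | c where "b = Suc (Suc (Suc c))"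
    by (metis not0_implies_Suc)
  then show ?thesis
  proof cases
    case 1
    then show ?thesis
      using nz C by (auto simp: lookup_basis_vec lowered_refl split: if_splits)
  next
    case 2
    show ?thesis
    proof (cases "i < n")
      case True
      have "(Unbar i \<in> C \<and> Unbar (Suc i) \<notin> C \<and> C' = lower_set n i {Unbar i} C) \<or>
          (Bar (Suc i) \<in> C \<and> Bar i \<notin> C \<and> C' = lower_set n i {Bar (Suc i)} C)"
        using nz unfolding 2 fdiv_col_one f_col_less[OF True]
        by (auto simp: lookup_add lookup_basis_vec split: if_splits)
      then show ?thesis
      proof
        assume "Unbar i \<in> C \<and> Unbar (Suc i) \<notin> C \<and> C' = lower_set n i {Unbar i} C"
        then show ?thesis
          using True 2 by (intro *[of "{Unbar i}"]) (auto simp: succ_letter_def blocking_letters_def)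
      next
        assume "Bar (Suc i) \<in> C \<and> Bar i \<notin> C \<and> C' = lower_set n i {Bar (Suc i)} C"
        then show ?thesis
          using True 2 by (intro *[of "{Bar (Suc i)}"]) (auto simp: succ_letter_def blocking_letters_def)
      qed
    next
      case False
      then have "i = n"
        using i by simp
      then show ?thesis
        using nz 2 by (intro *[of "{Unbar n}"])
          (auto simp: succ_letter_def blocking_letters_def f_col_last lookup_basis_vec split: if_splits)
    qed
  next
    case 3
    then show ?thesis
      using nz by (intro *[of "{Unbar i, Bar (Suc i)}"])
        (auto simp: succ_letter_def blocking_letters_def fdiv_col_two lookup_basis_vec split: if_splits)
  qed (use nz in simp)
qed

section \<open>Torus weights and the coproduct on tabloids\<close>

definition tab_weight :: "nat \<Rightarrow> nat \<Rightarrow> tabloid \<Rightarrow> int" where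
  "tab_weight n j \<tau> = sum_list (map (col_exponent n j) \<tau>)"

lemma word_Nil [simp]: "word [] = []"
  and word_Cons [simp]: "word (C # \<tau>) = word \<tau> @ col_word C"
  by (simp_all add: word_def)

lemma tab_weight_word:
  "(\<And>C. C \<in> set \<tau> \<Longrightarrow> finite C) \<Longrightarrow> tab_weight n j \<tau> = word_weight n j (word \<tau>)"
  by (induction \<tau>) (simp_all add: tab_weight_def col_exponent_word word_weight_append,
      simp add: word_weight_def)

lemma qh_basis: "qh n j (basis_vec \<tau>) = scale (q powi tab_weight n j \<tau>) (basis_vec \<tau>)"
proof -
  have "qh_tab n j \<tau> = scale (q powi tab_weight n j \<tau>) (basis_vec \<tau>)"
    by (induction \<tau>)
       (simp_all add: tab_weight_def qh_col_def tensor_scale_left tensor_scale_right power_int_add mult.commute)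
  then show ?thesis
    by (simp add: qh_def)
qed

lemma t_op_scale: "t_op n i (scale c v) = scale c (t_op n i v)"
  and t_op_add: "t_op n i (u + v) = t_op n i u + t_op n i v"
  by (simp_all add: t_op_def qh_def lin_extend_scale lin_extend_add)

text \<open>Since t_n = q^(2 h_n) and q_n = q^2, the operator t_i acts by a power of q_i to the
  weight in both cases, which removes the distinction between i < n and i = n from here on.\<close>

lemma t_op_basis:
  assumes "i \<le> n"
  shows "t_op n i (basis_vec \<tau>) = scale (q_idx n i powi tab_weight n i \<tau>) (basis_vec \<tau>)"
proof (cases "i < n")
  case True
  then show ?thesis
    by (simp add: t_op_def qh_basis q_idx_def)
next
  case False
  have "qh n n (qh n n (basis_vec \<tau>)) = scale (q powi tab_weight n n \<tau>) (scale (q powi tab_weight n n \<tau>) (basis_vec \<tau>))"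
    by (simp only: qh_basis) (simp only: qh_def lin_extend_scale, simp only: qh_def[symmetric] qh_basis)
  then show ?thesis
    using False assms by (simp add: t_op_def q_idx_powi power_int_add[symmetric])
qed

lemma t_op_homogeneous:
  assumes "i \<le> n"
    and "\<And>\<tau>. Poly_Mapping.lookup v \<tau> \<noteq> 0 \<Longrightarrow> tab_weight n i \<tau> = m"
  shows "t_op n i v = scale (q_idx n i powi m) v"
proof -
  have "Poly_Mapping.lookup (t_op n i u) \<tau> =
      q_idx n i powi tab_weight n i \<tau> * Poly_Mapping.lookup u \<tau>" for u \<tau>
    by (induction u rule: basis_vec_induct)
       (simp_all add: t_op_basis assms(1) lookup_basis_vec t_op_scale t_op_add lookup_add distrib_left)
  then show ?thesis
    using assms(2) by (intro poly_mapping_eqI) (metis lookup_scale mult_zero_right)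
qed

lemma f_op_tensor:
  "f_op n i (tensor u v) = tensor (f_op n i u) v + tensor (t_op n i u) (lin_extend (f_col n i) v)"
proof (induction u rule: basis_vec_induct)
  case (basis \<tau>)
  show ?case
  proof (induction v rule: basis_vec_induct)
    case (basis C)
    then show ?case
      by (simp add: f_op_def)
  next
    case (scale c v)
    then show ?case
      by (simp add: f_op_def tensor_scale_right lin_extend_scale scale_add_right)
  next
    case (add u v)
    then show ?case
      by (simp add: f_op_def tensor_add_right lin_extend_add)
  qed
next
  case (scale c u)
  then show ?case
    by (simp add: f_op_def tensor_scale_left lin_extend_scale scale_add_right t_op_scale)
next
  case (add u u')
  then show ?case
    by (simp add: f_op_def tensor_add_left lin_extend_add t_op_add)
qed

text \<open>The coproduct of f_i^(r) evaluated on a weight vector. The summand with b puts f_i^(r-b)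
  on the left factor and f_i^(b) on the right one. With m the weight of the left factor, each of the
  b right moves contributes t_i, with q_i-exponents between m - 2 (r - b) and m; dividing by the
  factorials leaves the mean m - (r - b) for each. No denominator remains, so positivity is
  manifest.\<close>

fun fdiv_tab :: "nat \<Rightarrow> nat \<Rightarrow> nat \<Rightarrow> tabloid \<Rightarrow> (tabloid \<Rightarrow>\<^sub>0 ratfun)" where
  "fdiv_tab n i r [] = (if r = 0 then basis_vec [] else 0)"
| "fdiv_tab n i r (C # \<tau>) =
     (\<Sum>b\<le>r. scale (q_idx n i powi (int b * (tab_weight n i \<tau> - int (r - b))))
       (tensor (fdiv_tab n i (r - b) \<tau>) (fdiv_col n i b C)))"

definition letters_in :: "nat \<Rightarrow> tabloid \<Rightarrow> bool" where
  "letters_in n \<tau> \<longleftrightarrow> (\<forall>C\<in>set \<tau>. C \<subseteq> alphabet n)"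

lemma letters_in_simps [simp]:
  "letters_in n []" "letters_in n (C # \<tau>) \<longleftrightarrow> C \<subseteq> alphabet n \<and> letters_in n \<tau>"
  by (auto simp: letters_in_def)

lemma set_word: "letters_in n \<tau> \<Longrightarrow> set (word \<tau>) = \<Union> (set \<tau>)"
  by (induction \<tau>) (auto simp: finite_column)

lemma letters_in_word: "letters_in n \<tau> \<Longrightarrow> set (word \<tau>) \<subseteq> alphabet n"
  by (auto simp: set_word letters_in_def)

lemma letters_in_tab_weight: "letters_in n \<tau> \<Longrightarrow> tab_weight n j \<tau> = word_weight n j (word \<tau>)"
  by (auto simp: letters_in_def intro: tab_weight_word finite_column)

lemma fdiv_tab_support:
  assumes i: "1 \<le> i" "i \<le> n"
  shows "letters_in n \<tau> \<Longrightarrow> Poly_Mapping.lookup (fdiv_tab n i r \<tau>) \<tau>' \<noteq> 0 \<Longrightarrow>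
    letters_in n \<tau>' \<and> map card \<tau>' = map card \<tau> \<and> lowered n i r (word \<tau>) (word \<tau>')"
proof (induction \<tau> arbitrary: r \<tau>')
  case Nil
  then show ?case
    by (auto simp: lookup_basis_vec lowered.Nil split: if_splits)
next
  case (Cons C \<tau>)
  obtain b where b: "b \<le> r"
    "Poly_Mapping.lookup (tensor (fdiv_tab n i (r - b) \<tau>) (fdiv_col n i b C)) \<tau>' \<noteq> 0"
    using Cons.prems(2) by (auto simp: lookup_sum elim!: sum.not_neutral_contains_not_neutral)
  then obtain C' \<sigma> where \<sigma>: "\<tau>' = C' # \<sigma>"
    by (cases \<tau>') auto
  have "Poly_Mapping.lookup (fdiv_tab n i (r - b) \<tau>) \<sigma> \<noteq> 0"
    "Poly_Mapping.lookup (fdiv_col n i b C) C' \<noteq> 0"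
    using b(2) by (auto simp: \<sigma>)
  then have "letters_in n \<sigma> \<and> map card \<sigma> = map card \<tau> \<and> lowered n i (r - b) (word \<tau>) (word \<sigma>)"
    "C' \<subseteq> alphabet n \<and> lowered n i b (col_word C) (col_word C')"
    using Cons fdiv_col_support[OF i, of C b C'] by auto
  then show ?case
    using lowered_append[of n i "r - b" "word \<tau>" "word \<sigma>" b] b(1) lowered_length[of n i b "col_word C" "col_word C'"]
    by (auto simp: \<sigma>)
qed

lemma fdiv_tab_nat_laurent:
  assumes i: "1 \<le> i" "i \<le> n"
  shows "Poly_Mapping.lookup (fdiv_tab n i r \<tau>) \<tau>' \<in> nat_laurent"
proof (induction \<tau> arbitrary: r \<tau>')
  case Nil
  then show ?case
    by (simp add: lookup_basis_vec)
next
  case (Cons C \<tau>)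
  show ?case
    by (cases \<tau>') (auto simp: lookup_sum intro!: nat_laurent_sum nat_laurent_mult Cons.IH
        fdiv_col_nat_laurent[OF i])
qed

text \<open>For a + b = r + 1 the term with f_i^(a) on the left and f_i^(b) on the right arises
  twice: from f_i acting on the left with factor [a], and from f_i acting on the right with factor
  [b]. By \<open>q_int_add\<close> the two add up to [a + b].\<close>

lemma f_op_fdiv_tab:
  assumes i: "1 \<le> i" "i \<le> n"
  shows "letters_in n \<tau> \<Longrightarrow>
    f_op n i (fdiv_tab n i r \<tau>) = scale (q_int n i (Suc r)) (fdiv_tab n i (Suc r) \<tau>)"
proof (induction \<tau> arbitrary: r)
  case Nil
  then show ?case
    by (simp add: f_op_def)
next
  case (Cons C \<tau>)
  let ?x = "q_idx n i" and ?m = "tab_weight n i \<tau>" and ?F = "\<lambda>r. fdiv_tab n i r \<tau>"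
    and ?c = "\<lambda>b. fdiv_col n i b C" and ?int = "q_int n i"
  let ?e = "\<lambda>b. ?x powi (int b * (?m - int (r - b)))"
  let ?X = "\<lambda>b. tensor (?F (Suc r - b)) (?c b)"
  \<comment> \<open>Each lowering subtracts a simple root, whose i-th coordinate is 2.\<close>
  have t: "t_op n i (?F a) = scale (?x powi (?m - 2 * int a)) (?F a)" for a
  proof (rule t_op_homogeneous[OF i(2)])
    fix \<sigma> assume "Poly_Mapping.lookup (?F a) \<sigma> \<noteq> 0"
    then have "letters_in n \<sigma> \<and> lowered n i a (word \<tau>) (word \<sigma>)"
      using fdiv_tab_support[OF i] Cons.prems by auto
    then show "tab_weight n i \<sigma> = ?m - 2 * int a"
      using Cons.prems lowered_weight[of n i a "word \<tau>" "word \<sigma>" i] i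
      by (simp add: letters_in_tab_weight cartan_diag)
  qed
  have step: "f_op n i (tensor (?F (r - b)) (?c b)) =
      scale (?int (Suc r - b)) (?X b) +
      scale (?x powi (?m - 2 * int (r - b)) * ?int (Suc b)) (?X (Suc b))" if "b \<le> r" for b
    using that Cons
    by (simp add: f_op_tensor t f_col_fdiv_col[OF i] tensor_scale_left tensor_scale_right Suc_diff_le mult.commute)
  \<comment> \<open>h b is the part of \<open>?X b\<close> that comes from f_i acting on the right
    factor of summand b - 1. There is none for b = 0, and with this shift both sums run over the
    same index.\<close>
  define h where "h b = (case b of 0 \<Rightarrow> 0
    | Suc b \<Rightarrow> scale (?e b * (?x powi (?m - 2 * int (r - b)) * ?int (Suc b))) (?X (Suc b)))" for b
  have "f_op n i (fdiv_tab n i r (C # \<tau>)) = (\<Sum>b\<le>r. scale (?e b) (f_op n i (tensor (?F (r - b)) (?c b))))"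
    by (simp add: f_op_def lin_extend_sum lin_extend_scale)
  also have "\<dots> = (\<Sum>b\<le>r. scale (?e b * ?int (Suc r - b)) (?X b)) + (\<Sum>b\<le>r. h (Suc b))"
    by (simp add: step scale_add_right h_def sum.distrib)
  \<comment> \<open>The added term b = r + 1 carries the factor [0] = 0.\<close>
  also have "(\<Sum>b\<le>r. scale (?e b * ?int (Suc r - b)) (?X b)) =
      (\<Sum>b\<le>Suc r. scale (?e b * ?int (Suc r - b)) (?X b))"
    by simp
  also have "(\<Sum>b\<le>r. h (Suc b)) = (\<Sum>b\<le>Suc r. h b)"
    by (subst sum.atMost_Suc_shift) (simp add: h_def)
  also have "(\<Sum>b\<le>Suc r. scale (?e b * ?int (Suc r - b)) (?X b)) + (\<Sum>b\<le>Suc r. h b) =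
      (\<Sum>b\<le>Suc r. scale (?int (Suc r) * ?x powi (int b * (?m - int (Suc r - b)))) (?X b))"
    unfolding sum.distrib[symmetric]
  proof (rule sum.cong[OF refl])
    fix b assume "b \<in> {..Suc r}"
    then obtain a where a: "Suc r = a + b"
      by (metis atMost_iff le_iff_add add.commute)
    have e: "?x powi (k + int b * (?m - int a)) = ?x powi k * ?x powi (int b * (?m - int a))" for k
      by (simp add: power_int_add)
    \<comment> \<open>For a = 0 the natural subtraction r - b truncates and the exponents disagree,
      but then [a] = 0 on both sides.\<close>
    have 1: "?e b * ?int a = ?x powi (int b * (?m - int a)) * (?x powi int b * ?int a)"
    proof (cases a)
      case (Suc a')
      then have "int b * (?m - int (r - b)) = int b + int b * (?m - int a)"
        using a by (simp add: algebra_simps)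
      then show ?thesis
        using e[of "int b"] by (simp add: mult_ac)
    qed simp
    have 2: "h b = scale (?x powi (int b * (?m - int a)) * (?x powi (- int a) * ?int b)) (?X b)"
    proof (cases b)
      case 0
      then show ?thesis
        by (simp add: h_def)
    next
      case (Suc b')
      then have "r - b' = a"
        using a by simp
      moreover have "int b' * (?m - int a) + (?m - 2 * int a) = - int a + int b * (?m - int a)"
        using Suc by (simp add: algebra_simps)
      ultimately have E: "?e b' * ?x powi (?m - 2 * int (r - b')) =
          ?x powi (- int a) * ?x powi (int b * (?m - int a))"
        using e[of "- int a"] by (metis power_int_add q_idx_nonzero)
      have "h b = scale (?e b' * ?x powi (?m - 2 * int (r - b')) * ?int b) (?X b)"
        unfolding h_def Suc by (simp only: nat.case mult.assoc)
      then show ?thesis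
        unfolding E by (simp only: mult_ac)
    qed
    have "scale (?e b * ?int a) (?X b) + h b =
        scale (?int (a + b) * ?x powi (int b * (?m - int a))) (?X b)"
      unfolding 1 2 q_int_add scale_add_left[symmetric] distrib_left[symmetric]
      by (simp only: mult.commute)
    then show "scale (?e b * ?int (Suc r - b)) (?X b) + h b =
        scale (?int (Suc r) * ?x powi (int b * (?m - int (Suc r - b)))) (?X b)"
      using a by simp
  qed
  also have "\<dots> = scale (?int (Suc r)) (fdiv_tab n i (Suc r) (C # \<tau>))"
    by (simp add: scale_sum del: sum.atMost_Suc)
  finally show ?case .
qed

lemma f_div_basis:
  assumes i: "1 \<le> i" "i \<le> n" and \<tau>: "letters_in n \<tau>"
  shows "f_div n i r (basis_vec \<tau>) = fdiv_tab n i r \<tau>"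
proof -
  have zero: "fdiv_tab n i 0 \<sigma> = basis_vec \<sigma>" for \<sigma>
    by (induction \<sigma>) simp_all
  have "(f_op n i ^^ r) (basis_vec \<tau>) = scale (q_fact n i r) (fdiv_tab n i r \<tau>)"
  proof (induction r)
    case 0
    then show ?case
      by (simp add: zero q_fact_def)
  next
    case (Suc r)
    then have "(f_op n i ^^ Suc r) (basis_vec \<tau>) = scale (q_fact n i r) (f_op n i (fdiv_tab n i r \<tau>))"
      by (simp add: f_op_def lin_extend_scale)
    then show ?case
      by (simp add: f_op_fdiv_tab[OF i \<tau>] q_fact_def)
  qed
  then show ?thesis
    by (simp add: f_div_def q_fact_nonzero)
qed

lemma f_div_expand:
  "f_div n i r v =
     (\<Sum>\<tau>\<in>Poly_Mapping.keys v. scale (Poly_Mapping.lookup v \<tau>) (f_div n i r (basis_vec \<tau>)))"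
proof -
  have f_sum: "f_div n i r (sum h S) = (\<Sum>x\<in>S. f_div n i r (h x))" for h :: "tabloid \<Rightarrow> _" and S
  proof -
    have "(f_op n i ^^ r) (sum h S) = (\<Sum>x\<in>S. (f_op n i ^^ r) (h x))"
      by (induction r) (simp_all add: f_op_def lin_extend_sum)
    then show ?thesis
      by (simp add: f_div_def scale_sum)
  qed
  have f_scale: "f_div n i r (scale c u) = scale c (f_div n i r u)" for c u
  proof -
    have "(f_op n i ^^ r) (scale c u) = scale c ((f_op n i ^^ r) u)"
      by (induction r) (simp_all add: f_op_def lin_extend_scale)
    then show ?thesis
      by (simp add: f_div_def mult.commute)
  qed
  have "v = (\<Sum>\<tau>\<in>Poly_Mapping.keys v. scale (Poly_Mapping.lookup v \<tau>) (basis_vec \<tau>))"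
    by (rule poly_mapping_eqI)
       (simp add: lookup_sum lookup_basis_vec in_keys_iff mult_delta_right)
  then have "f_div n i r v =
      f_div n i r (\<Sum>\<tau>\<in>Poly_Mapping.keys v. scale (Poly_Mapping.lookup v \<tau>) (basis_vec \<tau>))"
    by (rule arg_cong)
  then show ?thesis
    by (simp only: f_sum f_scale)
qed

section \<open>Raising a tabloid\<close>

definition raisable :: "nat \<Rightarrow> nat \<Rightarrow> column \<Rightarrow> column" where
  "raisable n i C =
     {a \<in> C \<inter> raised_letters n i. \<forall>b\<in>C. b < a \<longrightarrow> b \<notin> blocking_letters n i}"

definition raise_col :: "nat \<Rightarrow> nat \<Rightarrow> column \<Rightarrow> column" where
  "raise_col n i C = (C - raisable n i C) \<union> pred_letter n ` raisable n i C"

text \<open>Columns are read from right to left, so C is reached by the raising only if no column of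
  the tail holds a blocking letter. Blocking letters inside C itself are handled by
  \<open>raisable\<close>.\<close>

fun raise_tab :: "nat \<Rightarrow> nat \<Rightarrow> tabloid \<Rightarrow> tabloid" where
  "raise_tab n i [] = []"
| "raise_tab n i (C # \<tau>) =
     (if \<Union> (set \<tau>) \<inter> blocking_letters n i = {} then raise_col n i C else C) # raise_tab n i \<tau>"

lemma raise_word_sorted:
  assumes "i \<le> n" "sorted_wrt (<) w"
  shows "raise_word n i w = map (\<lambda>a. if a \<in> raisable n i (set w) then pred_letter n a else a) w"
    and "raise_number n i w = length (filter (\<lambda>a. a \<in> raisable n i (set w)) w)"
proof -
  have "raise_word n i w = map (\<lambda>a. if a \<in> raisable n i (set w) then pred_letter n a else a) w \<and>
    raise_number n i w = length (filter (\<lambda>a. a \<in> raisable n i (set w)) w)"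
    using assms(2)
  proof (induction w)
    case (Cons a w)
    show ?case
    proof (cases "a \<in> blocking_letters n i")
      case True
      then have "raisable n i (set (a # w)) = {}"
        using Cons.prems raised_not_blocking[OF assms(1), of a] by (auto simp: raisable_def)
      then show ?thesis
        using True by simp
    next
      case False
      have "c \<in> raisable n i (set (a # w)) \<longleftrightarrow> c \<in> raisable n i (set w)" if "c \<in> set w" for c
        using False that by (auto simp: raisable_def)
      moreover have "a \<in> raisable n i (set (a # w)) \<longleftrightarrow> a \<in> raised_letters n i"
        using Cons.prems by (auto simp: raisable_def)
      moreover have "filter (\<lambda>c. c \<in> raisable n i (set (a # w))) w = filter (\<lambda>c. c \<in> raisable n i (set w)) w"
        by (rule filter_cong) (use calculation(1) in auto)
      ultimately show ?thesis
        using False Cons by (auto simp del: set_simps)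
    qed
  qed (simp_all add: raisable_def)
  then show "raise_word n i w = map (\<lambda>a. if a \<in> raisable n i (set w) then pred_letter n a else a) w"
    "raise_number n i w = length (filter (\<lambda>a. a \<in> raisable n i (set w)) w)"
    by auto
qed

lemma sorted_col_word: "sorted_wrt (<) (col_word C)"
  by (simp add: col_word_def)

lemma raise_number_col_word:
  assumes "i \<le> n" "finite C"
  shows "raise_number n i (col_word C) = card (raisable n i C)"
proof -
  have "set (filter (\<lambda>a. a \<in> raisable n i C) (col_word C)) = raisable n i C"
    using assms by (auto simp: raisable_def)
  then have "length (filter (\<lambda>a. a \<in> raisable n i C) (col_word C)) = card (raisable n i C)"
    using distinct_card[of "filter (\<lambda>a. a \<in> raisable n i C) (col_word C)"] by simp
  then show ?thesis
    using raise_word_sorted(2)[OF assms(1) sorted_col_word] assms(2) by simp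
qed

lemma raise_col:
  assumes i: "1 \<le> i" "i \<le> n" and C: "C \<subseteq> alphabet n"
  shows "col_word (raise_col n i C) = raise_word n i (col_word C)"
    and "raise_col n i C \<subseteq> alphabet n" and "card (raise_col n i C) = card C"
proof -
  let ?g = "\<lambda>a. if a \<in> raisable n i C then pred_letter n a else a"
  have fin: "finite C"
    using C by (rule finite_column)
  have g: "raise_col n i C = ?g ` C"
    by (auto simp: raise_col_def raisable_def)
  have "strict_mono_on C ?g"
  proof (rule strict_mono_onI)
    fix x y assume xy: "x \<in> C" "y \<in> C" "x < y"
    have "?g x \<le> x"
      using pred_raised(2)[OF i, of x] by (auto simp: raisable_def)
    moreover have "x < ?g y"
    proof (cases "y \<in> raisable n i C")
      case True
      then have y: "y \<in> raised_letters n i" "x \<notin> blocking_letters n i"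
        using xy by (auto simp: raisable_def)
      \<comment> \<open>A raisable letter has no blocking letter below it in C, in particular not
        its own predecessor.\<close>
      then have "x \<le> pred_letter n y" "x \<noteq> pred_letter n y"
        using le_pred_raised[OF i y(1), of x] pred_raised(1)[OF i y(1)] xy C by auto
      then show ?thesis
        using True by simp
    qed (use xy in simp)
    ultimately show "?g x < ?g y"
      by simp
  qed
  then show *: "col_word (raise_col n i C) = raise_word n i (col_word C)"
    using raise_word_sorted(1)[OF i(2) sorted_col_word[of C]] fin col_word_image[OF fin, of ?g]
    by (simp only: g set_col_word)
  show "raise_col n i C \<subseteq> alphabet n"
    using C pred_raised(4)[OF i] by (auto simp: raise_col_def raisable_def)
  show "card (raise_col n i C) = card C"
    using * by (metis length_col_word length_raise_word)
qed

lemma raise_tab: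
  assumes i: "1 \<le> i" "i \<le> n"
  shows "letters_in n \<tau> \<Longrightarrow> word (raise_tab n i \<tau>) = raise_word n i (word \<tau>) \<and>
    letters_in n (raise_tab n i \<tau>) \<and> map card (raise_tab n i \<tau>) = map card \<tau>"
  by (induction \<tau>) (simp_all add: raise_word_append set_word[of n] raise_col[OF i])

text \<open>Raising turns weight -1 into weight 1, and letters that are neither raised nor blocking
  have weight 0. Hence the weight of a raised prefix counts its changed letters, which cancels the
  power of q in \<open>fdiv_tab_raise_tab\<close>.\<close>

lemma letter_weight_raised:
  assumes "1 \<le> i" "i \<le> n" "a \<notin> blocking_letters n i"
  shows "letter_weight n i (if a \<in> raised_letters n i then pred_letter n a else a) =
    of_bool (a \<in> raised_letters n i)"
  using assms
  by (cases "i < n") (auto simp: letter_weight_def raised_letters_def blocking_letters_def)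

lemma raise_word_weight:
  assumes "1 \<le> i" "i \<le> n"
  shows "set w \<inter> blocking_letters n i = {} \<Longrightarrow>
    word_weight n i (raise_word n i w) = int (raise_number n i w)"
proof (induction w)
  case (Cons a w)
  then show ?case
    using letter_weight_raised[OF assms, of a] by (auto simp: word_weight_def)
qed (simp add: word_weight_def)

lemma raisable_iff:
  "a \<in> raisable n i C \<longleftrightarrow>
    a \<in> C \<and> a \<in> raised_letters n i \<and> (\<forall>b\<in>blocking_letters n i. b < a \<longrightarrow> b \<notin> C)"
  unfolding raisable_def by blast

lemma raisable_less:
  assumes "i < n"
  shows "raisable n i C =
    (if Unbar (Suc i) \<in> C \<and> Unbar i \<notin> C then {Unbar (Suc i)} else {}) \<union>
    (if Bar i \<in> C \<and> Unbar i \<notin> C \<and> Bar (Suc i) \<notin> C then {Bar i} else {})"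
proof (rule set_eqI)
  fix a
  have r: "raised_letters n i = {Bar i, Unbar (Suc i)}" "blocking_letters n i = {Bar (Suc i), Unbar i}"
    using assms by (simp_all add: raised_letters_def blocking_letters_def)
  consider "a = Bar i" | "a = Unbar (Suc i)" | "a \<noteq> Bar i" "a \<noteq> Unbar (Suc i)"
    by blast
  then show "a \<in> raisable n i C \<longleftrightarrow>
      a \<in> (if Unbar (Suc i) \<in> C \<and> Unbar i \<notin> C then {Unbar (Suc i)} else {}) \<union>
        (if Bar i \<in> C \<and> Unbar i \<notin> C \<and> Bar (Suc i) \<notin> C then {Bar i} else {})"
    by cases (simp_all add: raisable_iff r conj_commute)
qed

lemma raisable_last:
  "raisable n n C = (if Bar n \<in> C \<and> Unbar n \<notin> C then {Bar n} else {})"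
proof (rule set_eqI)
  fix a
  show "a \<in> raisable n n C \<longleftrightarrow> a \<in> (if Bar n \<in> C \<and> Unbar n \<notin> C then {Bar n} else {})"
    by (cases "a = Bar n") (simp_all add: raisable_iff raised_letters_def blocking_letters_def)
qed

text \<open>The entries q and q^(-1) of the action do not lead back to C. The term with q ends in a
  column where \<open>Unbar i\<close> precedes and blocks \<open>Bar i\<close>; the one with q^(-1)
  starts from a column that still contains \<open>Unbar (i + 1)\<close>, which raising would have
  moved as well.\<close>

lemma fdiv_col_raise_col:
  assumes i: "1 \<le> i" "i \<le> n"
  shows "Poly_Mapping.lookup (fdiv_col n i (card (raisable n i C)) (raise_col n i C)) C = 1"
proof (cases "i < n")
  case False
  then have n: "i = n"
    using i by simp
  show ?thesis
  proof (cases "Bar n \<in> C \<and> Unbar n \<notin> C")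
    case True
    then have "raisable n i C = {Bar n}"
      by (auto simp: n raisable_last)
    moreover have "insert (Bar n) (insert (Unbar n) (C - {Bar n}) - {Unbar n}) = C"
      using True by auto
    ultimately show ?thesis
      using True by (simp add: n raise_col_def f_col_last lower_set_last lookup_basis_vec)
  next
    case False
    then have "raisable n i C = {}"
      by (auto simp: n raisable_last)
    then show ?thesis
      by (simp add: raise_col_def lookup_basis_vec)
  qed
next
  case True
  consider "raisable n i C = {}"
    | "raisable n i C = {Unbar (Suc i)}" "Unbar (Suc i) \<in> C" "Unbar i \<notin> C"
      "Bar i \<in> C \<longrightarrow> Bar (Suc i) \<in> C"
    | "raisable n i C = {Bar i}" "Bar i \<in> C" "Unbar i \<notin> C" "Unbar (Suc i) \<notin> C" "Bar (Suc i) \<notin> C"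
    | "raisable n i C = {Unbar (Suc i), Bar i}" "Bar i \<in> C" "Unbar i \<notin> C" "Unbar (Suc i) \<in> C"
      "Bar (Suc i) \<notin> C"
    unfolding raisable_less[OF True]
    by (cases "Unbar i \<in> C"; cases "Unbar (Suc i) \<in> C"; cases "Bar i \<in> C"; cases "Bar (Suc i) \<in> C";
        simp add: insert_commute)
  then show ?thesis
  proof cases
    case 1
    then show ?thesis
      by (simp add: raise_col_def lookup_basis_vec)
  next
    case 2
    have "insert (Unbar (Suc i)) (insert (Unbar i) (C - {Unbar (Suc i)}) - {Unbar i}) = C"
      using 2 by auto
    moreover have "C \<noteq> insert (Bar i) (insert (Unbar i) (C - {Unbar (Suc i)}) - {Bar (Suc i)})"
      using 2 by auto
    ultimately show ?thesis
      using 2 True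
      by (simp add: raise_col_def f_col_less lower_set_Unbar lower_set_Bar lookup_basis_vec lookup_add)
  next
    case 3
    have "insert (Bar i) (insert (Bar (Suc i)) (C - {Bar i}) - {Bar (Suc i)}) = C"
      using 3 by auto
    then show ?thesis
      using 3 True
      by (simp add: raise_col_def f_col_less lower_set_Unbar lower_set_Bar lookup_basis_vec)
  next
    case 4
    have "insert (Unbar (Suc i)) (insert (Bar i)
        (insert (Unbar i) (insert (Bar (Suc i)) (C - {Unbar (Suc i), Bar i})) - {Unbar i, Bar (Suc i)})) = C"
      using 4 by auto
    then show ?thesis
      using 4 True
      by (simp add: raise_col_def fdiv_col_two lower_set_both lookup_basis_vec)
  qed
qed

text \<open>Only one summand of the coproduct can restore C, and its power of q is trivial: either C
  was not raised and b = 0, or the tail was raised completely and its weight equals the number of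
  its raised letters.\<close>

lemma fdiv_tab_raise_tab:
  assumes i: "1 \<le> i" "i \<le> n"
  shows "letters_in n \<tau> \<Longrightarrow>
    Poly_Mapping.lookup (fdiv_tab n i (raise_number n i (word \<tau>)) (raise_tab n i \<tau>)) \<tau> = 1"
proof (induction \<tau>)
  case Nil
  then show ?case
    by (simp add: lookup_basis_vec)
next
  case (Cons C \<tau>)
  have C: "C \<subseteq> alphabet n" "finite C" and \<tau>: "letters_in n \<tau>"
    using Cons.prems finite_column by auto
  let ?free = "\<Union> (set \<tau>) \<inter> blocking_letters n i = {}"
  define C1 where "C1 = (if ?free then raise_col n i C else C)"
  define \<beta> where "\<beta> = (if ?free then card (raisable n i C) else 0)"
  define \<rho> where "\<rho> = raise_number n i (word \<tau>)"
  define r where "r = \<rho> + \<beta>"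
  define m where "m = tab_weight n i (raise_tab n i \<tau>)"
  have C1: "C1 \<subseteq> alphabet n"
    using C raise_col[OF i] by (simp add: C1_def)
  have r: "raise_number n i (word (C # \<tau>)) = r"
    using C i by (simp add: raise_number_append set_word[OF \<tau>] r_def \<rho>_def \<beta>_def raise_number_col_word)
  have lead: "Poly_Mapping.lookup (fdiv_col n i \<beta> C1) C = 1"
    using fdiv_col_raise_col[OF i] by (simp add: \<beta>_def C1_def lookup_basis_vec)
  \<comment> \<open>The number of lowered letters is determined by the weights of the two
    columns.\<close>
  have uniq: "Poly_Mapping.lookup (fdiv_col n i b C1) C = 0" if "b \<noteq> \<beta>" for b
  proof (rule ccontr)
    assume "Poly_Mapping.lookup (fdiv_col n i b C1) C \<noteq> 0"
    then have "lowered n i b (col_word C1) (col_word C)" "lowered n i \<beta> (col_word C1) (col_word C)"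
      using fdiv_col_support[OF i C1] lead by auto
    then show False
      using that cartan_diag[OF i] lowered_weight[OF _ i, of b "col_word C1" "col_word C" i]
        lowered_weight[OF _ i, of \<beta> "col_word C1" "col_word C" i] by simp
  qed
  have exponent: "int \<beta> * (m - int \<rho>) = 0"
  proof (cases ?free)
    case True
    then have "m = int \<rho>"
      using raise_tab[OF i \<tau>] raise_word_weight[OF i, of "word \<tau>"]
      by (simp add: m_def \<rho>_def letters_in_tab_weight set_word[OF \<tau>])
    then show ?thesis
      by simp
  qed (simp add: \<beta>_def)
  have "Poly_Mapping.lookup (fdiv_tab n i r (raise_tab n i (C # \<tau>))) (C # \<tau>) =
      (\<Sum>b\<le>r. q_idx n i powi (int b * (m - int (r - b))) *
        (Poly_Mapping.lookup (fdiv_tab n i (r - b) (raise_tab n i \<tau>)) \<tau> *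
         Poly_Mapping.lookup (fdiv_col n i b C1) C))"
    by (simp add: C1_def[symmetric] m_def[symmetric] lookup_sum)
  also have "\<dots> = (\<Sum>b\<in>{\<beta>}. q_idx n i powi (int b * (m - int (r - b))) *
        (Poly_Mapping.lookup (fdiv_tab n i (r - b) (raise_tab n i \<tau>)) \<tau> *
         Poly_Mapping.lookup (fdiv_col n i b C1) C))"
    by (rule sum.mono_neutral_right) (auto simp: r_def uniq)
  also have "\<dots> = 1"
    using Cons.IH[OF \<tau>] lead by (simp add: r_def \<rho>_def[symmetric] exponent)
  finally show ?case
    unfolding r .
qed

section \<open>Split columns\<close>

definition nth_letter :: "nat \<Rightarrow> nat \<Rightarrow> letter" where
  "nth_letter n k = (if k \<le> n then Unbar k else Bar (2 * n + 1 - k))"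

definition prefix_count :: "nat \<Rightarrow> column \<Rightarrow> nat \<Rightarrow> nat" where
  "prefix_count n X k = (\<Sum>j = 1..k. of_bool (nth_letter n j \<in> X))"

text \<open>For columns of the alphabet this is the order \<open>col_le\<close>, written by counting
  as in the tableau criterion for the Bruhat order; different heights are allowed. Counts are
  preferred because moving a letter to its neighbour changes a single one.\<close>

definition dominates :: "nat \<Rightarrow> column \<Rightarrow> column \<Rightarrow> bool" where
  "dominates n X Y \<longleftrightarrow> (\<forall>k\<le>2 * n. prefix_count n Y k \<le> prefix_count n X k)"

definition unpaired :: "column \<Rightarrow> bool" where
  "unpaired X \<longleftrightarrow> (\<forall>s. \<not> (Unbar s \<in> X \<and> Bar s \<in> X))"

text \<open>The relation between an admissible column C and the pair (lC, rC), formulated without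
  reference to the greedy choice of the letters t.\<close>

definition split_col :: "nat \<Rightarrow> column \<Rightarrow> column \<Rightarrow> column \<Rightarrow> bool" where
  "split_col n L R C \<longleftrightarrow>
     unpaired L \<and> unpaired R \<and>
     (\<forall>s. Unbar s \<in> C \<longleftrightarrow> Unbar s \<in> R) \<and> (\<forall>s. Bar s \<in> C \<longleftrightarrow> Bar s \<in> L) \<and>
     (\<forall>s. Unbar s \<in> L \<or> Bar s \<in> L \<longleftrightarrow> Unbar s \<in> R \<or> Bar s \<in> R) \<and>
     (\<forall>s\<le>n. prefix_count n R s \<le> prefix_count n L s) \<and>
     prefix_count n L n = prefix_count n R n \<and>
     (\<forall>s\<in>{1..n}. Unbar s \<notin> L \<and> Bar s \<notin> L \<longrightarrow> prefix_count n L s = prefix_count n R s)"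

section \<open>Prefix counts and simple reflections\<close>

lemma prefix_count_zero [simp]: "prefix_count n X 0 = 0"
  by (simp add: prefix_count_def)

lemma prefix_count_Suc [simp]:
  "prefix_count n X (Suc k) = prefix_count n X k + of_bool (nth_letter n (Suc k) \<in> X)"
  by (simp add: prefix_count_def)

lemma prefix_count_card: "prefix_count n X k = card {j \<in> {1..k}. nth_letter n j \<in> X}"
  by (simp add: prefix_count_def of_bool_def sum.If_cases Int_def)

lemma prefix_count_full:
  assumes "k \<le> prefix_count n X k" "j \<in> {1..k}"
  shows "nth_letter n j \<in> X"
proof -
  have "{j \<in> {1..k}. nth_letter n j \<in> X} = {1..k}"
    by (rule card_seteq) (use assms in \<open>auto simp: prefix_count_card\<close>)
  then show ?thesis
    using assms(2) by blast
qed

text \<open>Redistributing values between two neighbouring positions is visible only in the partial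
  sum that separates them.\<close>

lemma sum_swap:
  fixes f g :: "nat \<Rightarrow> nat"
  assumes "\<And>j. j \<noteq> c \<Longrightarrow> j \<noteq> Suc c \<Longrightarrow> f j = g j" "f c + f (Suc c) = g c + g (Suc c)" "1 \<le> c" "k \<noteq> c"
  shows "sum f {1..k} = sum g {1..k}"
proof (cases "k < c")
  case True
  then show ?thesis
    by (intro sum.cong) (auto intro: assms(1))
next
  case False
  then have sub: "{c, Suc c} \<subseteq> {1..k}"
    using assms by auto
  have "sum f ({1..k} - {c, Suc c}) = sum g ({1..k} - {c, Suc c})"
    by (intro sum.cong) (auto intro: assms(1))
  then show ?thesis
    using sum.subset_diff[OF sub, of f] sum.subset_diff[OF sub, of g] assms(2) by simp
qed

text \<open>On an unpaired column: the lower of the column and its image under the i-th simple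
  reflection, with raised letters moving together.\<close>

definition raise_free :: "nat \<Rightarrow> nat \<Rightarrow> column \<Rightarrow> column" where
  "raise_free n i X =
     (if X \<inter> blocking_letters n i = {}
      then (X - raised_letters n i) \<union> pred_letter n ` (X \<inter> raised_letters n i) else X)"

text \<open>The descent condition of the lifting argument: the reflection cannot replace a letter by
  a missing smaller one.\<close>

definition stable :: "nat \<Rightarrow> nat \<Rightarrow> column \<Rightarrow> bool" where
  "stable n i X \<longleftrightarrow> (\<forall>b\<in>raised_letters n i. b \<in> X \<longrightarrow> pred_letter n b \<in> X)"

text \<open>The reflection exchanges letters at positions i, i + 1 and 2n - i, 2n - i + 1, so only
  the counts at i and 2n - i may change, and they may only grow. The two positions coincide for i =
  n.\<close>

definition raised_from :: "nat \<Rightarrow> nat \<Rightarrow> column \<Rightarrow> column \<Rightarrow> bool" where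
  "raised_from n i X X' \<longleftrightarrow>
     (\<forall>k. k \<noteq> i \<longrightarrow> k \<noteq> 2 * n - i \<longrightarrow> prefix_count n X' k = prefix_count n X k) \<and>
     (\<forall>k. prefix_count n X k \<le> prefix_count n X' k)"

lemma raised_from_refl [simp]: "raised_from n i X X"
  by (simp add: raised_from_def)

lemma raise_free_less:
  assumes "i < n"
  shows "Unbar i \<in> raise_free n i X \<longleftrightarrow>
      (if Unbar i \<in> X \<or> Bar (Suc i) \<in> X then Unbar i \<in> X else Unbar (Suc i) \<in> X)"
    "Unbar (Suc i) \<in> raise_free n i X \<longleftrightarrow> (Unbar i \<in> X \<or> Bar (Suc i) \<in> X) \<and> Unbar (Suc i) \<in> X"
    "Bar (Suc i) \<in> raise_free n i X \<longleftrightarrow>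
      (if Unbar i \<in> X \<or> Bar (Suc i) \<in> X then Bar (Suc i) \<in> X else Bar i \<in> X)"
    "Bar i \<in> raise_free n i X \<longleftrightarrow> (Unbar i \<in> X \<or> Bar (Suc i) \<in> X) \<and> Bar i \<in> X"
    "s \<noteq> i \<Longrightarrow> s \<noteq> Suc i \<Longrightarrow> Unbar s \<in> raise_free n i X \<longleftrightarrow> Unbar s \<in> X"
    "s \<noteq> i \<Longrightarrow> s \<noteq> Suc i \<Longrightarrow> Bar s \<in> raise_free n i X \<longleftrightarrow> Bar s \<in> X"
proof -
  have r: "raised_letters n i = {Bar i, Unbar (Suc i)}" "blocking_letters n i = {Bar (Suc i), Unbar i}"
    using assms by (simp_all add: raised_letters_def blocking_letters_def)
  show "Unbar i \<in> raise_free n i X \<longleftrightarrow>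
      (if Unbar i \<in> X \<or> Bar (Suc i) \<in> X then Unbar i \<in> X else Unbar (Suc i) \<in> X)"
    "Unbar (Suc i) \<in> raise_free n i X \<longleftrightarrow> (Unbar i \<in> X \<or> Bar (Suc i) \<in> X) \<and> Unbar (Suc i) \<in> X"
    "Bar (Suc i) \<in> raise_free n i X \<longleftrightarrow>
      (if Unbar i \<in> X \<or> Bar (Suc i) \<in> X then Bar (Suc i) \<in> X else Bar i \<in> X)"
    "Bar i \<in> raise_free n i X \<longleftrightarrow> (Unbar i \<in> X \<or> Bar (Suc i) \<in> X) \<and> Bar i \<in> X"
    "s \<noteq> i \<Longrightarrow> s \<noteq> Suc i \<Longrightarrow> Unbar s \<in> raise_free n i X \<longleftrightarrow> Unbar s \<in> X"
    "s \<noteq> i \<Longrightarrow> s \<noteq> Suc i \<Longrightarrow> Bar s \<in> raise_free n i X \<longleftrightarrow> Bar s \<in> X"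
    using assms by (simp add: raise_free_def r image_iff; force)+
qed

lemma raise_free_last:
  "Unbar n \<in> raise_free n n X \<longleftrightarrow> Unbar n \<in> X \<or> Bar n \<in> X"
  "Bar n \<in> raise_free n n X \<longleftrightarrow> Unbar n \<in> X \<and> Bar n \<in> X"
  "s \<noteq> n \<Longrightarrow> Unbar s \<in> raise_free n n X \<longleftrightarrow> Unbar s \<in> X"
  "s \<noteq> n \<Longrightarrow> Bar s \<in> raise_free n n X \<longleftrightarrow> Bar s \<in> X"
  by (auto simp: raise_free_def raised_letters_def blocking_letters_def)

lemma raise_col_less:
  assumes "i < n"
  shows "Unbar i \<in> raise_col n i C \<longleftrightarrow> Unbar i \<in> C \<or> Unbar (Suc i) \<in> C"
    "Unbar (Suc i) \<in> raise_col n i C \<longleftrightarrow> Unbar i \<in> C \<and> Unbar (Suc i) \<in> C"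
    "Bar (Suc i) \<in> raise_col n i C \<longleftrightarrow> Bar (Suc i) \<in> C \<or> Bar i \<in> C \<and> Unbar i \<notin> C"
    "Bar i \<in> raise_col n i C \<longleftrightarrow> Bar i \<in> C \<and> (Unbar i \<in> C \<or> Bar (Suc i) \<in> C)"
    "s \<noteq> i \<Longrightarrow> s \<noteq> Suc i \<Longrightarrow> Unbar s \<in> raise_col n i C \<longleftrightarrow> Unbar s \<in> C"
    "s \<noteq> i \<Longrightarrow> s \<noteq> Suc i \<Longrightarrow> Bar s \<in> raise_col n i C \<longleftrightarrow> Bar s \<in> C"
  using assms by (simp add: raise_col_def raisable_less; force)+

lemma raise_col_last:
  "Unbar n \<in> raise_col n n C \<longleftrightarrow> Unbar n \<in> C \<or> Bar n \<in> C"
  "Bar n \<in> raise_col n n C \<longleftrightarrow> Unbar n \<in> C \<and> Bar n \<in> C"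
  "s \<noteq> n \<Longrightarrow> Unbar s \<in> raise_col n n C \<longleftrightarrow> Unbar s \<in> C"
  "s \<noteq> n \<Longrightarrow> Bar s \<in> raise_col n n C \<longleftrightarrow> Bar s \<in> C"
  by (auto simp: raise_col_def raisable_last)

lemma nth_letter_around:
  assumes "1 \<le> i" "i < n"
  shows "nth_letter n i = Unbar i" "nth_letter n (Suc i) = Unbar (Suc i)"
    "nth_letter n (2 * n - i) = Bar (Suc i)" "nth_letter n (Suc (2 * n - i)) = Bar i"
  using assms by (auto simp: nth_letter_def)

lemma nth_letter_last:
  assumes "1 \<le> n"
  shows "nth_letter n n = Unbar n" "nth_letter n (Suc n) = Bar n"
  using assms by (auto simp: nth_letter_def)

lemma raised_from_raise_free:
  assumes i: "1 \<le> i" "i \<le> n" and X: "unpaired X"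
  shows "raised_from n i X (raise_free n i X)"
proof -
  let ?Y = "raise_free n i X"
  let ?f = "\<lambda>j. of_bool (nth_letter n j \<in> X) :: nat" and ?g = "\<lambda>j. of_bool (nth_letter n j \<in> ?Y) :: nat"
  have off: "prefix_count n ?Y k = prefix_count n X k" if k: "k \<noteq> i" "k \<noteq> 2 * n - i" for k
  proof (cases "i < n")
    case True
    \<comment> \<open>An intermediate column in which only the unbarred pair has been exchanged;
      each of the two exchanges is one use of \<open>sum_swap\<close>.\<close>
    define h where "h j = (if j = i \<or> j = Suc i then ?g j else ?f j)" for j
    have d: "Suc i < 2 * n - i"
      using True by simp
    note nl = nth_letter_around[OF i(1) True] and rf = raise_free_less[OF True]
    have up: "\<not> (Unbar i \<in> X \<and> Bar i \<in> X)" "\<not> (Unbar (Suc i) \<in> X \<and> Bar (Suc i) \<in> X)"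
      using X by (auto simp: unpaired_def)
    have "sum ?f {1..k} = sum h {1..k}"
    proof (rule sum_swap[of i])
      show "?f i + ?f (Suc i) = h i + h (Suc i)"
        using up by (auto simp: h_def nl rf)
    qed (use i k in \<open>auto simp: h_def\<close>)
    also have "\<dots> = sum ?g {1..k}"
    proof (rule sum_swap[of "2 * n - i"])
      fix j assume j: "j \<noteq> 2 * n - i" "j \<noteq> Suc (2 * n - i)"
      show "h j = ?g j"
      proof (cases "j = i \<or> j = Suc i")
        case False
        have "nth_letter n j \<in> ?Y \<longleftrightarrow> nth_letter n j \<in> X"
        proof (cases "j \<le> n")
          case True
          then show ?thesis
            using False rf(5) by (simp add: nth_letter_def)
        next
          case False
          then have "2 * n + 1 - j \<noteq> i" "2 * n + 1 - j \<noteq> Suc i"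
            using j i by auto
          then show ?thesis
            using False rf(6) by (simp add: nth_letter_def)
        qed
        then show ?thesis
          using False by (simp add: h_def)
      qed (simp add: h_def)
    next
      show "h (2 * n - i) + h (Suc (2 * n - i)) = ?g (2 * n - i) + ?g (Suc (2 * n - i))"
        using up d by (auto simp: h_def nl rf)
    qed (use i k in auto)
    finally show ?thesis
      by (simp add: prefix_count_def)
  next
    case False
    then have n: "i = n"
      using i by simp
    have "sum ?f {1..k} = sum ?g {1..k}"
    proof (rule sum_swap[of n])
      fix j assume "j \<noteq> n" "j \<noteq> Suc n"
      then have "2 * n + 1 - j \<noteq> n"
        using i by auto
      then show "?f j = ?g j"
        using \<open>j \<noteq> n\<close> raise_free_last(3,4)[of _ n X] by (simp add: n nth_letter_def)
    next
      show "?f n + ?f (Suc n) = ?g n + ?g (Suc n)"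
        using X i by (auto simp: n nth_letter_last raise_free_last unpaired_def)
    qed (use i k n in auto)
    then show ?thesis
      by (simp add: prefix_count_def)
  qed
  have at: "prefix_count n X k \<le> prefix_count n ?Y k" if "k = i \<or> k = 2 * n - i" for k
  proof -
    \<comment> \<open>By parity the position before i or 2n - i is neither of them, so the count
      there is already known to be unchanged.\<close>
    have "k = Suc (k - 1)" "k - 1 \<noteq> i" "k - 1 \<noteq> 2 * n - i"
      using that i by presburger+
    then obtain k' where k': "k = Suc k'" "k' \<noteq> i" "k' \<noteq> 2 * n - i"
      by blast
    have "nth_letter n k \<in> X \<longrightarrow> nth_letter n k \<in> ?Y"
    proof (cases "i < n")
      case True
      then show ?thesis
        using that nth_letter_around[OF i(1) True] raise_free_less[OF True] by auto
    next
      case False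
      then have "i = n"
        using i by simp
      then show ?thesis
        using that i by (auto simp: nth_letter_last raise_free_last)
    qed
    then show ?thesis
      using off[OF k'(2,3)] by (auto simp: k'(1))
  qed
  show ?thesis
    unfolding raised_from_def using off at by (metis order_refl)
qed

lemma stable_raise_free:
  assumes i: "1 \<le> i" "i \<le> n" and X: "unpaired X"
  shows "stable n i (raise_free n i X)"
proof (cases "i < n")
  case True
  have "\<not> (Unbar i \<in> X \<and> Bar i \<in> X)" "\<not> (Unbar (Suc i) \<in> X \<and> Bar (Suc i) \<in> X)"
    using X by (auto simp: unpaired_def)
  then show ?thesis
    using True by (auto simp: stable_def raised_letters_def raise_free_less)
next
  case False
  then have "i = n"
    using i by simp
  then show ?thesis
    using X by (auto simp: stable_def raised_letters_def raise_free_last unpaired_def)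
qed

text \<open>The lifting property. Only k = i and k = 2n - i matter, and the counts at k - 1 and k +
  1 compare already. If the k-th letter is in X', the count of X' grows by one from k - 1 to k and
  that of Y' by at most one. If not, stability keeps the next letter out of X' too, so the count of
  X' at k is its count at k + 1.\<close>

lemma dominates_raised:
  assumes i: "1 \<le> i" "i \<le> n" and XY: "dominates n X Y"
    and X: "raised_from n i X X'" and Y: "raised_from n i Y Y'"
    and stable: "Y' \<noteq> Y \<longrightarrow> stable n i X'"
  shows "dominates n X' Y'"
proof (cases "Y' = Y")
  case True
  then show ?thesis
    using XY X unfolding dominates_def raised_from_def by (meson order_trans)
next
  case False
  have off: "prefix_count n Y' k \<le> prefix_count n X' k"
    if "k \<le> 2 * n" "k \<noteq> i" "k \<noteq> 2 * n - i" for k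
    using XY X Y that by (simp add: dominates_def raised_from_def)
  have at: "prefix_count n Y' k \<le> prefix_count n X' k" if "k = i \<or> k = 2 * n - i" for k
  proof -
    have "k = Suc (k - 1)" "k - 1 \<noteq> i" "k - 1 \<noteq> 2 * n - i"
      using that i by presburger+
    then obtain k' where k': "k = Suc k'" "k' \<noteq> i" "k' \<noteq> 2 * n - i"
      by blast
    have sk: "Suc k \<le> 2 * n" "Suc k \<noteq> i" "Suc k \<noteq> 2 * n - i"
      using that i by presburger+
    have 1: "prefix_count n Y' k' \<le> prefix_count n X' k'"
      "prefix_count n Y' (Suc k) \<le> prefix_count n X' (Suc k)"
      using off[of k'] off[of "Suc k"] k' sk by (simp_all del: prefix_count_Suc)
    have "nth_letter n (Suc k) \<in> raised_letters n i \<and>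
        pred_letter n (nth_letter n (Suc k)) = nth_letter n k"
    proof (cases "i < n")
      case True
      then show ?thesis
        using that nth_letter_around[OF i(1) True] by (auto simp: raised_letters_def)
    next
      case False
      then have "i = n"
        using i by simp
      then show ?thesis
        using that i by (auto simp: nth_letter_last raised_letters_def)
    qed
    then have "nth_letter n (Suc k) \<in> X' \<longrightarrow> nth_letter n k \<in> X'"
      using stable False by (auto simp: stable_def)
    then show ?thesis
      using 1 by (cases "nth_letter n k \<in> X'") (auto simp: k'(1))
  qed
  show ?thesis
    using off at unfolding dominates_def by blast
qed

text \<open>The positions i and i + 1 of a split column: \<open>La, Lb, Lc, Ld\<close> are the memberships of
  i, i + 1, Bar (i + 1), Bar i in L, likewise for R; x and y are the prefix counts before i.\<close>

lemma split_col_local: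
  fixes x y :: nat
  assumes "\<not> (La \<and> Ld)" "\<not> (Lb \<and> Lc)" "\<not> (Ra \<and> Rd)" "\<not> (Rb \<and> Rc)"
    and "La \<or> Ld \<longleftrightarrow> Ra \<or> Rd" "Lb \<or> Lc \<longleftrightarrow> Rb \<or> Rc"
    and "y \<le> x" "y + of_bool Ra \<le> x + of_bool La"
    and "y + of_bool Ra + of_bool Rb \<le> x + of_bool La + of_bool Lb"
    and "\<not> La \<and> \<not> Ld \<longrightarrow> x + of_bool La = y + of_bool Ra"
    and "\<not> Lb \<and> \<not> Lc \<longrightarrow> x + of_bool La + of_bool Lb = y + of_bool Ra + of_bool Rb"
    and t: "t \<longleftrightarrow> \<not> Ra \<and> \<not> Lc \<and> (Rb \<or> Ld)"
    and "la \<longleftrightarrow> (if t then if La \<or> Lc then La else Lb else La)"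
    and "lb \<longleftrightarrow> (if t then (La \<or> Lc) \<and> Lb else Lb)"
    and "lc \<longleftrightarrow> (if t then if La \<or> Lc then Lc else Ld else Lc)"
    and "ld \<longleftrightarrow> (if t then (La \<or> Lc) \<and> Ld else Ld)"
    and "ra \<longleftrightarrow> (if Ra \<or> Rc then Ra else Rb)" "rb \<longleftrightarrow> (Ra \<or> Rc) \<and> Rb"
    and "rc \<longleftrightarrow> (if Ra \<or> Rc then Rc else Rd)" "rd \<longleftrightarrow> (Ra \<or> Rc) \<and> Rd"
  shows "(Ra \<or> Rb \<longleftrightarrow> ra) \<and> (Ra \<and> Rb \<longleftrightarrow> rb) \<and> (Lc \<or> Ld \<and> \<not> Ra \<longleftrightarrow> lc) \<and> (Ld \<and> (Ra \<or> Lc) \<longleftrightarrow> ld) \<and>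
    \<not> (la \<and> ld) \<and> \<not> (lb \<and> lc) \<and> \<not> (ra \<and> rd) \<and> \<not> (rb \<and> rc) \<and>
    (la \<or> ld \<longleftrightarrow> ra \<or> rd) \<and> (lb \<or> lc \<longleftrightarrow> rb \<or> rc) \<and>
    y + of_bool ra \<le> x + of_bool la \<and>
    (\<not> la \<and> \<not> ld \<longrightarrow> x + of_bool la = y + of_bool ra) \<and>
    (\<not> lb \<and> \<not> lc \<longrightarrow> x + of_bool La + of_bool Lb = y + of_bool Ra + of_bool Rb)"
proof -
  \<comment> \<open>Unpaired columns with equal support admit five patterns at each index, which
    leaves twenty-five cases.\<close>
  have 1: "(\<not> La \<and> \<not> Ld \<and> \<not> Ra \<and> \<not> Rd) \<or> (La \<and> \<not> Ld \<and> Ra \<and> \<not> Rd) \<or> (La \<and> \<not> Ld \<and> \<not> Ra \<and> Rd) \<or>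
      (\<not> La \<and> Ld \<and> Ra \<and> \<not> Rd) \<or> (\<not> La \<and> Ld \<and> \<not> Ra \<and> Rd)"
    using assms(1,3,5) by blast
  have 2: "(\<not> Lb \<and> \<not> Lc \<and> \<not> Rb \<and> \<not> Rc) \<or> (Lb \<and> \<not> Lc \<and> Rb \<and> \<not> Rc) \<or> (Lb \<and> \<not> Lc \<and> \<not> Rb \<and> Rc) \<or>
      (\<not> Lb \<and> Lc \<and> Rb \<and> \<not> Rc) \<or> (\<not> Lb \<and> Lc \<and> \<not> Rb \<and> Rc)"
    using assms(2,4,6) by blast
  show ?thesis
    using 1 2 assms(7-11) unfolding assms(13-20) t
    by (elim disjE conjE) (simp_all)
qed

text \<open>R records the unbarred letters of C and L the barred ones. If C holds a blocking letter,
  raising C moves at most \<open>Unbar (i + 1)\<close>, so only R may change. The equality of counts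
  at free indices excludes the remaining conflict, where R would move its partner t into a free
  index i + 1 while L stays.\<close>

lemma split_col_raise:
  assumes i: "1 \<le> i" "i \<le> n" and split: "split_col n L R C"
  defines "L' \<equiv> if C \<inter> blocking_letters n i = {} \<and> C \<inter> raised_letters n i \<noteq> {} then raise_free n i L else L"
  shows "split_col n L' (raise_free n i R) (raise_col n i C)"
proof -
  let ?R' = "raise_free n i R"
  have unp: "unpaired L" "unpaired R"
    using split by (auto simp: split_col_def)
  have pc: "prefix_count n L' s = prefix_count n L s" "prefix_count n ?R' s = prefix_count n R s"
    if "s \<le> n" "s \<noteq> i" for s
    using that i raised_from_raise_free[OF i unp(1)] raised_from_raise_free[OF i unp(2)]
    by (auto simp: raised_from_def L'_def)
  obtain j where j: "i = Suc j"
    using i by (cases i) auto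
  have C: "Unbar s \<in> C \<longleftrightarrow> Unbar s \<in> R" "Bar s \<in> C \<longleftrightarrow> Bar s \<in> L" for s
    using split by (auto simp: split_col_def)
  have le: "prefix_count n R s \<le> prefix_count n L s" if "s \<le> n" for s
    using split that by (auto simp: split_col_def)
  have eq: "prefix_count n L n = prefix_count n R n"
    "s \<in> {1..n} \<Longrightarrow> Unbar s \<notin> L \<and> Bar s \<notin> L \<Longrightarrow> prefix_count n L s = prefix_count n R s" for s
    using split by (auto simp: split_col_def)
  have supp: "Unbar s \<in> L \<or> Bar s \<in> L \<longleftrightarrow> Unbar s \<in> R \<or> Bar s \<in> R" for s
    using split by (auto simp: split_col_def)
  have unps: "\<not> (Unbar s \<in> L \<and> Bar s \<in> L)" "\<not> (Unbar s \<in> R \<and> Bar s \<in> R)" for s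
    using unp by (auto simp: unpaired_def)
  show ?thesis
  proof (cases "i < n")
    case False
    then have n: "i = n"
      using i by simp
    have nl: "nth_letter n (Suc j) = Unbar n"
      using n j nth_letter_last i by simp
    have t: "C \<inter> blocking_letters n i = {} \<and> C \<inter> raised_letters n i \<noteq> {} \<longleftrightarrow> Unbar n \<notin> R \<and> Bar n \<in> L"
      by (auto simp: n blocking_letters_def raised_letters_def C)
    have s: "Unbar s \<in> L' \<longleftrightarrow> Unbar s \<in> L" "Bar s \<in> L' \<longleftrightarrow> Bar s \<in> L" if "s \<noteq> n" for s
      using that by (simp_all add: L'_def n raise_free_last)
    have "Unbar n \<in> L' \<longleftrightarrow> Unbar n \<in> L \<or> Unbar n \<notin> R \<and> Bar n \<in> L"
      "Bar n \<in> L' \<longleftrightarrow> Bar n \<in> L \<and> Unbar n \<in> R"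
      unfolding L'_def t using unps(1)[of n] by (auto simp: n raise_free_last)
    note mem = this raise_free_last(1,2)[of n R] raise_col_last(1,2)[of n C]
    have le_j: "prefix_count n R j \<le> prefix_count n L j" "prefix_count n L (Suc j) = prefix_count n R (Suc j)"
      using le[of j] eq(1) i j n by auto
    \<comment> \<open>The counts agree at n and that of R is not larger at n - 1, so position n
      cannot belong to L alone.\<close>
    have "Unbar n \<in> L \<longrightarrow> Unbar n \<in> R"
      using le_j by (cases "Unbar n \<in> R") (auto simp: nl)
    note local = this supp[of n] unps[of n] C[of n]
    have x: "prefix_count n L' (Suc j) = prefix_count n L j + of_bool (Unbar n \<in> L')"
      "prefix_count n ?R' (Suc j) = prefix_count n R j + of_bool (Unbar n \<in> ?R')"
      "prefix_count n L (Suc j) = prefix_count n L j + of_bool (Unbar n \<in> L)"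
      "prefix_count n R (Suc j) = prefix_count n R j + of_bool (Unbar n \<in> R)"
      using pc[of j] j n nl by simp_all
    show ?thesis
      unfolding split_col_def
    proof (intro conjI allI impI ballI)
      show "unpaired L'" "unpaired ?R'"
        unfolding unpaired_def using unps mem local s raise_free_last(3,4)[of _ n R]
        by (metis n)+
      show "Unbar u \<in> raise_col n i C \<longleftrightarrow> Unbar u \<in> ?R'" for u
        using C mem local raise_col_last(3)[of u n C] raise_free_last(3)[of u n R]
        by (cases "u = n") (auto simp: n)
      show "Bar u \<in> raise_col n i C \<longleftrightarrow> Bar u \<in> L'" for u
        using C[of u] mem local raise_col_last(4)[of u n C] s(2)[of u]
        by (cases "u = n") (auto simp: n)
      show "Unbar u \<in> L' \<or> Bar u \<in> L' \<longleftrightarrow> Unbar u \<in> ?R' \<or> Bar u \<in> ?R'" for u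
        using supp[of u] mem local s[of u] raise_free_last(3,4)[of u n R]
        by (cases "u = n") (auto simp: n)
      have top: "prefix_count n L' (Suc j) = prefix_count n ?R' (Suc j)"
        using mem local le_j(2) unfolding x by (auto simp: n)
      then show "prefix_count n L' n = prefix_count n ?R' n"
        using j n by simp
      show "prefix_count n ?R' u \<le> prefix_count n L' u" if "u \<le> n" for u
        using that top le[of u] pc[of u] j n by (cases "u = i") auto
      show "prefix_count n L' u = prefix_count n ?R' u"
        if "u \<in> {1..n}" "Unbar u \<notin> L' \<and> Bar u \<notin> L'" for u
        using that top eq(2)[of u] pc[of u] s[of u] j n by (cases "u = i") auto
    qed
  next
    case True
    have nl: "nth_letter n (Suc j) = Unbar i" "nth_letter n (Suc (Suc j)) = Unbar (Suc i)"
      using nth_letter_around[OF i(1) True] j by simp_all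
    have t: "C \<inter> blocking_letters n i = {} \<and> C \<inter> raised_letters n i \<noteq> {} \<longleftrightarrow>
        Unbar i \<notin> R \<and> Bar (Suc i) \<notin> L \<and> (Unbar (Suc i) \<in> R \<or> Bar i \<in> L)" (is "_ \<longleftrightarrow> ?t")
      using True by (auto simp: blocking_letters_def raised_letters_def C)
    have s: "Unbar u \<in> L' \<longleftrightarrow> Unbar u \<in> L" "Bar u \<in> L' \<longleftrightarrow> Bar u \<in> L" if "u \<noteq> i" "u \<noteq> Suc i" for u
      using that by (simp_all add: L'_def raise_free_less[OF True])
    have L': "Unbar i \<in> L' \<longleftrightarrow> (if ?t then if Unbar i \<in> L \<or> Bar (Suc i) \<in> L then Unbar i \<in> L
          else Unbar (Suc i) \<in> L else Unbar i \<in> L)"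
      "Unbar (Suc i) \<in> L' \<longleftrightarrow> (if ?t then (Unbar i \<in> L \<or> Bar (Suc i) \<in> L) \<and> Unbar (Suc i) \<in> L
          else Unbar (Suc i) \<in> L)"
      "Bar (Suc i) \<in> L' \<longleftrightarrow> (if ?t then if Unbar i \<in> L \<or> Bar (Suc i) \<in> L then Bar (Suc i) \<in> L
          else Bar i \<in> L else Bar (Suc i) \<in> L)"
      "Bar i \<in> L' \<longleftrightarrow> (if ?t then (Unbar i \<in> L \<or> Bar (Suc i) \<in> L) \<and> Bar i \<in> L else Bar i \<in> L)"
      unfolding L'_def t by (simp_all add: raise_free_less[OF True])
    have x: "prefix_count n L' i = prefix_count n L j + of_bool (Unbar i \<in> L')"
      "prefix_count n ?R' i = prefix_count n R j + of_bool (Unbar i \<in> ?R')"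
      "prefix_count n L i = prefix_count n L j + of_bool (Unbar i \<in> L)"
      "prefix_count n R i = prefix_count n R j + of_bool (Unbar i \<in> R)"
      "prefix_count n L (Suc i) = prefix_count n L j + of_bool (Unbar i \<in> L) + of_bool (Unbar (Suc i) \<in> L)"
      "prefix_count n R (Suc i) = prefix_count n R j + of_bool (Unbar i \<in> R) + of_bool (Unbar (Suc i) \<in> R)"
      using pc[of j] i unfolding j by (simp_all add: nl[unfolded j])
    have local: "(Unbar i \<in> R \<or> Unbar (Suc i) \<in> R \<longleftrightarrow> Unbar i \<in> ?R') \<and>
        (Unbar i \<in> R \<and> Unbar (Suc i) \<in> R \<longleftrightarrow> Unbar (Suc i) \<in> ?R') \<and>
        (Bar (Suc i) \<in> L \<or> Bar i \<in> L \<and> Unbar i \<notin> R \<longleftrightarrow> Bar (Suc i) \<in> L') \<and>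
        (Bar i \<in> L \<and> (Unbar i \<in> R \<or> Bar (Suc i) \<in> L) \<longleftrightarrow> Bar i \<in> L') \<and>
        \<not> (Unbar i \<in> L' \<and> Bar i \<in> L') \<and> \<not> (Unbar (Suc i) \<in> L' \<and> Bar (Suc i) \<in> L') \<and>
        \<not> (Unbar i \<in> ?R' \<and> Bar i \<in> ?R') \<and> \<not> (Unbar (Suc i) \<in> ?R' \<and> Bar (Suc i) \<in> ?R') \<and>
        (Unbar i \<in> L' \<or> Bar i \<in> L' \<longleftrightarrow> Unbar i \<in> ?R' \<or> Bar i \<in> ?R') \<and>
        (Unbar (Suc i) \<in> L' \<or> Bar (Suc i) \<in> L' \<longleftrightarrow> Unbar (Suc i) \<in> ?R' \<or> Bar (Suc i) \<in> ?R') \<and>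
        prefix_count n R j + of_bool (Unbar i \<in> ?R') \<le> prefix_count n L j + of_bool (Unbar i \<in> L') \<and>
        (\<not> Unbar i \<in> L' \<and> \<not> Bar i \<in> L' \<longrightarrow>
          prefix_count n L j + of_bool (Unbar i \<in> L') = prefix_count n R j + of_bool (Unbar i \<in> ?R')) \<and>
        (\<not> Unbar (Suc i) \<in> L' \<and> \<not> Bar (Suc i) \<in> L' \<longrightarrow>
          prefix_count n L j + of_bool (Unbar i \<in> L) + of_bool (Unbar (Suc i) \<in> L) =
          prefix_count n R j + of_bool (Unbar i \<in> R) + of_bool (Unbar (Suc i) \<in> R))"
    proof (rule split_col_local[OF unps(1)[of i] unps(1)[of "Suc i"] unps(2)[of i] unps(2)[of "Suc i"]
          supp[of i] supp[of "Suc i"] _ _ _ _ _ refl L' raise_free_less(1-4)[OF True, of R]])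
      show "prefix_count n R j \<le> prefix_count n L j"
        using le[of j] i j by simp
      show "prefix_count n R j + of_bool (Unbar i \<in> R) \<le> prefix_count n L j + of_bool (Unbar i \<in> L)"
        using le[of i] i by (simp add: x)
      show "prefix_count n R j + of_bool (Unbar i \<in> R) + of_bool (Unbar (Suc i) \<in> R)
          \<le> prefix_count n L j + of_bool (Unbar i \<in> L) + of_bool (Unbar (Suc i) \<in> L)"
        using le[of "Suc i"] True unfolding x by simp
      show "\<not> Unbar i \<in> L \<and> \<not> Bar i \<in> L \<longrightarrow>
          prefix_count n L j + of_bool (Unbar i \<in> L) = prefix_count n R j + of_bool (Unbar i \<in> R)"
        using eq(2)[of i] i unfolding x by simp
      show "\<not> Unbar (Suc i) \<in> L \<and> \<not> Bar (Suc i) \<in> L \<longrightarrow>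
          prefix_count n L j + of_bool (Unbar i \<in> L) + of_bool (Unbar (Suc i) \<in> L) =
          prefix_count n R j + of_bool (Unbar i \<in> R) + of_bool (Unbar (Suc i) \<in> R)"
        using eq(2)[of "Suc i"] True unfolding x by simp
    qed
    note rc = raise_col_less(5,6)[OF True, of _ C] raise_col_less(1-4)[OF True, of C]
      and rf = raise_free_less(5,6)[OF True, of _ R]
    show ?thesis
      unfolding split_col_def
    proof (intro conjI allI impI ballI)
      show "unpaired L'"
        unfolding unpaired_def using unps(1) local s by metis
      show "unpaired ?R'"
        unfolding unpaired_def using unps(2) local rf by metis
      show "Unbar u \<in> raise_col n i C \<longleftrightarrow> Unbar u \<in> ?R'" for u
        using C local rc rf by metis
      show "Bar u \<in> raise_col n i C \<longleftrightarrow> Bar u \<in> L'" for u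
        using C local rc s by metis
      show "Unbar u \<in> L' \<or> Bar u \<in> L' \<longleftrightarrow> Unbar u \<in> ?R' \<or> Bar u \<in> ?R'" for u
        using supp[of u] local s[of u] rf[of u] by metis
      show "prefix_count n L' n = prefix_count n ?R' n"
        using pc[of n] eq(1) True by simp
      show "prefix_count n ?R' u \<le> prefix_count n L' u" if "u \<le> n" for u
        using that local le[of u] pc[of u] x(1,2) by (cases "u = i") simp_all
      show "prefix_count n L' u = prefix_count n ?R' u"
        if u: "u \<in> {1..n}" "Unbar u \<notin> L' \<and> Bar u \<notin> L'" for u
      proof -
        consider "u = i" | "u = Suc i" | "u \<noteq> i" "u \<noteq> Suc i"
          by blast
        then show ?thesis
        proof cases
          case 1
          then show ?thesis
            using u local x(1,2) by simp
        next
          case 2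
          then have "prefix_count n L (Suc i) = prefix_count n R (Suc i)"
            using u local unfolding x by simp
          then show ?thesis
            using 2 u pc[of u] by (simp del: prefix_count_Suc)
        next
          case 3
          then show ?thesis
            using u eq(2)[of u] pc[of u] s[of u] by simp
        qed
      qed
    qed
  qed
qed

text \<open>The invariant replacing symplecticity of a tableau; the column X bounds the tabloid on the left.\<close>

fun splittable :: "nat \<Rightarrow> column \<Rightarrow> tabloid \<Rightarrow> bool" where
  "splittable n X [] \<longleftrightarrow> True"
| "splittable n X (C # \<tau>) \<longleftrightarrow>
     (\<exists>L R. split_col n L R C \<and> dominates n X L \<and> splittable n R \<tau>)"

text \<open>The bound X' is the R of the column on the left, which is reflected, hence stable, when
  nothing to its right blocks. An L moves only if neither its column nor the tail blocks, and this
  is exactly the case in which the lifting property asks for a stable bound.\<close>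

lemma splittable_raise_tab:
  assumes i: "1 \<le> i" "i \<le> n"
  shows "splittable n X \<tau> \<Longrightarrow> raised_from n i X X' \<Longrightarrow>
    (\<Union> (set \<tau>) \<inter> blocking_letters n i = {} \<longrightarrow> stable n i X') \<Longrightarrow>
    splittable n X' (raise_tab n i \<tau>)"
proof (induction \<tau> arbitrary: X X')
  case (Cons C \<tau>)
  then obtain L R where LR: "split_col n L R C" "dominates n X L" "splittable n R \<tau>"
    by auto
  then have unp: "unpaired L" "unpaired R"
    by (auto simp: split_col_def)
  show ?case
  proof (cases "\<Union> (set \<tau>) \<inter> blocking_letters n i = {}")
    case True
    define L' where "L' =
      (if C \<inter> blocking_letters n i = {} \<and> C \<inter> raised_letters n i \<noteq> {} then raise_free n i L else L)"
    have "split_col n L' (raise_free n i R) (raise_col n i C)"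
      using split_col_raise[OF i LR(1)] by (simp add: L'_def)
    moreover have "splittable n (raise_free n i R) (raise_tab n i \<tau>)"
      using Cons.IH[OF LR(3) raised_from_raise_free[OF i unp(2)]] stable_raise_free[OF i unp(2)] by blast
    moreover have "dominates n X' L'"
    proof (rule dominates_raised[OF i LR(2) Cons.prems(2)])
      show "raised_from n i L L'"
        using raised_from_raise_free[OF i unp(1)] by (simp add: L'_def)
      \<comment> \<open>A change of L means that C has no blocking letter, so together with the free
        tail the hypothesis on X' applies.\<close>
      show "L' \<noteq> L \<longrightarrow> stable n i X'"
        using Cons.prems(3) True by (auto simp: L'_def Int_Un_distrib2 split: if_splits)
    qed
    ultimately show ?thesis
      using True by auto
  next
    case False
    have "dominates n X' L"
      by (rule dominates_raised[OF i LR(2) Cons.prems(2) raised_from_refl]) simp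
    moreover have "splittable n R (raise_tab n i \<tau>)"
      using Cons.IH[OF LR(3) raised_from_refl] False by blast
    ultimately show ?thesis
      using LR(1) False by auto
  qed
qed simp

section \<open>Consequences of the invariant for initial segments and columns of highest
  weight\<close>

lemma stable_alphabet: "1 \<le> i \<Longrightarrow> i \<le> n \<Longrightarrow> stable n i (alphabet n)"
  unfolding stable_def using pred_raised(4) by blast

text \<open>R contains 1, ..., s, and L has at least as many letters up to s, so it contains them
  too. Being unpaired, L then lacks \<open>Bar s\<close>. This is what the search for the active
  letter needs from admissibility.\<close>

lemma split_col_initial:
  assumes "split_col n L R C" "1 \<le> s" "s \<le> n" "\<And>j. 1 \<le> j \<Longrightarrow> j \<le> s \<Longrightarrow> Unbar j \<in> C"
  shows "Bar s \<notin> C"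
proof -
  have "nth_letter n j \<in> R" if "j \<in> {1..s}" for j
    using assms that by (simp add: nth_letter_def split_col_def)
  then have "{j \<in> {1..s}. nth_letter n j \<in> R} = {1..s}"
    by blast
  then have "prefix_count n R s = s"
    by (simp add: prefix_count_card)
  then have "s \<le> prefix_count n L s"
    using assms by (auto simp: split_col_def)
  then have "Unbar s \<in> L"
    using prefix_count_full[of s n L s] assms by (simp add: nth_letter_def)
  then show ?thesis
    using assms(1) by (auto simp: split_col_def unpaired_def)
qed

lemma split_col_hw:
  assumes "split_col n L R (hw_column p)" "dominates n X L" "p \<le> n" "s \<in> {1..p}"
  shows "Unbar s \<in> X"
proof -
  have L: "Unbar j \<in> L" if "j \<in> {1..p}" for j
  proof -
    have "Unbar j \<in> hw_column p" "Bar j \<notin> hw_column p"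
      using that by (auto simp: hw_column_def)
    then show ?thesis
      using assms(1) by (auto simp: split_col_def)
  qed
  have "{j \<in> {1..p}. nth_letter n j \<in> L} = {1..p}"
    using L assms(3) by (auto simp: nth_letter_def)
  then have "prefix_count n L p = p"
    by (simp add: prefix_count_card)
  then have "p \<le> prefix_count n X p"
    using assms(2,3) unfolding dominates_def by (metis mult_2 trans_le_add1)
  then show ?thesis
    using prefix_count_full[of p n X s] assms(3,4) by (simp add: nth_letter_def)
qed

text \<open>A column of highest weight has no barred letters, so its L contains the same initial
  segment, and domination at a full prefix forces that segment into the bound. The inclusion passes
  from column to column.\<close>

lemma splittable_hw:
  assumes "splittable n X \<tau>" "\<forall>D\<in>set \<tau>. D = hw_column (card D) \<and> card D \<le> n"
    and "D \<in> set \<tau>" "Unbar s \<in> D"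
  shows "Unbar s \<in> X"
  using assms
proof (induction \<tau> arbitrary: X)
  case (Cons C \<tau>)
  then obtain L R where LR: "split_col n L R C" "dominates n X L" "splittable n R \<tau>"
    by auto
  have C: "C = hw_column (card C)" "card C \<le> n"
    using Cons.prems(2) by auto
  have "Unbar s \<in> C"
  proof (cases "D = C")
    case False
    then have "Unbar s \<in> R"
      using Cons.IH[OF LR(3)] Cons.prems by auto
    then show ?thesis
      using LR(1) by (auto simp: split_col_def)
  qed (use Cons.prems in simp)
  then have "s \<in> {1..card C}"
    using C(1) unfolding hw_column_def by blast
  then show ?case
    using split_col_hw[of n L R "card C" X s] LR C by simp
qed simp

lemma splittable_nth:
  assumes "splittable n X \<tau>" "k < length \<tau>"
  shows "\<exists>L R. split_col n L R (\<tau> ! k) \<and> splittable n R (drop (Suc k) \<tau>)"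
  using assms
proof (induction \<tau> arbitrary: X k)
  case (Cons C \<tau>)
  then show ?case
    by (cases k) auto
qed simp


section \<open>Symplectic tableaux are splittable\<close>

lemma prefix_count_le_card:
  assumes "X \<subseteq> alphabet n" "1 \<le> k" "k \<le> 2 * n"
  shows "prefix_count n X k = card {b \<in> X. b \<le> nth_letter n k}"
proof -
  have "bij_betw (nth_letter n) {j \<in> {1..k}. nth_letter n j \<in> X} {b \<in> X. b \<le> nth_letter n k}"
  proof (rule bij_betwI')
    fix i j assume "i \<in> {j \<in> {1..k}. nth_letter n j \<in> X}" "j \<in> {j \<in> {1..k}. nth_letter n j \<in> X}"
    then show "nth_letter n i = nth_letter n j \<longleftrightarrow> i = j"
      using assms(3) by (auto simp: nth_letter_def split: if_splits)
  next
    fix j assume "j \<in> {j \<in> {1..k}. nth_letter n j \<in> X}"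
    then show "nth_letter n j \<in> {b \<in> X. b \<le> nth_letter n k}"
      by (auto simp: nth_letter_def split: if_splits)
  next
    fix b assume b: "b \<in> {b \<in> X. b \<le> nth_letter n k}"
    show "\<exists>j\<in>{j \<in> {1..k}. nth_letter n j \<in> X}. b = nth_letter n j"
    proof (cases b)
      case (Unbar s)
      then have "1 \<le> s" "s \<le> n"
        using b assms(1) by auto
      then show ?thesis
        using b Unbar by (intro bexI[of _ s]) (auto simp: nth_letter_def split: if_splits)
    next
      case (Bar s)
      then have "1 \<le> s" "s \<le> n"
        using b assms(1) by auto
      then show ?thesis
        using b Bar assms(3) by (intro bexI[of _ "2 * n + 1 - s"]) (auto simp: nth_letter_def split: if_splits)
    qed
  qed
  then show ?thesis
    by (simp add: prefix_count_card bij_betw_same_card)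
qed

text \<open>Translates between entries of a sorted column and counts of small letters, the two
  descriptions of the column order.\<close>

lemma card_le_nth_col_word:
  fixes a :: letter
  assumes "finite X"
  shows "k < card {b \<in> X. b \<le> a} \<longleftrightarrow> k < card X \<and> col_word X ! k \<le> a"
proof -
  let ?w = "col_word X"
  have w: "sorted ?w" "distinct ?w" "length ?w = card X" "set ?w = X"
    using assms by (simp_all add: col_word_def)
  have "{b \<in> X. b \<le> a} = (!) ?w ` {j. j < card X \<and> ?w ! j \<le> a}"
    using w(3,4) by (auto simp: in_set_conv_nth[of _ ?w, unfolded w(3,4)])
  moreover have "inj_on ((!) ?w) {j. j < card X \<and> ?w ! j \<le> a}"
    using w(2,3) by (auto simp: inj_on_def nth_eq_iff_index_eq)
  ultimately have card: "card {b \<in> X. b \<le> a} = card {j. j < card X \<and> ?w ! j \<le> a}"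
    by (simp add: card_image)
  show ?thesis
  proof
    assume k: "k < card X \<and> ?w ! k \<le> a"
    have "{..k} \<subseteq> {j. j < card X \<and> ?w ! j \<le> a}"
      using k sorted_nth_mono[OF w(1), of _ k] w(3) by (auto intro: order_trans)
    then have "card {..k} \<le> card {j. j < card X \<and> ?w ! j \<le> a}"
      by (intro card_mono) auto
    then show "k < card {b \<in> X. b \<le> a}"
      by (simp add: card)
  next
    assume k: "k < card {b \<in> X. b \<le> a}"
    show "k < card X \<and> ?w ! k \<le> a"
    proof (rule ccontr)
      assume *: "\<not> (k < card X \<and> ?w ! k \<le> a)"
      have "{j. j < card X \<and> ?w ! j \<le> a} \<subseteq> {..<k}"
      proof
        fix j assume j: "j \<in> {j. j < card X \<and> ?w ! j \<le> a}"
        show "j \<in> {..<k}"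
        proof (rule ccontr)
          assume "j \<notin> {..<k}"
          then have "k \<le> j"
            by simp
          then show False
            using j * sorted_nth_mono[OF w(1), of k j] w(3) by auto
        qed
      qed
      then have "card {j. j < card X \<and> ?w ! j \<le> a} \<le> card {..<k}"
        by (intro card_mono) auto
      then show False
        using k by (simp add: card)
    qed
  qed
qed

lemma col_le_dominates:
  assumes "col_le X Y" "X \<subseteq> alphabet n" "Y \<subseteq> alphabet n"
  shows "dominates n X Y"
  unfolding dominates_def
proof (intro allI impI)
  fix k assume k: "k \<le> 2 * n"
  show "prefix_count n Y k \<le> prefix_count n X k"
  proof (cases "k = 0 \<or> prefix_count n Y k = 0")
    case True
    then show ?thesis
      by auto
  next
    case False
    let ?a = "nth_letter n k"
    have fin: "finite X" "finite Y"
      using assms finite_column by auto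
    have pc: "prefix_count n X k = card {b \<in> X. b \<le> ?a}" "prefix_count n Y k = card {b \<in> Y. b \<le> ?a}"
      using prefix_count_le_card[of X n k] prefix_count_le_card[of Y n k] assms False k by auto
    then obtain m where m: "card {b \<in> Y. b \<le> ?a} = Suc m"
      using False by (metis not0_implies_Suc)
    then have "m < card Y" "col_word Y ! m \<le> ?a"
      using card_le_nth_col_word[OF fin(2), of m ?a] by auto
    then have "m < card X" "col_word X ! m \<le> ?a"
      using assms(1) by (auto simp: col_le_def intro: order_trans)
    then show ?thesis
      using card_le_nth_col_word[OF fin(1), of m ?a] pc m by auto
  qed
qed

section \<open>The greedy splitting of an admissible column\<close>

lemma is_greatest_unique: "is_greatest S s \<Longrightarrow> is_greatest S t \<Longrightarrow> s = t"
  by (auto simp: is_greatest_def intro: antisym)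

lemma is_splitting_unique:
  assumes "is_splitting C ts" "is_splitting C us"
  shows "ts = us"
proof (rule nth_equalityI)
  define S where "S k p = {t. 1 \<le> t \<and> t < (if k = 0 then pairs_of C ! 0 else min p (pairs_of C ! k)) \<and>
    Unbar t \<notin> C \<and> Bar t \<notin> C}" for k p
  have g: "is_greatest (S k (vs ! (k - 1))) (vs ! k)" if "is_splitting C vs" "k < length vs" for vs k
    using that unfolding is_splitting_def Let_def S_def by auto
  show len: "length ts = length us"
    using assms by (simp add: is_splitting_def Let_def)
  fix k assume "k < length ts"
  then show "ts ! k = us ! k"
  proof (induction k)
    case 0
    have "S 0 (ts ! (0 - 1)) = S 0 (us ! (0 - 1))"
      by (simp add: S_def)
    then show ?case
      using g[OF assms(1), of 0] g[OF assms(2), of 0] 0 len is_greatest_unique by auto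
  next
    case (Suc k)
    then show ?case
      using g[OF assms(1), of "Suc k"] g[OF assms(2), of "Suc k"] len is_greatest_unique by auto
  qed
qed

lemma is_splitting_splitting: "admissible C \<Longrightarrow> is_splitting C (splitting C)"
  unfolding admissible_def splitting_def using is_splitting_unique by (metis theI)

text \<open>Up to s, the counts of lC and rC differ by the number of t at most s minus the number of
  z at most s. This is nonnegative since each t lies below its z, and it vanishes at n and at every
  free index by maximality of the t.\<close>

lemma split_col_lcol_rcol:
  assumes C: "C \<subseteq> alphabet n" and adm: "admissible C"
  shows "split_col n (lcol C) (rcol C) C" and "lcol C \<subseteq> alphabet n" and "rcol C \<subseteq> alphabet n"
proof -
  define zs ts where "zs = pairs_of C" and "ts = splitting C"
  let ?Z = "{z. Unbar z \<in> C \<and> Bar z \<in> C}"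
  let ?free = "\<lambda>t. 1 \<le> t \<and> Unbar t \<notin> C \<and> Bar t \<notin> C"
  have "?Z \<subseteq> {1..n}"
    using C by auto
  then have finZ: "finite ?Z"
    using finite_subset by blast
  have zs: "set zs = ?Z" "distinct zs" "sorted (rev zs)"
    using finZ by (simp_all add: zs_def pairs_of_def)
  have z_mono: "zs ! l < zs ! k" if "k < l" "l < length zs" for k l
    using sorted_rev_nth_mono[OF zs(3), of k l] that zs(2) nth_eq_iff_index_eq[OF zs(2), of k l] by force
  have spl: "is_splitting C ts"
    using is_splitting_splitting[OF adm] by (simp add: ts_def)
  have len: "length ts = length zs"
    using spl by (simp add: is_splitting_def zs_def Let_def)
  have greatest: "is_greatest {t. 1 \<le> t \<and> t < (if k = 0 then zs ! 0 else min (ts ! (k - 1)) (zs ! k)) \<and>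
      Unbar t \<notin> C \<and> Bar t \<notin> C} (ts ! k)" if "k < length zs" for k
    using spl that unfolding is_splitting_def zs_def Let_def by auto
  have t: "?free (ts ! k)" "ts ! k < zs ! k" "k > 0 \<Longrightarrow> ts ! k < ts ! (k - 1)" if "k < length zs" for k
    using greatest[OF that] by (auto simp: is_greatest_def split: if_splits)
  have t_max: "s \<le> ts ! k" if "k < length zs" "?free s" "s < zs ! k" "k > 0 \<Longrightarrow> s < ts ! (k - 1)" for k s
    using greatest[OF that(1)] that(2-) by (auto simp: is_greatest_def split: if_splits)
  have t_mono: "ts ! l < ts ! k" if "k < l" "l < length zs" for k l
    using that
  proof (induction l)
    case (Suc l)
    have "ts ! Suc l < ts ! l"
      using t(3)[of "Suc l"] Suc.prems by simp
    then show ?case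
      using Suc by (cases "k = l") auto
  qed simp
  have ts_dist: "distinct ts"
    using t_mono by (metis distinct_conv_nth len nat_neq_iff)
  \<comment> \<open>No free index left unchosen lies between t and its z: below the previous t, the
    greedy choice would have taken it; above, the induction hypothesis applies and the z
    decrease.\<close>
  have gap: "zs ! k < s" if "k < length zs" "?free s" "s \<notin> set ts" "ts ! k \<le> s" for k s
    using that
  proof (induction k)
    case 0
    then have "s \<noteq> ts ! 0"
      using len by auto
    then have "\<not> s < zs ! 0"
      using t_max[of 0 s] 0 by auto
    moreover have "zs ! 0 \<in> ?Z"
      using 0 zs(1) nth_mem by blast
    ultimately show ?case
      using 0(2) by (metis linorder_neqE_nat mem_Collect_eq)
  next
    case (Suc k)
    have "s \<noteq> ts ! Suc k"
      using Suc.prems len by (metis nth_mem)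
    show ?case
    proof (cases "ts ! k \<le> s")
      case True
      then show ?thesis
        using Suc z_mono[of k "Suc k"] by simp
    next
      case False
      then have "\<not> s < zs ! Suc k"
        using t_max[of "Suc k" s] Suc.prems \<open>s \<noteq> ts ! Suc k\<close> by auto
      moreover have "zs ! Suc k \<in> ?Z"
        using Suc.prems zs(1) nth_mem by blast
      ultimately show ?thesis
        using Suc.prems(2) by (metis linorder_neqE_nat mem_Collect_eq)
    qed
  qed
  have tfree: "?free s" if "s \<in> set ts" for s
    using that t(1) by (metis in_set_conv_nth len)
  have mem: "Unbar s \<in> lcol C \<longleftrightarrow> Unbar s \<in> C \<and> s \<notin> set zs \<or> s \<in> set ts"
    "Bar s \<in> lcol C \<longleftrightarrow> Bar s \<in> C"
    "Unbar s \<in> rcol C \<longleftrightarrow> Unbar s \<in> C"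
    "Bar s \<in> rcol C \<longleftrightarrow> Bar s \<in> C \<and> s \<notin> set zs \<or> s \<in> set ts" for s
    by (auto simp: lcol_def rcol_def zs_def[symmetric] ts_def[symmetric])
  have t_le: "s \<le> n" if "s \<in> set ts" for s
  proof -
    obtain k where "k < length zs" "s = ts ! k"
      using \<open>s \<in> set ts\<close> len by (metis in_set_conv_nth)
    then have "s < zs ! k" "zs ! k \<in> ?Z"
      using t(2) zs(1) nth_mem by blast+
    then show ?thesis
      using \<open>?Z \<subseteq> {1..n}\<close> by auto
  qed
  show "lcol C \<subseteq> alphabet n" "rcol C \<subseteq> alphabet n"
    using C tfree t_le by (auto simp: lcol_def rcol_def zs_def[symmetric] ts_def[symmetric])
  have index_card: "card {x \<in> set xs. x \<le> s} = card {k. k < length xs \<and> xs ! k \<le> s}"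
    if "distinct xs" for xs :: "nat list" and s
  proof -
    have "{x \<in> set xs. x \<le> s} = (!) xs ` {k. k < length xs \<and> xs ! k \<le> s}"
      by (auto simp: in_set_conv_nth)
    moreover have "inj_on ((!) xs) {k. k < length xs \<and> xs ! k \<le> s}"
      using that by (auto simp: inj_on_def nth_eq_iff_index_eq)
    ultimately show ?thesis
      by (simp add: card_image)
  qed
  have count: "prefix_count n (lcol C) s + card {k. k < length zs \<and> zs ! k \<le> s} =
      prefix_count n (rcol C) s + card {k. k < length zs \<and> ts ! k \<le> s}" if s: "s \<le> n" for s
  proof -
    have sum: "(\<Sum>j = 1..s. of_bool (j \<in> set xs)) = card {k. k < length xs \<and> xs ! k \<le> s}"
      if "distinct xs" "\<forall>x\<in>set xs. 1 \<le> x" for xs :: "nat list"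
    proof -
      have "{1..s} \<inter> set xs = {x \<in> set xs. x \<le> s}"
        using that(2) by auto
      then show ?thesis
        using index_card[OF that(1), of s] by (simp add: of_bool_def sum.If_cases)
    qed
    have nl: "nth_letter n j = Unbar j" if "j \<in> {1..s}" for j
      using that s by (simp add: nth_letter_def)
    have "prefix_count n (lcol C) s + (\<Sum>j = 1..s. of_bool (j \<in> set zs)) =
        prefix_count n (rcol C) s + (\<Sum>j = 1..s. of_bool (j \<in> set ts))"
      unfolding prefix_count_def sum.distrib[symmetric]
    proof (rule sum.cong[OF refl])
      fix j assume "j \<in> {1..s}"
      then show "of_bool (nth_letter n j \<in> lcol C) + of_bool (j \<in> set zs) =
          (of_bool (nth_letter n j \<in> rcol C) + of_bool (j \<in> set ts) :: nat)"
        using tfree[of j] zs(1) by (auto simp: nl mem)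
    qed
    moreover have "\<forall>z\<in>set zs. 1 \<le> z"
      using zs(1) \<open>?Z \<subseteq> {1..n}\<close> by auto
    ultimately show ?thesis
      using sum[OF zs(2)] sum[OF ts_dist] tfree len by simp
  qed
  show "split_col n (lcol C) (rcol C) C"
    unfolding split_col_def unpaired_def
  proof (intro conjI allI impI ballI)
    show "\<not> (Unbar s \<in> lcol C \<and> Bar s \<in> lcol C)" "\<not> (Unbar s \<in> rcol C \<and> Bar s \<in> rcol C)" for s
      using tfree[of s] zs(1) by (auto simp: mem)
    show "Unbar s \<in> C \<longleftrightarrow> Unbar s \<in> rcol C" "Bar s \<in> C \<longleftrightarrow> Bar s \<in> lcol C" for s
      by (auto simp: mem)
    show "Unbar s \<in> lcol C \<or> Bar s \<in> lcol C \<longleftrightarrow> Unbar s \<in> rcol C \<or> Bar s \<in> rcol C" for s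
      using zs(1) by (auto simp: mem)
    show "prefix_count n (rcol C) s \<le> prefix_count n (lcol C) s" if "s \<le> n" for s
    proof -
      have "card {k. k < length zs \<and> zs ! k \<le> s} \<le> card {k. k < length zs \<and> ts ! k \<le> s}"
        using t(2) by (intro card_mono) (auto intro: order_trans less_imp_le)
      then show ?thesis
        using count[OF that] by simp
    qed
    have "{k. k < length zs \<and> zs ! k \<le> n} = {k. k < length zs}"
      using zs(1) \<open>?Z \<subseteq> {1..n}\<close> nth_mem by fastforce
    moreover have "{k. k < length zs \<and> ts ! k \<le> n} = {k. k < length zs}"
      using t_le len by auto
    ultimately show "prefix_count n (lcol C) n = prefix_count n (rcol C) n"
      using count[of n] by simp
    fix s assume s: "s \<in> {1..n}" "Unbar s \<notin> lcol C \<and> Bar s \<notin> lcol C"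
    then have "?free s" "s \<notin> set ts"
      using zs(1) by (auto simp: mem)
    then have "zs ! k \<le> s \<longleftrightarrow> ts ! k \<le> s" if "k < length zs" for k
      using t(2)[OF that] gap[OF that] by fastforce
    then have "{k. k < length zs \<and> zs ! k \<le> s} = {k. k < length zs \<and> ts ! k \<le> s}"
      by blast
    then show "prefix_count n (lcol C) s = prefix_count n (rcol C) s"
      using count[of s] s by simp
  qed
qed

lemma prefix_count_alphabet: "k \<le> 2 * n \<Longrightarrow> prefix_count n (alphabet n) k = k"
proof -
  assume "k \<le> 2 * n"
  then have "{j \<in> {1..k}. nth_letter n j \<in> alphabet n} = {1..k}"
    by (auto simp: nth_letter_def)
  then show ?thesis
    by (simp add: prefix_count_card)
qed

lemma dominates_alphabet: "dominates n (alphabet n) Y"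
proof -
  have "prefix_count n Y k \<le> k" for k
    by (induction k) auto
  then show ?thesis
    by (simp add: dominates_def prefix_count_alphabet)
qed

lemma symplectic_splittable:
  assumes "letters_in n T" "\<forall>C\<in>set T. admissible C"
    and "\<forall>k. Suc k < length T \<longrightarrow> col_le (rcol (T ! k)) (lcol (T ! Suc k))"
    and "T \<noteq> [] \<longrightarrow> dominates n X (lcol (hd T))"
  shows "splittable n X T"
  using assms
proof (induction T arbitrary: X)
  case (Cons C T)
  have C: "C \<subseteq> alphabet n" "admissible C"
    using Cons.prems(1,2) by simp_all
  have T: "letters_in n T" "\<forall>C\<in>set T. admissible C"
    using Cons.prems(1,2) by simp_all
  have "\<forall>k. Suc k < length T \<longrightarrow> col_le (rcol (T ! k)) (lcol (T ! Suc k))"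
  proof (intro allI impI)
    fix k assume "Suc k < length T"
    then show "col_le (rcol (T ! k)) (lcol (T ! Suc k))"
      using spec[OF Cons.prems(3), of "Suc k"] by simp
  qed
  moreover have "T \<noteq> [] \<longrightarrow> dominates n (rcol C) (lcol (hd T))"
  proof
    assume ne: "T \<noteq> []"
    then have "col_le (rcol C) (lcol (hd T))"
      using spec[OF Cons.prems(3), of 0] by (simp add: hd_conv_nth)
    moreover have "hd T \<subseteq> alphabet n" "admissible (hd T)"
      using T ne by (simp_all add: letters_in_def)
    ultimately show "dominates n (rcol C) (lcol (hd T))"
      by (intro col_le_dominates split_col_lcol_rcol C)
  qed
  ultimately have "splittable n (rcol C) T"
    by (rule Cons.IH[OF T])
  then show ?case
    using split_col_lcol_rcol(1)[OF C] Cons.prems(4) by auto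
qed simp

section \<open>The step on tabloids\<close>

lemma word_append: "word (xs @ ys) = word ys @ word xs"
  by (simp add: word_def)

lemma length_word: "length (word \<tau>) = sum_list (map card \<tau>)"
  by (induction \<tau>) simp_all

lemma col_word_position:
  fixes w :: "letter list"
  assumes "sorted_wrt (<) w" "a \<in> set w"
  shows "card {b \<in> set w. b < a} < length w \<and> w ! card {b \<in> set w. b < a} = a \<and>
    take (card {b \<in> set w. b < a}) w = filter (\<lambda>b. b < a) w"
  using assms
proof (induction w)
  case (Cons c w)
  show ?case
  proof (cases "a = c")
    case True
    then have none: "\<not> b < a" if "b \<in> set (c # w)" for b
      using Cons.prems that by auto
    then have "{b \<in> set (c # w). b < a} = {}" "filter (\<lambda>b. b < a) (c # w) = []"
      by (auto simp: filter_empty_conv simp del: filter.simps)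
    then show ?thesis
      using True by (simp only:) simp
  next
    case False
    then have a: "a \<in> set w" "c < a"
      using Cons.prems by auto
    have "{b \<in> set (c # w). b < a} = insert c {b \<in> set w. b < a}"
      using a by auto
    moreover have "c \<notin> set w"
      using Cons.prems by auto
    ultimately have "card {b \<in> set (c # w). b < a} = Suc (card {b \<in> set w. b < a})"
      by simp
    then show ?thesis
      using Cons a by (simp only:) simp
  qed
qed simp

text \<open>Links the arithmetic position with the word. The last claim lists what is read before
  the letter, which decides whether a blocking letter precedes it.\<close>

lemma word_pos:
  assumes "letters_in n T" "j < length T" "a \<in> T ! j"
  shows "word_pos T j a < length (word T)" "word T ! word_pos T j a = a"
    "set (take (word_pos T j a) (word T)) = \<Union> (set (drop (Suc j) T)) \<union> {b \<in> T ! j. b < a}"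
proof -
  have T: "T = take j T @ T ! j # drop (Suc j) T"
    using assms(2) by (rule id_take_nth_drop)
  have w: "word T = word (drop (Suc j) T) @ col_word (T ! j) @ word (take j T)"
    by (subst T) (simp add: word_append)
  have "letters_in n (drop (Suc j) T)" "finite (T ! j)"
    using assms finite_column[of "T ! j" n] by (auto simp: letters_in_def dest: in_set_dropD)
  note fin = this
  have "length (word (drop (Suc j) T)) = (\<Sum>l\<in>{0..<length T - Suc j}. card (T ! (Suc j + l)))"
    by (simp add: length_word sum_list_sum_nth)
  also have "\<dots> = (\<Sum>l\<in>{j<..<length T}. card (T ! l))"
    by (rule sum.reindex_bij_witness[of _ "\<lambda>l. l - Suc j" "\<lambda>l. Suc j + l"]) auto
  finally have pos: "word_pos T j a = length (word (drop (Suc j) T)) + card {b \<in> T ! j. b < a}"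
    by (simp add: word_pos_def)
  have c: "card {b \<in> T ! j. b < a} < length (col_word (T ! j))"
    "col_word (T ! j) ! card {b \<in> T ! j. b < a} = a"
    "take (card {b \<in> T ! j. b < a}) (col_word (T ! j)) = filter (\<lambda>b. b < a) (col_word (T ! j))"
    using col_word_position[OF sorted_col_word[of "T ! j"], of a] assms(3) fin(2) by auto
  show "word_pos T j a < length (word T)" "word T ! word_pos T j a = a"
    using c(1,2) by (auto simp: pos w nth_append simp del: length_col_word)
  show "set (take (word_pos T j a) (word T)) = \<Union> (set (drop (Suc j) T)) \<union> {b \<in> T ! j. b < a}"
    using c(1,3) fin by (auto simp: pos w set_word[OF fin(1)])
qed

lemma raise_tab_nth:
  "j < length T \<Longrightarrow> raise_tab n i T ! j =
    (if \<Union> (set (drop (Suc j) T)) \<inter> blocking_letters n i = {} then raise_col n i (T ! j) else T ! j)"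
proof (induction T arbitrary: j)
  case (Cons C T)
  then show ?case
    by (cases j) auto
qed simp

lemma length_raise_tab [simp]: "length (raise_tab n i T) = length T"
  by (induction T) auto

lemma raise_number_card:
  assumes "i \<le> n"
  shows "raise_number n i w = card {p. p < length w \<and> w ! p \<in> raised_letters n i \<and>
    (\<forall>m\<le>p. w ! m \<notin> blocking_letters n i)}"
proof (induction w)
  case (Cons a w)
  let ?P = "\<lambda>w p. p < length w \<and> w ! p \<in> raised_letters n i \<and> (\<forall>m\<le>p. w ! m \<notin> blocking_letters n i)"
  show ?case
  proof (cases "a \<in> blocking_letters n i")
    case True
    then have "{p. ?P (a # w) p} = {}"
      by auto
    then show ?thesis
      using True by simp
  next
    case False
    have "(\<forall>m\<le>Suc p. (a # w) ! m \<notin> blocking_letters n i) \<longleftrightarrow> (\<forall>m\<le>p. w ! m \<notin> blocking_letters n i)" for p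
    proof
      assume *: "\<forall>m\<le>Suc p. (a # w) ! m \<notin> blocking_letters n i"
      show "\<forall>m\<le>p. w ! m \<notin> blocking_letters n i"
        using * by (metis Suc_le_mono nth_Cons_Suc)
    next
      assume *: "\<forall>m\<le>p. w ! m \<notin> blocking_letters n i"
      show "\<forall>m\<le>Suc p. (a # w) ! m \<notin> blocking_letters n i"
        using * False by (auto simp: nth_Cons split: nat.split)
    qed
    then have S: "?P (a # w) (Suc p) \<longleftrightarrow> ?P w p" for p
      by simp
    have "{p. ?P (a # w) p} = (if a \<in> raised_letters n i then {0} else {}) \<union> Suc ` {p. ?P w p}"
    proof (rule set_eqI)
      fix p
      show "p \<in> {p. ?P (a # w) p} \<longleftrightarrow>
          p \<in> (if a \<in> raised_letters n i then {0} else {}) \<union> Suc ` {p. ?P w p}"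
      proof (cases p)
        case 0
        then show ?thesis
          using False by auto
      next
        case (Suc p')
        then show ?thesis
          using S[of p'] by auto
      qed
    qed
    moreover have "card ((if a \<in> raised_letters n i then {0} else {}) \<union> Suc ` {p. ?P w p}) =
        of_bool (a \<in> raised_letters n i) + card {p. ?P w p}"
      by (subst card_Un_disjoint) (auto simp: card_image)
    ultimately show ?thesis
      using False Cons by simp
  qed
qed simp

section \<open>Locating the active letter\<close>

lemma tabloids_iff: "T \<in> tabloids n lam \<longleftrightarrow> letters_in n T \<and> map card T = heights n lam"
  unfolding tabloids_def columns_def letters_in_def all_set_conv_all_nth list_eq_iff_nth_eq
  by (simp add: list_all2_conv_all_nth) metis

lemma heights_le: "p \<in> set (heights n lam) \<Longrightarrow> p \<le> n"
  by (auto simp: heights_def)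

text \<open>A letter that is not movable has its predecessor in the column, so the letters below the
  smallest movable one form an initial segment of the alphabet, which by the last assumption
  stops before the barred letters.\<close>

lemma not_movable_initial:
  assumes "C \<subseteq> alphabet n" "D \<subseteq> C" "\<And>y z. y \<in> D \<Longrightarrow> z \<in> C \<Longrightarrow> z < y \<Longrightarrow> z \<in> D"
    and "\<And>y. y \<in> D \<Longrightarrow> \<not> movable n C y"
    and "\<And>s. 1 \<le> s \<Longrightarrow> s \<le> n \<Longrightarrow> (\<And>j. 1 \<le> j \<Longrightarrow> j \<le> s \<Longrightarrow> Unbar j \<in> C) \<Longrightarrow> Bar s \<notin> C"
    and "y \<in> D"
  shows "\<exists>b. y = Unbar b \<and> (\<forall>j. 1 \<le> j \<longrightarrow> j \<le> b \<longrightarrow> Unbar j \<in> C)"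
proof -
  have pred: "pred_letter n y \<in> C" if "y \<in> D" "y \<noteq> Unbar 1" for y
    using assms(2,4) that by (auto simp: movable_def)
  have unbar: "Unbar b \<in> D \<Longrightarrow> 1 \<le> j \<Longrightarrow> j \<le> b \<Longrightarrow> Unbar j \<in> C" for b j
  proof (induction b)
    case (Suc b)
    show ?case
    proof (cases "j = Suc b")
      case False
      then have "1 \<le> b" "j \<le> b"
        using Suc.prems by auto
      then have "Unbar b \<in> D"
        using pred[OF Suc.prems(1)] assms(3)[OF Suc.prems(1), of "Unbar b"] by simp
      then show ?thesis
        using Suc.IH Suc.prems(2) \<open>j \<le> b\<close> by simp
    qed (use Suc.prems assms(2) in auto)
  qed simp
  have bar: "Bar s \<notin> D" for s
  proof (induction "n - s" arbitrary: s rule: less_induct)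
    case less
    show ?case
    proof
      assume s: "Bar s \<in> D"
      then have sn: "1 \<le> s" "s \<le> n"
        using assms(1,2) by auto
      show False
      proof (cases "s = n")
        case True
        then have "Unbar n \<in> D"
          using pred[OF s] assms(3)[OF s, of "Unbar n"] by simp
        then show False
          using unbar[of n] assms(5)[of n] sn s True assms(2) by blast
      next
        case False
        then have "Bar (s + 1) \<in> D"
          using pred[OF s] assms(3)[OF s, of "Bar (s + 1)"] by simp
        moreover have "n - (s + 1) < n - s"
          using sn False by linarith
        ultimately show False
          using less by blast
      qed
    qed
  qed
  show ?thesis
    using assms(6) unbar bar by (cases y) auto
qed

lemma initial_hw_column:
  assumes "C \<subseteq> alphabet n"
    and "\<And>y. y \<in> C \<Longrightarrow> \<exists>b. y = Unbar b \<and> (\<forall>j. 1 \<le> j \<longrightarrow> j \<le> b \<longrightarrow> Unbar j \<in> C)"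
  shows "C = hw_column (card C)"
proof -
  define B where "B = {b. Unbar b \<in> C}"
  have B: "C = Unbar ` B"
    using assms(2) unfolding B_def by blast
  have fin: "finite B" "card B = card C"
    using B finite_column[OF assms(1)] by (auto simp: finite_image_iff inj_on_def card_image)
  have "\<exists>m. B = {1..m}"
  proof (cases "B = {}")
    case False
    have "B = {1..Max B}"
    proof
      show "B \<subseteq> {1..Max B}"
        using fin assms(1) by (auto simp: B_def)
      show "{1..Max B} \<subseteq> B"
        using Max_in[OF fin(1) False] assms(2)[of "Unbar (Max B)"] by (auto simp: B_def)
    qed
    then show ?thesis ..
  qed (auto intro: exI[of _ 0])
  then show ?thesis
    using B fin(2) by (auto simp: hw_column_def)
qed

text \<open>All letters read before the active letter x are unbarred and smaller than i, hence
  neither raised nor blocking. The factor from x to y may therefore be extended to the beginning of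
  the word, where it becomes the prefix treated by \<open>raise_word\<close>.\<close>

lemma next_tabloid_raise_tab:
  assumes T: "T \<in> tabloids n lam" "splittable n (alphabet n) T" "T \<noteq> hw_tabloid n lam"
  defines "i \<equiv> active_idx n T"
  shows "1 \<le> i" "i \<le> n" "next_tabloid n T = raise_tab n i T"
    "raise_count n T = raise_number n i (word T)" "raise_number n i (word T) > 0"
proof -
  have lt: "letters_in n T" and card_T: "map card T = heights n lam"
    using T(1) by (auto simp: tabloids_iff)
  define K where "K = {k. k < length T \<and> T ! k \<noteq> hw_column (card (T ! k))}"
  define k where "k = active_col T"
  have "K \<noteq> {}"
  proof
    assume "K = {}"
    then have "T = map (hw_column \<circ> card) T"
      by (intro nth_equalityI) (auto simp: K_def)
    then show False
      using T(3) card_T unfolding hw_tabloid_def by (metis map_map)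
  qed
  moreover have "finite K"
    by (simp add: K_def)
  ultimately have "k \<in> K" and k_max: "\<And>j. j \<in> K \<Longrightarrow> j \<le> k"
    using Max_in[of K] Max_ge[of K] by (simp_all add: k_def active_col_def K_def)
  then have k: "k < length T" "T ! k \<noteq> hw_column (card (T ! k))"
    by (simp_all add: K_def)
  define C where "C = T ! k"
  have C: "C \<subseteq> alphabet n"
    using lt k(1) by (auto simp: letters_in_def C_def)
  obtain L R where LR: "split_col n L R C" "splittable n R (drop (Suc k) T)"
    using splittable_nth[OF T(2) k(1)] by (auto simp: C_def)
  have lite: "Bar s \<notin> C" if "1 \<le> s" "s \<le> n" "\<And>j. 1 \<le> j \<Longrightarrow> j \<le> s \<Longrightarrow> Unbar j \<in> C" for s
    using split_col_initial[OF LR(1)] that by blast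
  define x where "x = active_letter n T"
  have M: "{x. movable n C x} \<noteq> {}" "finite {x. movable n C x}"
  proof -
    show "{x. movable n C x} \<noteq> {}"
    proof
      assume none: "{x. movable n C x} = {}"
      have "C = hw_column (card C)"
        by (rule initial_hw_column[OF C], rule not_movable_initial[OF C order_refl]) (use none lite in auto)
      then show False
        using k by (simp add: C_def)
    qed
    show "finite {x. movable n C x}"
      by (rule finite_subset[OF _ finite_column[OF C]]) (auto simp: movable_def)
  qed
  have x_eq: "x = Min {x. movable n C x}"
    by (simp add: x_def active_letter_def C_def k_def)
  then have x: "movable n C x"
    using Min_in[OF M(2,1)] by simp
  have x_min: "\<not> movable n C y" if "y < x" for y
    using Min_le[OF M(2), of y] that by (auto simp: x_eq)
  have xC: "x \<in> C" "x \<noteq> Unbar 1" "pred_letter n x \<notin> C"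
    using x by (auto simp: movable_def)
  \<comment> \<open>Some letter among 1, ..., i is missing in C: the predecessor of x if x =
    \<open>Unbar (i + 1)\<close>, and otherwise by \<open>lite\<close>, since \<open>Bar i\<close>
    is in C. It bounds the initial segments below.\<close>
  have "1 \<le> i \<and> i \<le> n \<and> x \<in> raised_letters n i \<and> \<not> (\<forall>j. 1 \<le> j \<longrightarrow> j \<le> i \<longrightarrow> Unbar j \<in> C)"
  proof (cases x)
    case (Unbar j)
    then have "2 \<le> j" "j \<le> n" "i = j - 1"
      using xC(1,2) C by (auto simp: i_def active_idx_def x_def[symmetric] le_less Suc_le_eq numeral_2_eq_2)
    moreover from this have "\<not> (\<forall>j. 1 \<le> j \<longrightarrow> j \<le> i \<longrightarrow> Unbar j \<in> C)"
      using xC(3) Unbar by (intro notI) (auto dest!: spec[of _ i])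
    ultimately show ?thesis
      using Unbar by (auto simp: raised_letters_def)
  next
    case (Bar j)
    then have j: "1 \<le> j" "j \<le> n" "i = j"
      using xC(1) C by (auto simp: i_def active_idx_def x_def[symmetric])
    then have "\<not> (\<forall>j. 1 \<le> j \<longrightarrow> j \<le> i \<longrightarrow> Unbar j \<in> C)"
      using lite[of i] xC(1) Bar by blast
    then show ?thesis
      using j Bar by (auto simp: raised_letters_def)
  qed
  then have i: "1 \<le> i" "i \<le> n" and x_raised: "x \<in> raised_letters n i"
    and missing: "\<not> (\<forall>j. 1 \<le> j \<longrightarrow> j \<le> i \<longrightarrow> Unbar j \<in> C)"
    by auto
  show "1 \<le> i" "i \<le> n"
    by fact+
  let ?rs = "raised_letters n i" and ?bl = "blocking_letters n i" and ?w = "word T"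
  have small: "a \<notin> ?rs \<and> a \<notin> ?bl" if "a \<in> Unbar ` {..<i}" for a
    using that i by (auto simp: raised_letters_def blocking_letters_def)
  have below: "\<exists>b. y = Unbar b \<and> (\<forall>j. 1 \<le> j \<longrightarrow> j \<le> b \<longrightarrow> Unbar j \<in> C)" if "y \<in> C" "y < x" for y
    by (rule not_movable_initial[OF C, of "{y \<in> C. y < x}"]) (use that x_min lite in auto)
  have before_C: "y \<in> Unbar ` {..<i}" if y: "y \<in> C" "y < x" for y
  proof -
    obtain b where b: "y = Unbar b" "\<forall>j. 1 \<le> j \<longrightarrow> j \<le> b \<longrightarrow> Unbar j \<in> C"
      using below[OF y] by blast
    then have "b < i"
      using missing by (metis le_trans not_less)
    then show ?thesis
      using b by simp
  qed
  \<comment> \<open>Columns to the right of C have highest weight, so they are initial segments. The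
    invariant places them inside the unbarred part of C, and the missing letter keeps them below
    i.\<close>
  have before_D: "y \<in> Unbar ` {..<i}" if D: "D \<in> set (drop (Suc k) T)" "y \<in> D" for D y
  proof -
    have hw: "\<forall>D\<in>set (drop (Suc k) T). D = hw_column (card D) \<and> card D \<le> n"
    proof
      fix D assume "D \<in> set (drop (Suc k) T)"
      then obtain l where "l < length T - Suc k" "D = T ! (Suc k + l)"
        by (auto simp: in_set_conv_nth)
      then obtain j where j: "Suc k \<le> j" "j < length T" "D = T ! j"
        by (metis le_add1 less_diff_conv2 less_diff_conv add.commute)
      then have "D = hw_column (card D)"
        using k_max[of j] by (auto simp: K_def)
      moreover have "card D \<in> set (map card T)"
        using j by simp
      ultimately show "D = hw_column (card D) \<and> card D \<le> n"
        using heights_le card_T by metis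
    qed
    have sub: "Unbar s \<in> C" if "Unbar s \<in> D" for s
      using splittable_hw[OF LR(2) hw D(1) that] LR(1)
      by (simp add: split_col_def)
    obtain s where s: "y = Unbar s" "1 \<le> s" "s \<le> card D" and DD: "D = hw_column (card D)"
      using hw D unfolding hw_column_def by (metis atLeastAtMost_iff imageE)
    have "s < i"
    proof (rule ccontr)
      assume "\<not> s < i"
      then have "Unbar j \<in> D" if "1 \<le> j" "j \<le> i" for j
        using s that by (subst DD) (simp add: hw_column_def)
      then show False
        using sub missing by blast
    qed
    then show ?thesis
      using s by simp
  qed
  define st where "st = start_pos n T"
  have st: "st = word_pos T k x"
    by (simp add: st_def start_pos_def k_def x_def)
  have st_len: "st < length ?w" and st_x: "?w ! st = x"
    using word_pos[OF lt k(1), of x] xC(1) by (auto simp: st C_def)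
  have before: "?w ! m \<in> Unbar ` {..<i}" if "m < st" for m
  proof -
    have "?w ! m \<in> set (take st ?w)"
      using that st_len by (auto simp: in_set_conv_nth)
    then show ?thesis
      using word_pos(3)[OF lt k(1), of x] xC(1) before_C before_D by (auto simp: st C_def)
  qed
  define S where "S = {p. st \<le> p \<and> p < length ?w \<and> ?w ! p \<in> ?rs \<and> (\<forall>m\<in>{st..p}. ?w ! m \<notin> ?bl)}"
  define en where "en = end_pos n T"
  have en: "en = Max S"
    by (simp add: en_def end_pos_def S_def st_def i_def)
  have "st \<in> S"
    using st_len st_x x_raised raised_not_blocking[OF i(2)] by (auto simp: S_def)
  moreover have "finite S"
    by (simp add: S_def)
  ultimately have enS: "en \<in> S" and en_max: "\<And>p. p \<in> S \<Longrightarrow> p \<le> en"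
    using Max_in[of S] Max_ge[of S] unfolding en by blast+
  \<comment> \<open>For positions of raised letters, lying in the factor means that no blocking
    letter occurs up to there, counted from the start of the word.\<close>
  have key: "p \<in> {st..en} \<longleftrightarrow> (\<forall>m\<le>p. ?w ! m \<notin> ?bl)" if p: "p < length ?w" "?w ! p \<in> ?rs" for p
  proof
    assume "p \<in> {st..en}"
    then show "\<forall>m\<le>p. ?w ! m \<notin> ?bl"
      using enS before small by (auto simp: S_def)
  next
    assume *: "\<forall>m\<le>p. ?w ! m \<notin> ?bl"
    have "st \<le> p"
      using before[of p] small[of "?w ! p"] p by (metis not_less)
    then have "p \<in> S"
      using p * by (auto simp: S_def)
    then show "p \<in> {st..en}"
      using en_max \<open>st \<le> p\<close> by simp
  qed
  have count: "{m \<in> {st..en}. ?w ! m \<in> ?rs} =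
      {p. p < length ?w \<and> ?w ! p \<in> ?rs \<and> (\<forall>m\<le>p. ?w ! m \<notin> ?bl)}"
  proof -
    have en: "en < length ?w"
      using enS by (simp add: S_def)
    have "p \<in> {st..en} \<and> ?w ! p \<in> ?rs \<longleftrightarrow>
        p < length ?w \<and> ?w ! p \<in> ?rs \<and> (\<forall>m\<le>p. ?w ! m \<notin> ?bl)" for p
      using key[of p] en by (meson atLeastAtMost_iff le_less_trans)
    then show ?thesis
      by blast
  qed
  have "raise_count n T = card {m \<in> {st..en}. ?w ! m \<in> ?rs}"
    by (simp add: raise_count_def st_def en_def i_def)
  then show "raise_count n T = raise_number n i ?w"
    unfolding count raise_number_card[OF i(2)] .
  have "st \<in> {m \<in> {st..en}. ?w ! m \<in> ?rs}"
    using en_max[OF \<open>st \<in> S\<close>] st_x x_raised by simp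
  then have "card {m \<in> {st..en}. ?w ! m \<in> ?rs} > 0"
    unfolding card_gt_0_iff by (intro conjI) (blast, simp)
  then show "raise_number n i ?w > 0"
    unfolding count raise_number_card[OF i(2)] .
  show "next_tabloid n T = raise_tab n i T"
  proof (rule nth_equalityI)
    show "length (next_tabloid n T) = length (raise_tab n i T)"
      by (simp add: next_tabloid_def)
    fix j assume "j < length (next_tabloid n T)"
    then have j: "j < length T"
      by (simp add: next_tabloid_def)
    let ?free = "\<Union> (set (drop (Suc j) T)) \<inter> ?bl = {}"
    have "word_pos T j a \<in> {st..en} \<longleftrightarrow> ?free \<and> a \<in> raisable n i (T ! j)"
      if a: "a \<in> T ! j" "a \<in> ?rs" for a
    proof -
      let ?p = "word_pos T j a"
      have p: "?p < length ?w" "?w ! ?p = a"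
        "set (take ?p ?w) = \<Union> (set (drop (Suc j) T)) \<union> {b \<in> T ! j. b < a}"
        using word_pos[OF lt j a(1)] by auto
      have "(\<forall>m\<le>?p. ?w ! m \<notin> ?bl) \<longleftrightarrow> (\<forall>m<?p. ?w ! m \<notin> ?bl)"
        using p(2) a(2) raised_not_blocking[OF i(2)] by (auto simp: le_less)
      also have "\<dots> \<longleftrightarrow> (\<forall>b\<in>(!) ?w ` {0..<?p}. b \<notin> ?bl)"
        by auto
      also have "\<dots> \<longleftrightarrow> set (take ?p ?w) \<inter> ?bl = {}"
        unfolding nth_image[OF less_imp_le[OF p(1)]] by blast
      also have "\<dots> \<longleftrightarrow> ?free \<and> a \<in> raisable n i (T ! j)"
        unfolding p(3) using a by (auto simp: raisable_def)
      finally show ?thesis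
        using key[of ?p] p a by simp
    qed
    then have "(\<lambda>a. if word_pos T j a \<in> {st..en} \<and> a \<in> ?rs then pred_letter n a else a) ` (T ! j) =
        (\<lambda>a. if ?free \<and> a \<in> raisable n i (T ! j) then pred_letter n a else a) ` (T ! j)"
      by (intro image_cong) (auto simp: raisable_def)
    also have "\<dots> = (if ?free then raise_col n i (T ! j) else T ! j)"
      by (auto simp: raise_col_def raisable_def)
    finally show "next_tabloid n T ! j = raise_tab n i T ! j"
      using j by (simp add: next_tabloid_def raise_tab_nth st_def en_def i_def)
  qed
qed


section \<open>The expansion of the monomial vectors\<close>

text \<open>Position in the alphabet. The sum over a word falls by the number of raised letters,
  which makes it the termination measure.\<close>

fun letter_rank :: "nat \<Rightarrow> letter \<Rightarrow> nat" where
  "letter_rank n (Unbar j) = j"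
| "letter_rank n (Bar j) = 2 * n + 1 - j"

lemma lowered_rank:
  assumes "lowered n i r w w'" "1 \<le> i" "i \<le> n"
  shows "sum_list (map (letter_rank n) w') = sum_list (map (letter_rank n) w) + r"
  using assms
proof (induction rule: lowered.induct)
  case (lower b r w w')
  have "letter_rank n b = Suc (letter_rank n (pred_letter n b))"
    using lower(1,4,5) by (cases rule: raised_cases) auto
  then show ?case
    using lower by simp
qed simp_all

text \<open>The heights show where the word is to be cut. This turns the uniqueness statement for
  words into one for tabloids.\<close>

lemma word_inject:
  "letters_in n \<sigma> \<Longrightarrow> letters_in n \<tau> \<Longrightarrow> map card \<sigma> = map card \<tau> \<Longrightarrow> word \<sigma> = word \<tau> \<Longrightarrow> \<sigma> = \<tau>"
proof (induction \<sigma> arbitrary: \<tau>)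
  case (Cons C \<sigma>)
  then obtain D \<rho> where \<tau>: "\<tau> = D # \<rho>"
    by (cases \<tau>) auto
  have "length (word \<sigma>) = length (word \<rho>)"
    using Cons.prems(3) \<tau> by (simp add: length_word)
  then have "word \<sigma> = word \<rho>" "col_word C = col_word D"
    using Cons.prems(4) \<tau> by auto
  then show ?case
    using Cons \<tau> by simp (metis finite_column set_col_word)
qed simp

section \<open>Recursion along the steps and the triangular expansion\<close>

lemma monomial_vector_hw: "monomial_vector n lam (hw_tabloid n lam) = basis_vec (hw_tabloid n lam)"
proof -
  have "step_count n lam (hw_tabloid n lam) = 0"
    unfolding step_count_def by (rule Least_eq_0) simp
  then show ?thesis
    by (simp add: monomial_vector_def)
qed

text \<open>The second hypothesis is essential because \<open>step_count\<close> is a LEAST: without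
  some s that reaches the highest weight it would be unspecified.\<close>

lemma monomial_vector_step:
  assumes "T \<noteq> hw_tabloid n lam" "(next_tabloid n ^^ s) (next_tabloid n T) = hw_tabloid n lam"
  shows "monomial_vector n lam T =
    f_div n (active_idx n T) (raise_count n T) (monomial_vector n lam (next_tabloid n T))"
proof -
  have shift: "(next_tabloid n ^^ Suc k) T = (next_tabloid n ^^ k) (next_tabloid n T)" for k
    by (simp add: funpow_swap1)
  have "step_count n lam T = Suc (step_count n lam (next_tabloid n T))"
    unfolding step_count_def shift[symmetric]
    by (rule Least_Suc[of _ "Suc s"]) (use assms in \<open>simp_all only: shift funpow_0 not_False_eq_True\<close>)
  then have "[0..<step_count n lam T] = 0 # map Suc [0..<step_count n lam (next_tabloid n T)]"
    by (simp only: map_Suc_upt upt_conv_Cons zero_less_Suc)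
  then show ?thesis
    unfolding monomial_vector_def by (simp only: foldr_Cons foldr_map o_def shift funpow_0)
qed

text \<open>Termination is proved in the same induction, since the recursion for the monomial vector
  is available only once the steps are known to end.\<close>

lemma monomial_vector_expansion:
  assumes "T \<in> tabloids n lam" "splittable n (alphabet n) T"
  defines "A \<equiv> monomial_vector n lam T"
  shows "(\<exists>s. (next_tabloid n ^^ s) T = hw_tabloid n lam) \<and>
    Poly_Mapping.lookup A T = 1 \<and>
    (\<forall>\<tau>. Poly_Mapping.lookup A \<tau> \<in> nat_laurent) \<and>
    (\<forall>\<tau>. Poly_Mapping.lookup A \<tau> \<noteq> 0 \<longrightarrow> \<tau> \<in> tabloids n lam \<and> tabloid_le \<tau> T \<and>
      (\<forall>j. word_weight n j (word \<tau>) = word_weight n j (word T)))"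
  using assms(1,2) unfolding A_def
proof (induction "sum_list (map (letter_rank n) (word T))" arbitrary: T rule: less_induct)
  case less
  show ?case
  proof (cases "T = hw_tabloid n lam")
    case True
    have "(next_tabloid n ^^ 0) T = hw_tabloid n lam"
      using True by simp
    moreover have "tabloid_le T T"
      by (simp add: tabloid_le_def lexordp_eq_refl)
    ultimately show ?thesis
      using True less.prems(1) unfolding True monomial_vector_hw
      by (auto simp: lookup_basis_vec intro: exI[of _ 0])
  next
    case False
    define i r T1 where "i = active_idx n T" and "r = raise_count n T" and "T1 = next_tabloid n T"
    note step = next_tabloid_raise_tab[OF less.prems False, folded i_def r_def T1_def]
    note i = step(1,2)
    have T: "letters_in n T" "map card T = heights n lam"
      using less.prems(1) by (auto simp: tabloids_iff)
    have T1: "word T1 = raise_word n i (word T)" "letters_in n T1" "map card T1 = map card T"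
      using raise_tab[OF i T(1)] step(3) by auto
    have low: "lowered n i r (word T1) (word T)"
      using raise_word_lowered[of n i "word T"] step(4) T1(1) by simp
    have "sum_list (map (letter_rank n) (word T1)) < sum_list (map (letter_rank n) (word T))"
      using lowered_rank[OF low i] step(4,5) by simp
    moreover have "T1 \<in> tabloids n lam"
      using T1 T by (simp add: tabloids_iff)
    moreover have "splittable n (alphabet n) T1"
      using splittable_raise_tab[OF i less.prems(2) raised_from_refl] stable_alphabet[OF i] step(3) by simp
    ultimately obtain s where s: "(next_tabloid n ^^ s) T1 = hw_tabloid n lam"
      and IH: "Poly_Mapping.lookup (monomial_vector n lam T1) T1 = 1"
        "\<And>\<tau>. Poly_Mapping.lookup (monomial_vector n lam T1) \<tau> \<in> nat_laurent"
        "\<And>\<tau>. Poly_Mapping.lookup (monomial_vector n lam T1) \<tau> \<noteq> 0 \<Longrightarrow>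
          \<tau> \<in> tabloids n lam \<and> tabloid_le \<tau> T1 \<and>
          (\<forall>j. word_weight n j (word \<tau>) = word_weight n j (word T1))"
      using less.hyps[of T1] by blast
    let ?A = "monomial_vector n lam T1"
    have A: "monomial_vector n lam T = f_div n i r ?A"
      using monomial_vector_step[OF False, of s] s by (simp add: i_def r_def T1_def)
    have tab: "letters_in n \<tau>" "map card \<tau> = map card T" "tabloid_le \<tau> T1"
      "word_weight n j (word \<tau>) = word_weight n j (word T1)" if "\<tau> \<in> Poly_Mapping.keys ?A" for \<tau> j
      using IH(3)[of \<tau>] that T by (auto simp: in_keys_iff tabloids_iff)
    have expand: "Poly_Mapping.lookup (f_div n i r ?A) \<tau>' =
        (\<Sum>\<tau>\<in>Poly_Mapping.keys ?A. Poly_Mapping.lookup ?A \<tau> * Poly_Mapping.lookup (fdiv_tab n i r \<tau>) \<tau>')" for \<tau>'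
      by (subst f_div_expand) (simp add: lookup_sum f_div_basis[OF i tab(1)])
    \<comment> \<open>The bound and the uniqueness both come from \<open>lowered_lex\<close>, with
      the word of the term in A(T1) as u; the induction hypothesis supplies its comparison with
      T1.\<close>
    have main: "\<tau>' \<in> tabloids n lam \<and> tabloid_le \<tau>' T \<and> (\<tau>' = T \<longrightarrow> \<tau> = T1) \<and>
        (\<forall>j. word_weight n j (word \<tau>') = word_weight n j (word T))"
      if \<tau>: "\<tau> \<in> Poly_Mapping.keys ?A" and nz: "Poly_Mapping.lookup (fdiv_tab n i r \<tau>) \<tau>' \<noteq> 0" for \<tau> \<tau>'
    proof -
      have \<tau>': "letters_in n \<tau>'" "map card \<tau>' = map card \<tau>" "lowered n i r (word \<tau>) (word \<tau>')"
        using fdiv_tab_support[OF i tab(1)[OF \<tau>] nz] by auto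
      have "lexordp_eq (word \<tau>') (word T) \<and> (word \<tau>' = word T \<longrightarrow> word \<tau> = raise_word n i (word T))"
      proof (rule lowered_lex[OF i])
        show "lowered n i (raise_number n i (word T)) (word \<tau>) (word \<tau>')"
          using \<tau>'(3) step(4) by simp
        show "lexordp_eq (word \<tau>) (raise_word n i (word T))"
          using tab(3)[OF \<tau>] T1(1) by (simp add: tabloid_le_def)
        show "set (word T) \<subseteq> alphabet n" "set (word \<tau>) \<subseteq> alphabet n"
          using letters_in_word T(1) tab(1)[OF \<tau>] by auto
        show "length (word \<tau>) = length (word T)"
          using tab(2)[OF \<tau>] by (simp add: length_word)
      qed
      then have "tabloid_le \<tau>' T" "\<tau>' = T \<longrightarrow> \<tau> = T1"
        using word_inject[OF tab(1)[OF \<tau>] T1(2)] tab(2)[OF \<tau>] T1(1,3) by (auto simp: tabloid_le_def)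
      moreover have "\<tau>' \<in> tabloids n lam"
        using \<tau>' tab(2)[OF \<tau>] T by (simp add: tabloids_iff)
      moreover have "word_weight n j (word \<tau>') = word_weight n j (word T)" for j
        using lowered_weight[OF \<tau>'(3) i, of j] lowered_weight[OF low i, of j] tab(4)[OF \<tau>, of j] by simp
      ultimately show ?thesis
        by blast
    qed
    have T1_key: "T1 \<in> Poly_Mapping.keys ?A"
      using IH(1) by (simp add: in_keys_iff)
    \<comment> \<open>By uniqueness no term of A(T1) other than T1 itself reaches T.\<close>
    have "Poly_Mapping.lookup (f_div n i r ?A) T =
        (\<Sum>\<tau>\<in>{T1}. Poly_Mapping.lookup ?A \<tau> * Poly_Mapping.lookup (fdiv_tab n i r \<tau>) T)"
      unfolding expand by (rule sum.mono_neutral_right) (use T1_key main in auto)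
    then have lead: "Poly_Mapping.lookup (f_div n i r ?A) T = 1"
      using fdiv_tab_raise_tab[OF i T(1)] step(3,4) IH(1) by simp
    have nat: "Poly_Mapping.lookup (f_div n i r ?A) \<tau>' \<in> nat_laurent" for \<tau>'
      unfolding expand by (intro nat_laurent_sum nat_laurent_mult IH(2) fdiv_tab_nat_laurent[OF i])
    have supp: "\<exists>\<tau>\<in>Poly_Mapping.keys ?A. Poly_Mapping.lookup (fdiv_tab n i r \<tau>) \<tau>' \<noteq> 0"
      if "Poly_Mapping.lookup (f_div n i r ?A) \<tau>' \<noteq> 0" for \<tau>'
      using that unfolding expand by (metis (no_types, lifting) mult_zero_right sum.neutral)
    have "(next_tabloid n ^^ Suc s) T = hw_tabloid n lam"
      using s by (simp add: funpow_swap1 T1_def)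
    then show ?thesis
      unfolding A using lead nat supp main by blast
  qed
qed

lemma has_weight_word_weight:
  assumes "letters_in n \<tau>" "\<And>j. word_weight n j (word \<tau>) = \<mu> j"
  shows "has_weight n (basis_vec \<tau>) \<mu>"
  using assms by (simp add: has_weight_def qh_basis letters_in_tab_weight)

theorem proposition4p2p3:
  fixes n :: nat and lam :: "nat \<Rightarrow> nat" and T :: tabloid
  assumes "n \<ge> 1"
    and "T \<in> symplectic_tableaux n lam"
  shows "\<exists>\<alpha> :: tabloid \<Rightarrow> ratfun.
    monomial_vector n lam T = (\<Sum>\<tau>\<in>tabloids n lam. scale (\<alpha> \<tau>) (basis_vec \<tau>)) \<and>
    (\<forall>\<tau>\<in>tabloids n lam. \<alpha> \<tau> \<noteq> 0 \<longrightarrow> same_weight n \<tau> T) \<and>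
    (\<forall>\<tau>\<in>tabloids n lam. \<alpha> \<tau> \<in> nat_laurent) \<and> \<alpha> T = 1 \<and>
    (\<forall>\<tau>\<in>tabloids n lam. \<alpha> \<tau> \<noteq> 0 \<longrightarrow> tabloid_le \<tau> T)"
proof -
  let ?A = "monomial_vector n lam T"
  have T: "T \<in> tabloids n lam" "letters_in n T"
    using assms(2) by (auto simp: symplectic_tableaux_def tabloids_iff)
  \<comment> \<open>The full alphabet dominates every column and is stable under every reflection,
    so it can bound the tabloid on the left throughout.\<close>
  have "splittable n (alphabet n) T"
    using assms(2) T(2)
    by (intro symplectic_splittable) (auto simp: symplectic_tableaux_def dominates_alphabet)
  note expansion = monomial_vector_expansion[OF T(1) this]
  have A: "Poly_Mapping.lookup ?A T = 1" "\<And>\<tau>. Poly_Mapping.lookup ?A \<tau> \<in> nat_laurent"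
    "\<And>\<tau>. Poly_Mapping.lookup ?A \<tau> \<noteq> 0 \<Longrightarrow> \<tau> \<in> tabloids n lam \<and> tabloid_le \<tau> T \<and>
      (\<forall>j. word_weight n j (word \<tau>) = word_weight n j (word T))"
    using expansion by blast+
  have "?A = (\<Sum>\<tau>\<in>tabloids n lam. scale (Poly_Mapping.lookup ?A \<tau>) (basis_vec \<tau>))"
    by (rule poly_mapping_eqI)
       (use A(3) in \<open>auto simp: lookup_sum lookup_basis_vec mult_delta_right finite_tabloids\<close>)
  moreover have "same_weight n \<tau> T" if "Poly_Mapping.lookup ?A \<tau> \<noteq> 0" for \<tau>
    using A(3)[OF that] T(2) unfolding same_weight_def
    by (intro exI[of _ "\<lambda>j. word_weight n j (word T)"]) (simp add: has_weight_word_weight tabloids_iff)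
  ultimately show ?thesis
    using A by (intro exI[of _ "Poly_Mapping.lookup ?A"]) blast
qed

end
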